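(* Let $\mathbb M$ and $\mathbb H$ be partial groups, and let $\alpha\colon\mathbb H\to B\mathrm{Out}(\mathbb M)$ be an outer action (a homomorphism of partial groups). Let $\mathcal E(\mathbb M,\mathbb H,\alpha)$ be the set of equivalence classes of extensions of $\mathbb H$ by $\mathbb M$ with induced outer action $\alpha$. Then the following holds. (a) The set $\mathcal E(\mathbb M,\mathbb H,\alpha)$ is nonempty if and only if the obstruction class $[\kappa]\in H^3(\mathbb H;Z(\mathbb M))$ (defined in the context) vanishes. (b) If $\mathcal E(\mathbb M,\mathbb H,\alpha)$ is not empty, then $H^2(\mathbb H;Z(\mathbb M))$ acts freely and transitively on this set.
   Context: Partial groups. A partial monoid is a nonempty simplicial set $\mathbb M$ with exactly one vertex $v$ such that for all $n\ge1$ the spine map $\mathbb M_n\to(\mathbb M_1)^n$, whose $i$-th component is induced by the map $[1]\to[n]$ with image $\{i-1,i\}$, is injective. The $n$-simplex with spine $(x_1,\dots,x_n)$ is written $[x_1|\dots|x_n]$. $\Pi\colon\mathbb M_n\to\mathbb M_1$ is induced by $[1]\to[n]$ with image $\{0,n\}$; one writes $x_1\cdots x_n=\Pi[x_1|\dots|x_n]$, and $1=s_0(v)$. A partial group is a partial monoid with an inversion: a simplicial map $\nu\colon\mathbb M\to\mathbb M^{\mathrm{op}}$ with $\nu^{-1}=\nu^{\mathrm{op}}$ such that for every $u\in\mathbb M_n$, $n\ge1$, there is a simplex $[\nu(u)|u]\in\mathbb M_{2n}$ (concatenated spines) with $\Pi[\nu(u)|u]=1$; $u^{-1}=\nu(u)$.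 Homomorphisms are simplicial maps. For a group $G$, $BG$ is the bar construction ($B_nG=G^n$, inner faces multiply adjacent entries), a partial group. A homomorphism $\mathbb H\to BG$ amounts to a map $\mathbb H_1\to G$ with $g\cdot h\mapsto$ product of images for all $[g|h]\in\mathbb H_2$. Homotopies. With $\iota\in\Delta[1]_1$ the nondegenerate edge, $v_0=d_1\iota$, $v_1=d_0\iota$, a homotopy from $g$ to $f$ is $F\colon Y\times\Delta[1]\to X$ with $f=F\circ(\mathrm{Id}\times v_0)$, $g=F\circ(\mathrm{Id}\times v_1)$. Write $f\xleftarrow{\eta}g$ if there is such an $F$ with $F(1,\iota)=\eta$. $N(\mathbb M)$ is the set of $\eta\in\mathbb M_1$ for which there is an automorphism $c_\eta$ of $\mathbb M$ with $c_\eta\xleftarrow{\eta}1_{\mathbb M}$; $Z(\mathbb M)=\{\eta\in N(\mathbb M): c_\eta=1_{\mathbb M}\}$. $N(\mathbb M)$ is a group, $Z(\mathbb M)$ is an abelian subgroup, both preserved by $\mathrm{Aut}(\mathbb M)$, and $\mathrm{Out}(\mathbb M)=\mathrm{Aut}(\mathbb M)/\{c_\eta\}_{\eta\in N(\mathbb M)}$ is the group of homotopy classes of automorphisms; $\mathrm{Out}(\mathbb M)$ acts on $Z(\mathbb M)$. Extensions. A fibre bundle with fibre $F$ is a surjective simplicial map $E\to B$ whose pullback along each simplex $\Delta[n]\to B$ is isomorphic over $\Delta[n]$ to $F\times\Delta[n]$. An extension of $\mathbb H$ by $\mathbb M$ is a fibre bundle $\tau\colon\mathbb E\to\mathbb H$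 with fibre $\mathbb M$, written $\mathbb M\to\mathbb E\to\mathbb H$, where $\mathbb M\to\mathbb E$ identifies $\mathbb M$ with the fibre over the vertex of $\mathbb H$. Two extensions are equivalent if there is an isomorphism of total spaces compatible with $\mathrm{Id}_{\mathbb M}$ and $\mathrm{Id}_{\mathbb H}$. Twisting pairs. An $\mathbb H$-twisting pair for $\mathbb M$ is a pair of functions $t\colon\mathbb H_1\to\mathrm{Aut}(\mathbb M)$, $\eta\colon\mathbb H_2\to N(\mathbb M)$ with: (a) $t(g)\circ t(h)\xleftarrow{\eta(g,h)}t(gh)$ for $[g|h]\in\mathbb H_2$; (b) $t(1)=\mathrm{Id}$, $\eta(g,1)=1=\eta(1,g)$; (c) $t(g)(\eta(h,k))\cdot\eta(g,hk)=\eta(g,h)\cdot\eta(gh,k)$ for $[g|h|k]\in\mathbb H_3$. It defines an extension $\mathbb M\times_\phi\mathbb H$, $\phi=(t,\eta)$, with $n$-simplices $[(x_1,g_1)|\dots|(x_n,g_n)]$ such that $[g_1|\dots|g_n]\in\mathbb H$ and $[x_1|t(g_1)(x_2)|\dots|(t(g_1)\circ\dots\circ t(g_{n-1}))(x_n)]\in\mathbb M$, product $(x,g)(z,h)=(x\cdot t(g)(z)\cdot\eta(g,h),gh)$, inclusion $x\mapsto(x,1)$, and projection to the $g_i$'s; every extension is equivalent to one of this form. The outer action induced by such an extension is $\mathbb H\to B\mathrm{Out}(\mathbb M)$, $g\mapsto[t(g)]$; it depends only on the equivalence class of the extension. Cohomology. $H^*(\mathbb H;Z(\mathbb M))$ is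 cohomology of the simplicial set $\mathbb H$ with coefficients twisted by $\alpha$: cochains are functions $c\colon\mathbb H_n\to Z(\mathbb M)$, with differential (written additively) $(\delta c)(\mathbf h)=\alpha(h_1)(c(d_0\mathbf h))+\sum_{i=1}^{n+1}(-1)^ic(d_i\mathbf h)$ for $\mathbf h=[h_1|\dots|h_{n+1}]$. Obstruction class and action. Choose representatives $t(g)\in\mathrm{Aut}(\mathbb M)$ of $\alpha(g)$ with $t(1)=\mathrm{Id}$, and $\eta(g,h)\in N(\mathbb M)$ with $t(g)\circ t(h)\xleftarrow{\eta(g,h)}t(gh)$ and $\eta(g,1)=1=\eta(1,g)$. Then $[\kappa]$ is the class of $\kappa([g|h|k])=\eta(g,h)\cdot\eta(gh,k)\cdot\eta(g,hk)^{-1}\cdot t(g)(\eta(h,k))^{-1}\in Z(\mathbb M)$. The action of $[v]\in H^2(\mathbb H;Z(\mathbb M))$, represented by $v$ with $v(g,1)=v(1,g)=1$, sends the class of the extension defined by $(t,\eta)$ to that of the extension defined by $(t,v\cdot\eta)$, where $(v\cdot\eta)(g,h)=v(g,h)\cdot\eta(g,h)$. *)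

theory Defs
  imports "HOL-Algebra.Group_Action" "HOL-Algebra.FiniteProduct"
begin

section \<open>Simplicial sets\<close>

text \<open>
  A simplicial operator \<open>[m] \<rightarrow> [n]\<close> is represented by the sorted list of its \<open>m + 1\<close> values.
  \<open>oper X n \<theta>\<close> is the induced map from \<open>simplices X n\<close> to \<open>simplices X m\<close>; the dimension \<open>n\<close>
  of the argument is explicit because the sets of simplices of different dimensions may overlap.
\<close>

definition ops :: "nat \<Rightarrow> nat \<Rightarrow> nat list set" where
  "ops m n = {\<theta>. length \<theta> = Suc m \<and> sorted \<theta> \<and> set \<theta> \<subseteq> {..n}}"

definition op_comp :: "nat list \<Rightarrow> nat list \<Rightarrow> nat list" where
  "op_comp \<theta> \<phi> = map (\<lambda>i. \<theta> ! i) \<phi>"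

record 'a sset =
  simplices :: "nat \<Rightarrow> 'a set"
  oper :: "nat \<Rightarrow> nat list \<Rightarrow> 'a \<Rightarrow> 'a"

definition simplicial_set :: "'a sset \<Rightarrow> bool" where
  "simplicial_set X \<longleftrightarrow>
     (\<forall>m n. \<forall>\<theta>\<in>ops m n. \<forall>x\<in>simplices X n. oper X n \<theta> x \<in> simplices X m) \<and>
     (\<forall>n. \<forall>x\<in>simplices X n. oper X n [0..<Suc n] x = x) \<and>
     (\<forall>k m n. \<forall>\<theta>\<in>ops m n. \<forall>\<phi>\<in>ops k m. \<forall>x\<in>simplices X n.
        oper X m \<phi> (oper X n \<theta> x) = oper X n (op_comp \<theta> \<phi>) x)"

definition simplicial_map :: "'a sset \<Rightarrow> 'b sset \<Rightarrow> (nat \<Rightarrow> 'a \<Rightarrow> 'b) \<Rightarrow> bool" where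
  "simplicial_map X Y f \<longleftrightarrow>
     (\<forall>n. \<forall>x\<in>simplices X n. f n x \<in> simplices Y n) \<and>
     (\<forall>m n. \<forall>\<theta>\<in>ops m n. \<forall>x\<in>simplices X n. f m (oper X n \<theta> x) = oper Y n \<theta> (f n x))"

definition simplicial_iso :: "'a sset \<Rightarrow> 'b sset \<Rightarrow> (nat \<Rightarrow> 'a \<Rightarrow> 'b) \<Rightarrow> bool" where
  "simplicial_iso X Y f \<longleftrightarrow> simplicial_map X Y f \<and>
     (\<exists>g. simplicial_map Y X g \<and>
        (\<forall>n. \<forall>x\<in>simplices X n. g n (f n x) = x) \<and>
        (\<forall>n. \<forall>y\<in>simplices Y n. f n (g n y) = y))"

definition std_simplex :: "nat \<Rightarrow> nat list sset" where
  "std_simplex n = \<lparr>simplices = (\<lambda>k. ops k n), oper = (\<lambda>k \<theta> \<sigma>. op_comp \<sigma> \<theta>)\<rparr>"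

definition sset_prod :: "'a sset \<Rightarrow> 'b sset \<Rightarrow> ('a \<times> 'b) sset" where
  "sset_prod X Y = \<lparr>simplices = (\<lambda>n. simplices X n \<times> simplices Y n),
                    oper = (\<lambda>n \<theta> (x, y). (oper X n \<theta> x, oper Y n \<theta> y))\<rparr>"

definition sset_pullback ::
  "'a sset \<Rightarrow> 'b sset \<Rightarrow> (nat \<Rightarrow> 'a \<Rightarrow> 'c) \<Rightarrow> (nat \<Rightarrow> 'b \<Rightarrow> 'c) \<Rightarrow> ('a \<times> 'b) sset" where
  "sset_pullback X Y f g =
     \<lparr>simplices = (\<lambda>n. {(x, y). x \<in> simplices X n \<and> y \<in> simplices Y n \<and> f n x = g n y}),
      oper = (\<lambda>n \<theta> (x, y). (oper X n \<theta> x, oper Y n \<theta> y))\<rparr>"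

text \<open>The opposite simplicial set: precomposition with the order reversals of \<open>[m]\<close> and \<open>[n]\<close>.\<close>

definition sset_op :: "'a sset \<Rightarrow> 'a sset" where
  "sset_op X = \<lparr>simplices = simplices X,
                oper = (\<lambda>n \<theta> x. oper X n (map (\<lambda>i. n - i) (rev \<theta>)) x)\<rparr>"

text \<open>\<open>face X n i\<close> is \<open>d\<^sub>i\<close> on \<open>n\<close>-simplices, induced by the injection \<open>[n-1] \<rightarrow> [n]\<close> omitting \<open>i\<close>.\<close>

definition face :: "'a sset \<Rightarrow> nat \<Rightarrow> nat \<Rightarrow> 'a \<Rightarrow> 'a" where
  "face X n i x = oper X n (remove1 i [0..<Suc n]) x"


section \<open>Partial groups\<close>

definition spine :: "'a sset \<Rightarrow> nat \<Rightarrow> 'a \<Rightarrow> 'a list" where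
  "spine X n u = map (\<lambda>i. oper X n [i, Suc i] u) [0..<n]"

definition partial_monoid :: "'a sset \<Rightarrow> bool" where
  "partial_monoid M \<longleftrightarrow> simplicial_set M \<and> (\<exists>!v. v \<in> simplices M 0) \<and>
     (\<forall>n\<ge>1. inj_on (spine M n) (simplices M n))"

definition vertex :: "'a sset \<Rightarrow> 'a" where
  "vertex M = (THE v. v \<in> simplices M 0)"

definition pg_one :: "'a sset \<Rightarrow> 'a" where
  "pg_one M = oper M 0 [0, 0] (vertex M)"

text \<open>\<open>is_word M [x\<^sub>1, \<dots>, x\<^sub>n]\<close> says that the simplex \<open>[x\<^sub>1| \<dots> |x\<^sub>n]\<close> exists; \<open>simplex M\<close> is that simplex.\<close>

definition is_word :: "'a sset \<Rightarrow> 'a list \<Rightarrow> bool" where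
  "is_word M xs \<longleftrightarrow> (\<exists>u\<in>simplices M (length xs). spine M (length xs) u = xs)"

definition simplex :: "'a sset \<Rightarrow> 'a list \<Rightarrow> 'a" where
  "simplex M xs = (THE u. u \<in> simplices M (length xs) \<and> spine M (length xs) u = xs)"

definition Pi_map :: "'a sset \<Rightarrow> nat \<Rightarrow> 'a \<Rightarrow> 'a" where
  "Pi_map M n u = oper M n [0, n] u"

definition pg_prod :: "'a sset \<Rightarrow> 'a list \<Rightarrow> 'a" where
  "pg_prod M xs = Pi_map M (length xs) (simplex M xs)"

abbreviation pg_mult :: "'a sset \<Rightarrow> 'a \<Rightarrow> 'a \<Rightarrow> 'a" where
  "pg_mult M x y \<equiv> pg_prod M [x, y]"

definition inversion :: "'a sset \<Rightarrow> (nat \<Rightarrow> 'a \<Rightarrow> 'a) \<Rightarrow> bool" where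
  "inversion M \<nu> \<longleftrightarrow> simplicial_map M (sset_op M) \<nu> \<and>
     (\<forall>n. \<forall>u\<in>simplices M n. \<nu> n (\<nu> n u) = u) \<and>
     (\<forall>n\<ge>1. \<forall>u\<in>simplices M n. \<exists>w\<in>simplices M (2 * n).
        spine M (2 * n) w = spine M n (\<nu> n u) @ spine M n u \<and> Pi_map M (2 * n) w = pg_one M)"

definition partial_group :: "'a sset \<Rightarrow> bool" where
  "partial_group M \<longleftrightarrow> partial_monoid M \<and> (\<exists>\<nu>. inversion M \<nu>)"

text \<open>
  The action of an operator on words in which adjacent letters can be multiplied: the \<open>i\<close>-th letter
  of the result is the product of the letters strictly after position \<open>\<theta>(i - 1)\<close> up to position \<open>\<theta>(i)\<close>.
\<close>

definition word_oper :: "('a \<Rightarrow> 'a \<Rightarrow> 'a) \<Rightarrow> 'a \<Rightarrow> nat list \<Rightarrow> 'a list \<Rightarrow> 'a list" where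
  "word_oper f e \<theta> w =
     map (\<lambda>i. foldl f e (take (\<theta> ! Suc i - \<theta> ! i) (drop (\<theta> ! i) w))) [0..<length \<theta> - 1]"

definition bar :: "('a, 'b) monoid_scheme \<Rightarrow> 'a list sset" where
  "bar G = \<lparr>simplices = (\<lambda>n. {w. length w = n \<and> set w \<subseteq> carrier G}),
            oper = (\<lambda>n. word_oper (mult G) (one G))\<rparr>"


section \<open>Homotopies, automorphisms, outer automorphisms\<close>

text \<open>
  \<open>homotopic_via Y X f \<eta> g\<close> is \<open>f \<leftarrow>\<eta> g\<close>. The operators \<open>[0, \<dots>, 0]\<close> and \<open>[1, \<dots>, 1]\<close> are the
  degeneracies of \<open>v\<^sub>0\<close> and \<open>v\<^sub>1\<close> in \<open>\<Delta>[1]\<close>, and \<open>[0, 1]\<close> is \<open>\<iota>\<close>.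
\<close>

definition homotopic_via ::
  "'a sset \<Rightarrow> 'b sset \<Rightarrow> (nat \<Rightarrow> 'a \<Rightarrow> 'b) \<Rightarrow> 'b \<Rightarrow> (nat \<Rightarrow> 'a \<Rightarrow> 'b) \<Rightarrow> bool" where
  "homotopic_via Y X f \<eta> g \<longleftrightarrow>
     (\<exists>F. simplicial_map (sset_prod Y (std_simplex 1)) X F \<and>
        (\<forall>n. \<forall>y\<in>simplices Y n. f n y = F n (y, replicate (Suc n) 0)) \<and>
        (\<forall>n. \<forall>y\<in>simplices Y n. g n y = F n (y, replicate (Suc n) 1)) \<and>
        F 1 (pg_one Y, [0, 1]) = \<eta>)"

text \<open>Automorphisms are taken to be extensional, so that equal automorphisms are equal as terms.\<close>

definition AutGroup :: "'a sset \<Rightarrow> (nat \<Rightarrow> 'a \<Rightarrow> 'a) monoid" where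
  "AutGroup M =
     \<lparr>carrier = {f. simplicial_iso M M f \<and> (\<forall>n. f n \<in> extensional (simplices M n))},
      mult = (\<lambda>f g n. compose (simplices M n) (f n) (g n)),
      one = (\<lambda>n. \<lambda>x\<in>simplices M n. x)\<rparr>"

definition NSet :: "'a sset \<Rightarrow> 'a set" where
  "NSet M = {\<eta>\<in>simplices M 1. \<exists>c\<in>carrier (AutGroup M). homotopic_via M M c \<eta> \<one>\<^bsub>AutGroup M\<^esub>}"

definition conj_aut :: "'a sset \<Rightarrow> 'a \<Rightarrow> nat \<Rightarrow> 'a \<Rightarrow> 'a" where
  "conj_aut M \<eta> = (THE c. c \<in> carrier (AutGroup M) \<and> homotopic_via M M c \<eta> \<one>\<^bsub>AutGroup M\<^esub>)"

definition ZSet :: "'a sset \<Rightarrow> 'a set" where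
  "ZSet M = {\<eta>\<in>NSet M. conj_aut M \<eta> = \<one>\<^bsub>AutGroup M\<^esub>}"

definition NGroup :: "'a sset \<Rightarrow> 'a monoid" where
  "NGroup M = \<lparr>carrier = NSet M, mult = pg_mult M, one = pg_one M\<rparr>"

definition ZGroup :: "'a sset \<Rightarrow> 'a monoid" where
  "ZGroup M = (NGroup M)\<lparr>carrier := ZSet M\<rparr>"

definition InnSet :: "'a sset \<Rightarrow> (nat \<Rightarrow> 'a \<Rightarrow> 'a) set" where
  "InnSet M = conj_aut M ` NSet M"

definition OutGroup :: "'a sset \<Rightarrow> (nat \<Rightarrow> 'a \<Rightarrow> 'a) set monoid" where
  "OutGroup M = AutGroup M Mod InnSet M"

definition out_class :: "'a sset \<Rightarrow> (nat \<Rightarrow> 'a \<Rightarrow> 'a) \<Rightarrow> (nat \<Rightarrow> 'a \<Rightarrow> 'a) set" where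
  "out_class M f = InnSet M #>\<^bsub>AutGroup M\<^esub> f"

text \<open>The action of an element of \<open>Out(M)\<close>, a coset, on \<open>Z(M)\<close>: evaluate any representative.\<close>

definition out_act :: "(nat \<Rightarrow> 'a \<Rightarrow> 'a) set \<Rightarrow> 'a \<Rightarrow> 'a" where
  "out_act A z = the_elem ((\<lambda>f. f 1 z) ` A)"

definition outer_action :: "'m sset \<Rightarrow> 'h sset \<Rightarrow> (nat \<Rightarrow> 'h \<Rightarrow> (nat \<Rightarrow> 'm \<Rightarrow> 'm) set list) \<Rightarrow> bool"
  where "outer_action M H \<alpha> \<longleftrightarrow> simplicial_map H (bar (OutGroup M)) \<alpha>"


section \<open>Extensions\<close>

definition fibre_bundle ::
  "'f sset \<Rightarrow> 'e sset \<Rightarrow> 'b sset \<Rightarrow> (nat \<Rightarrow> 'e \<Rightarrow> 'b) \<Rightarrow> bool" where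
  "fibre_bundle F E B \<tau> \<longleftrightarrow> simplicial_map E B \<tau> \<and>
     (\<forall>n. \<tau> n ` simplices E n = simplices B n) \<and>
     (\<forall>n \<sigma>. simplicial_map (std_simplex n) B \<sigma> \<longrightarrow>
        (\<exists>\<psi>. simplicial_iso (sset_pullback E (std_simplex n) \<tau> \<sigma>) (sset_prod F (std_simplex n)) \<psi> \<and>
           (\<forall>k. \<forall>p\<in>simplices (sset_pullback E (std_simplex n) \<tau> \<sigma>) k. snd (\<psi> k p) = snd p)))"

definition fibre_over :: "'e sset \<Rightarrow> 'b sset \<Rightarrow> (nat \<Rightarrow> 'e \<Rightarrow> 'b) \<Rightarrow> 'b \<Rightarrow> 'e sset" where
  "fibre_over E B \<tau> v =
     \<lparr>simplices = (\<lambda>n. {e\<in>simplices E n. \<tau> n e = oper B 0 (replicate (Suc n) 0) v}),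
      oper = oper E\<rparr>"

record ('m, 'h, 'e) ext =
  total :: "'e sset"
  incl :: "nat \<Rightarrow> 'm \<Rightarrow> 'e"
  proj :: "nat \<Rightarrow> 'e \<Rightarrow> 'h"

definition extension :: "'m sset \<Rightarrow> 'h sset \<Rightarrow> ('m, 'h, 'e) ext \<Rightarrow> bool" where
  "extension M H X \<longleftrightarrow> simplicial_set (total X) \<and>
     fibre_bundle M (total X) H (proj X) \<and>
     simplicial_iso M (fibre_over (total X) H (proj X) (vertex H)) (incl X)"

text \<open>The total spaces of the two extensions may have different types.\<close>

definition ext_equiv :: "'m sset \<Rightarrow> 'h sset \<Rightarrow> ('m, 'h, 'e) ext \<Rightarrow> ('m, 'h, 'f) ext \<Rightarrow> bool" where
  "ext_equiv M H X Y \<longleftrightarrow>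
     (\<exists>\<psi>. simplicial_iso (total X) (total Y) \<psi> \<and>
        (\<forall>n. \<forall>x\<in>simplices M n. \<psi> n (incl X n x) = incl Y n x) \<and>
        (\<forall>n. \<forall>e\<in>simplices (total X) n. proj Y n (\<psi> n e) = proj X n e))"


section \<open>Twisting pairs\<close>

text \<open>In a twisting pair, \<open>\<eta>\<close> is a function on 2-simplices: \<open>\<eta>(g, h)\<close> is \<open>\<eta> (simplex H [g, h])\<close>.\<close>

definition normalized :: "'m sset \<Rightarrow> 'h sset \<Rightarrow> ('h \<Rightarrow> 'm) \<Rightarrow> bool" where
  "normalized M H v \<longleftrightarrow> (\<forall>g\<in>simplices H 1.
     v (simplex H [g, pg_one H]) = pg_one M \<and> v (simplex H [pg_one H, g]) = pg_one M)"

definition pre_twisting_pair ::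
  "'m sset \<Rightarrow> 'h sset \<Rightarrow> ('h \<Rightarrow> nat \<Rightarrow> 'm \<Rightarrow> 'm) \<Rightarrow> ('h \<Rightarrow> 'm) \<Rightarrow> bool" where
  "pre_twisting_pair M H t \<eta> \<longleftrightarrow>
     (\<forall>g\<in>simplices H 1. t g \<in> carrier (AutGroup M)) \<and>
     (\<forall>u\<in>simplices H 2. \<eta> u \<in> NSet M) \<and>
     (\<forall>g h. is_word H [g, h] \<longrightarrow>
        homotopic_via M M (t g \<otimes>\<^bsub>AutGroup M\<^esub> t h) (\<eta> (simplex H [g, h])) (t (pg_mult H g h))) \<and>
     t (pg_one H) = \<one>\<^bsub>AutGroup M\<^esub> \<and> normalized M H \<eta>"

definition twisting_pair ::
  "'m sset \<Rightarrow> 'h sset \<Rightarrow> ('h \<Rightarrow> nat \<Rightarrow> 'm \<Rightarrow> 'm) \<Rightarrow> ('h \<Rightarrow> 'm) \<Rightarrow> bool" where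
  "twisting_pair M H t \<eta> \<longleftrightarrow> pre_twisting_pair M H t \<eta> \<and>
     (\<forall>g h k. is_word H [g, h, k] \<longrightarrow>
        pg_mult M (t g 1 (\<eta> (simplex H [h, k]))) (\<eta> (simplex H [g, pg_mult H h k])) =
        pg_mult M (\<eta> (simplex H [g, h])) (\<eta> (simplex H [pg_mult H g h, k])))"

definition tw_mult ::
  "'m sset \<Rightarrow> 'h sset \<Rightarrow> ('h \<Rightarrow> nat \<Rightarrow> 'm \<Rightarrow> 'm) \<Rightarrow> ('h \<Rightarrow> 'm) \<Rightarrow> 'm \<times> 'h \<Rightarrow> 'm \<times> 'h \<Rightarrow> 'm \<times> 'h" where
  "tw_mult M H t \<eta> p q =
     (pg_prod M [fst p, t (snd p) 1 (fst q), \<eta> (simplex H [snd p, snd q])],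
      pg_mult H (snd p) (snd q))"

text \<open>
  \<open>tw_word\<close> sends \<open>[(x\<^sub>1,g\<^sub>1), \<dots>, (x\<^sub>n,g\<^sub>n)]\<close> to the list with \<open>i\<close>-th entry \<open>(t(g\<^sub>1) \<circ> \<dots> \<circ> t(g\<^bsub>i-1\<^esub>))(x\<^sub>i)\<close>.
\<close>

definition tw_word :: "('h \<Rightarrow> nat \<Rightarrow> 'm \<Rightarrow> 'm) \<Rightarrow> ('m \<times> 'h) list \<Rightarrow> 'm list" where
  "tw_word t ps =
     map (\<lambda>i. foldr (\<lambda>g. t g 1) (map snd (take i ps)) (fst (ps ! i))) [0..<length ps]"

definition tw_total ::
  "'m sset \<Rightarrow> 'h sset \<Rightarrow> ('h \<Rightarrow> nat \<Rightarrow> 'm \<Rightarrow> 'm) \<Rightarrow> ('h \<Rightarrow> 'm) \<Rightarrow> ('m \<times> 'h) list sset" where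
  "tw_total M H t \<eta> =
     \<lparr>simplices = (\<lambda>n. {ps. length ps = n \<and> set ps \<subseteq> simplices M 1 \<times> simplices H 1 \<and>
                          is_word H (map snd ps) \<and> is_word M (tw_word t ps)}),
      oper = (\<lambda>n. word_oper (tw_mult M H t \<eta>) (pg_one M, pg_one H))\<rparr>"

definition tw_ext ::
  "'m sset \<Rightarrow> 'h sset \<Rightarrow> ('h \<Rightarrow> nat \<Rightarrow> 'm \<Rightarrow> 'm) \<Rightarrow> ('h \<Rightarrow> 'm) \<Rightarrow> ('m, 'h, ('m \<times> 'h) list) ext" where
  "tw_ext M H t \<eta> =
     \<lparr>total = tw_total M H t \<eta>,
      incl = (\<lambda>n u. map (\<lambda>x. (x, pg_one H)) (spine M n u)),
      proj = (\<lambda>n ps. simplex H (map snd ps))\<rparr>"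

definition induces_outer_action ::
  "'m sset \<Rightarrow> 'h sset \<Rightarrow> ('m, 'h, 'e) ext \<Rightarrow> (nat \<Rightarrow> 'h \<Rightarrow> (nat \<Rightarrow> 'm \<Rightarrow> 'm) set list) \<Rightarrow> bool" where
  "induces_outer_action M H X \<alpha> \<longleftrightarrow>
     (\<exists>t \<eta>. twisting_pair M H t \<eta> \<and> ext_equiv M H X (tw_ext M H t \<eta>) \<and>
        (\<forall>n. \<forall>u\<in>simplices H n. \<alpha> n u = map (\<lambda>g. out_class M (t g)) (spine H n u)))"

text \<open>
  Equivalence classes of extensions whose total space has simplices in \<open>'e\<close>. The class attached to
  a twisting pair consists of the extensions over \<open>'e\<close> equivalent to \<open>tw_ext\<close>, whose own total
  space has simplices in \<open>('m \<times> 'h) list\<close>.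
\<close>

definition ext_classes ::
  "'m sset \<Rightarrow> 'h sset \<Rightarrow> (nat \<Rightarrow> 'h \<Rightarrow> (nat \<Rightarrow> 'm \<Rightarrow> 'm) set list) \<Rightarrow> ('m, 'h, 'e) ext set set" where
  "ext_classes M H \<alpha> =
     {X. extension M H X \<and> induces_outer_action M H X \<alpha>} //
     {(X, Y). extension M H X \<and> extension M H Y \<and> ext_equiv M H X Y}"

definition tw_class ::
  "'m sset \<Rightarrow> 'h sset \<Rightarrow> ('h \<Rightarrow> nat \<Rightarrow> 'm \<Rightarrow> 'm) \<Rightarrow> ('h \<Rightarrow> 'm) \<Rightarrow> ('m, 'h, 'e) ext set" where
  "tw_class M H t \<eta> = {X. extension M H X \<and> ext_equiv M H X (tw_ext M H t \<eta>)}"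


section \<open>Cohomology with twisted coefficients\<close>

definition cochain_group :: "'m sset \<Rightarrow> 'h sset \<Rightarrow> nat \<Rightarrow> ('h \<Rightarrow> 'm) monoid" where
  "cochain_group M H n =
     \<lparr>carrier = simplices H n \<rightarrow>\<^sub>E ZSet M,
      mult = (\<lambda>c d. \<lambda>u\<in>simplices H n. c u \<otimes>\<^bsub>ZGroup M\<^esub> d u),
      one = (\<lambda>u\<in>simplices H n. \<one>\<^bsub>ZGroup M\<^esub>)\<rparr>"

text \<open>
  The differential from degree \<open>n\<close> to degree \<open>n + 1\<close>, written multiplicatively; \<open>oper H (Suc n) [0, 1]\<close>
  extracts the first spine entry.
\<close>

definition codiff ::
  "'m sset \<Rightarrow> 'h sset \<Rightarrow> (nat \<Rightarrow> 'h \<Rightarrow> (nat \<Rightarrow> 'm \<Rightarrow> 'm) set list) \<Rightarrow> nat \<Rightarrow> ('h \<Rightarrow> 'm) \<Rightarrow> 'h \<Rightarrow> 'm" where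
  "codiff M H \<alpha> n c = (\<lambda>u\<in>simplices H (Suc n).
     out_act (hd (\<alpha> 1 (oper H (Suc n) [0, 1] u))) (c (face H (Suc n) 0 u)) \<otimes>\<^bsub>ZGroup M\<^esub>
     (\<Otimes>\<^bsub>ZGroup M\<^esub>i\<in>{1..Suc n}. c (face H (Suc n) i u) [^]\<^bsub>ZGroup M\<^esub> ((-1::int) ^ i)))"

definition cocycles ::
  "'m sset \<Rightarrow> 'h sset \<Rightarrow> (nat \<Rightarrow> 'h \<Rightarrow> (nat \<Rightarrow> 'm \<Rightarrow> 'm) set list) \<Rightarrow> nat \<Rightarrow> ('h \<Rightarrow> 'm) set" where
  "cocycles M H \<alpha> n =
     {c\<in>carrier (cochain_group M H n). codiff M H \<alpha> n c = \<one>\<^bsub>cochain_group M H (Suc n)\<^esub>}"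

definition coboundaries ::
  "'m sset \<Rightarrow> 'h sset \<Rightarrow> (nat \<Rightarrow> 'h \<Rightarrow> (nat \<Rightarrow> 'm \<Rightarrow> 'm) set list) \<Rightarrow> nat \<Rightarrow> ('h \<Rightarrow> 'm) set" where
  "coboundaries M H \<alpha> n =
     (case n of 0 \<Rightarrow> {\<one>\<^bsub>cochain_group M H 0\<^esub>}
      | Suc k \<Rightarrow> codiff M H \<alpha> k ` carrier (cochain_group M H k))"

definition cocycle_group ::
  "'m sset \<Rightarrow> 'h sset \<Rightarrow> (nat \<Rightarrow> 'h \<Rightarrow> (nat \<Rightarrow> 'm \<Rightarrow> 'm) set list) \<Rightarrow> nat \<Rightarrow> ('h \<Rightarrow> 'm) monoid" where
  "cocycle_group M H \<alpha> n = (cochain_group M H n)\<lparr>carrier := cocycles M H \<alpha> n\<rparr>"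

definition cohomology ::
  "'m sset \<Rightarrow> 'h sset \<Rightarrow> (nat \<Rightarrow> 'h \<Rightarrow> (nat \<Rightarrow> 'm \<Rightarrow> 'm) set list) \<Rightarrow> nat \<Rightarrow> ('h \<Rightarrow> 'm) set monoid" where
  "cohomology M H \<alpha> n = cocycle_group M H \<alpha> n Mod coboundaries M H \<alpha> n"

definition cohomology_class ::
  "'m sset \<Rightarrow> 'h sset \<Rightarrow> (nat \<Rightarrow> 'h \<Rightarrow> (nat \<Rightarrow> 'm \<Rightarrow> 'm) set list) \<Rightarrow> nat \<Rightarrow> ('h \<Rightarrow> 'm) \<Rightarrow> ('h \<Rightarrow> 'm) set" where
  "cohomology_class M H \<alpha> n c = coboundaries M H \<alpha> n #>\<^bsub>cocycle_group M H \<alpha> n\<^esub> c"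


section \<open>Obstruction class and action\<close>

definition obstruction_cochain ::
  "'m sset \<Rightarrow> 'h sset \<Rightarrow> ('h \<Rightarrow> nat \<Rightarrow> 'm \<Rightarrow> 'm) \<Rightarrow> ('h \<Rightarrow> 'm) \<Rightarrow> 'h \<Rightarrow> 'm" where
  "obstruction_cochain M H t \<eta> = (\<lambda>u\<in>simplices H 3.
     let g = spine H 3 u ! 0; h = spine H 3 u ! 1; k = spine H 3 u ! 2 in
       \<eta> (simplex H [g, h]) \<otimes>\<^bsub>NGroup M\<^esub> \<eta> (simplex H [pg_mult H g h, k]) \<otimes>\<^bsub>NGroup M\<^esub>
       inv\<^bsub>NGroup M\<^esub> \<eta> (simplex H [g, pg_mult H h k]) \<otimes>\<^bsub>NGroup M\<^esub>
       inv\<^bsub>NGroup M\<^esub> (t g 1 (\<eta> (simplex H [h, k]))))"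

text \<open>
  \<open>obstruction_class\<close> and \<open>ext_action\<close> are given by \<open>THE\<close>: any statement about them includes that
  they do not depend on the chosen representatives.
\<close>

definition obstruction_class ::
  "'m sset \<Rightarrow> 'h sset \<Rightarrow> (nat \<Rightarrow> 'h \<Rightarrow> (nat \<Rightarrow> 'm \<Rightarrow> 'm) set list) \<Rightarrow> ('h \<Rightarrow> 'm) set" where
  "obstruction_class M H \<alpha> = (THE K. \<exists>t \<eta>. pre_twisting_pair M H t \<eta> \<and>
     (\<forall>g\<in>simplices H 1. \<alpha> 1 g = [out_class M (t g)]) \<and>
     K = cohomology_class M H \<alpha> 3 (obstruction_cochain M H t \<eta>))"

definition ext_action ::
  "'m sset \<Rightarrow> 'h sset \<Rightarrow> (nat \<Rightarrow> 'h \<Rightarrow> (nat \<Rightarrow> 'm \<Rightarrow> 'm) set list) \<Rightarrow>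
   ('h \<Rightarrow> 'm) set \<Rightarrow> ('m, 'h, 'e) ext set \<Rightarrow> ('m, 'h, 'e) ext set" where
  "ext_action M H \<alpha> V = (\<lambda>C\<in>ext_classes M H \<alpha>.
     (THE D. \<exists>t \<eta> v. twisting_pair M H t \<eta> \<and> C = tw_class M H t \<eta> \<and>
        v \<in> V \<and> normalized M H v \<and>
        D = tw_class M H t (\<lambda>u. pg_mult M (v u) (\<eta> u))))"

definition free_action :: "('g, 'x) monoid_scheme \<Rightarrow> 'e set \<Rightarrow> ('g \<Rightarrow> 'e \<Rightarrow> 'e) \<Rightarrow> bool" where
  "free_action G E \<phi> \<longleftrightarrow> group_action G E \<phi> \<and>
     (\<forall>e\<in>E. stabilizer G \<phi> e = {\<one>\<^bsub>G\<^esub>})"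

end

theory Submission
  imports Defs
begin

text \<open>
  A homotopy \<open>c \<leftarrow>\<^sup>\<eta> 1\<close> evaluated on the pairs \<open>(z, 0\<dots>01\<dots>1)\<close> is a gauge transformation of the simplices
  of \<open>M\<close>: multiply the edges on both sides by \<open>\<eta>\<close> or \<open>1\<close>, depending on their end points. Composing
  such homotopies shows that \<open>N(M)\<^bsup>n+1\<^esup>\<close> acts on the \<open>n\<close>-simplices of \<open>M\<close>, an edge \<open>z\<^sub>i\<^sub>j\<close> becoming
  \<open>\<nu>\<^sub>i z\<^sub>i\<^sub>j \<nu>\<^sub>j\<^sup>-\<^sup>1\<close>. Everything is then computed on edges, because a simplex is determined by them.

  Over an \<open>n\<close>-simplex \<open>b\<close> of \<open>H\<close>, the edge \<open>(x, b\<^sub>i\<^sub>j)\<close> of the twisted product has the coordinate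
  \<open>t(b\<^sub>0\<^sub>i)(x) \<eta>(b\<^sub>0\<^sub>i, b\<^sub>i\<^sub>j)\<close>, which is multiplicative in \<open>i \<le> j\<close> by the cocycle condition; by gauge
  transformations these coordinates trivialize the twisted product over \<open>b\<close>. An equivalence of two
  twisted products is, in these coordinates over an edge \<open>g\<close>, a homotopy \<open>1 \<leftarrow> t'(g) t(g)\<^sup>-\<^sup>1\<close>; hence it
  has the form \<open>(x, g) \<mapsto> (x \<rho>(g), g)\<close> for a function \<open>\<rho>\<close> to \<open>N(M)\<close>. What remains is the classical
  computation with factor sets: changing \<open>(t, \<eta>)\<close> along \<open>\<rho>\<close> preserves \<open>\<kappa>\<close>, and multiplying \<open>\<eta>\<close> by a
  central cochain \<open>v\<close> divides \<open>\<kappa>\<close> by \<open>\<delta>v\<close>.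
\<close>

section \<open>Simplices and their edges\<close>

text \<open>The difficulty is that products in \<open>M\<close> exist only where a simplex exists,
  and associativity holds only inside one simplex: a list whose adjacent products are defined need
  not be a word. So an identity between products is not reached by rewriting; a simplex having all
  the required edges is produced, and its edges are read off. Elements of \<open>N(M)\<close> can be
  multiplied with anything, and gauge transformations, together with operators and automorphisms,
  supply the new simplices. Inside \<open>N(M)\<close> and \<open>Aut(M)\<close> ordinary group
  calculations apply. Three mismatches between the notions shape the last part. Twisting pairs are
  normalized, but the cochains that define cohomology are not; so a class needs a normalized
  representative, and \<kappa> = \<delta>x has to be solvable with normalized \<open>x\<close>.
  Twisted products have words of pairs as simplices, but the classes consist of extensions over the
  type \<open>'e\<close>; an injection carries them over. The obstruction class and the action are
  definite descriptions, so their evaluation rests on a comparison of two arbitrary choices.\<close>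

declare One_nat_def [simp del]

lemma ops_1 [simp]: "[i, j] \<in> ops 1 n \<longleftrightarrow> i \<le> j \<and> j \<le> n"
  by (auto simp: ops_def)

lemma ops_2 [simp]: "[i, j, k] \<in> ops 2 n \<longleftrightarrow> i \<le> j \<and> j \<le> k \<and> k \<le> n"
  by (auto simp: ops_def)

lemma ops_3 [simp]: "[i, j, k, l] \<in> ops 3 n \<longleftrightarrow> i \<le> j \<and> j \<le> k \<and> k \<le> l \<and> l \<le> n"
  by (auto simp: ops_def)

lemma ops_0 [simp]: "[i] \<in> ops 0 n \<longleftrightarrow> i \<le> n"
  by (auto simp: ops_def)

lemma ops_id [simp]: "[0..<Suc n] \<in> ops n n"
  by (auto simp: ops_def simp del: upt_Suc)

lemma ops_replicate [simp]: "i \<le> n \<Longrightarrow> replicate (Suc m) i \<in> ops m n"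
  by (auto simp: ops_def simp del: replicate_Suc)

lemma ops_nth: "\<theta> \<in> ops m n \<Longrightarrow> i \<le> m \<Longrightarrow> \<theta> ! i \<le> n"
  by (auto simp: ops_def subset_iff)

lemma ops_nth_mono: "\<theta> \<in> ops m n \<Longrightarrow> i \<le> j \<Longrightarrow> j \<le> m \<Longrightarrow> \<theta> ! i \<le> \<theta> ! j"
  by (auto simp: ops_def intro: sorted_nth_mono)

lemma ops_length: "\<theta> \<in> ops m n \<Longrightarrow> length \<theta> = Suc m"
  by (auto simp: ops_def)

lemma op_comp_nth: "i < length \<phi> \<Longrightarrow> op_comp \<theta> \<phi> ! i = \<theta> ! (\<phi> ! i)"
  by (simp add: op_comp_def)

lemma op_comp_ops: "\<theta> \<in> ops m n \<Longrightarrow> \<phi> \<in> ops k m \<Longrightarrow> op_comp \<theta> \<phi> \<in> ops k n"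
proof -
  assume \<theta>: "\<theta> \<in> ops m n" and \<phi>: "\<phi> \<in> ops k m"
  have "length (op_comp \<theta> \<phi>) = Suc k"
    using ops_length[OF \<phi>] by (simp add: op_comp_def)
  moreover have "sorted (op_comp \<theta> \<phi>)"
    unfolding sorted_iff_nth_mono
    using ops_nth_mono[OF \<theta>] ops_nth_mono[OF \<phi>] ops_nth[OF \<phi>] ops_length[OF \<phi>]
    by (auto simp: op_comp_def)
  moreover have "set (op_comp \<theta> \<phi>) \<subseteq> {..n}"
    using ops_nth[OF \<theta>] \<phi> by (auto simp: op_comp_def ops_def)
  ultimately show ?thesis by (simp add: ops_def)
qed

lemma op_comp_id: "\<theta> \<in> ops m n \<Longrightarrow> op_comp [0..<Suc n] \<theta> = \<theta>"
  unfolding op_comp_def by (rule map_idI) (auto simp: ops_def simp del: upt_Suc)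

lemma op_comp_id_right: "\<theta> \<in> ops m n \<Longrightarrow> op_comp \<theta> [0..<Suc m] = \<theta>"
  unfolding op_comp_def by (simp add: ops_length[symmetric] map_nth del: upt_Suc)

lemma op_comp_assoc: "\<phi> \<in> ops k m \<Longrightarrow> \<chi> \<in> ops l k \<Longrightarrow> op_comp (op_comp \<theta> \<phi>) \<chi> = op_comp \<theta> (op_comp \<phi> \<chi>)"
  by (rule nth_equalityI) (auto simp: op_comp_def ops_def subset_iff less_Suc_eq_le)

lemma ops_to_0: "\<xi> \<in> ops k 0 \<Longrightarrow> \<xi> = replicate (Suc k) 0"
  by (rule nth_equalityI) (use ops_nth[of \<xi> k 0] ops_length[of \<xi> k 0] in \<open>auto simp: less_Suc_eq_le simp del: replicate_Suc\<close>)

text \<open>Unlike the spine, the family of all edges is natural: an operator only renumbers the end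
  points (\<open>edge_oper\<close>).\<close>

definition edge :: "'a sset \<Rightarrow> nat \<Rightarrow> 'a \<Rightarrow> nat \<Rightarrow> nat \<Rightarrow> 'a" where
  "edge X n u i j = oper X n [i, j] u"

locale sset =
  fixes X :: "'a sset"
  assumes simplicial_set: "simplicial_set X"
begin

lemma oper_in: "\<theta> \<in> ops m n \<Longrightarrow> x \<in> simplices X n \<Longrightarrow> oper X n \<theta> x \<in> simplices X m"
  using simplicial_set by (auto simp: simplicial_set_def)

lemma oper_id: "x \<in> simplices X n \<Longrightarrow> oper X n [0..<Suc n] x = x"
  using simplicial_set unfolding simplicial_set_def by blast

lemma oper_oper: "\<theta> \<in> ops m n \<Longrightarrow> \<phi> \<in> ops k m \<Longrightarrow> x \<in> simplices X n \<Longrightarrow>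
    oper X m \<phi> (oper X n \<theta> x) = oper X n (op_comp \<theta> \<phi>) x"
  using simplicial_set unfolding simplicial_set_def by blast

lemma edge_in [simp]: "u \<in> simplices X n \<Longrightarrow> i \<le> j \<Longrightarrow> j \<le> n \<Longrightarrow> edge X n u i j \<in> simplices X 1"
  by (simp add: edge_def oper_in)

lemma edge_oper: "\<theta> \<in> ops m n \<Longrightarrow> u \<in> simplices X n \<Longrightarrow> i \<le> j \<Longrightarrow> j \<le> m \<Longrightarrow>
    edge X m (oper X n \<theta> u) i j = edge X n u (\<theta> ! i) (\<theta> ! j)"
  by (simp add: edge_def oper_oper[where k = 1] op_comp_def)

lemma edge_1 [simp]: "x \<in> simplices X 1 \<Longrightarrow> edge X 1 x 0 1 = x"
  using oper_id[of x 1] by (simp add: edge_def One_nat_def)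

end

lemma simplicial_mapD1: "simplicial_map X Y f \<Longrightarrow> x \<in> simplices X n \<Longrightarrow> f n x \<in> simplices Y n"
  by (auto simp: simplicial_map_def)

lemma simplicial_mapD2: "simplicial_map X Y f \<Longrightarrow> \<theta> \<in> ops m n \<Longrightarrow> x \<in> simplices X n \<Longrightarrow>
    f m (oper X n \<theta> x) = oper Y n \<theta> (f n x)"
  by (auto simp: simplicial_map_def)

lemma simplicial_map_edge: "simplicial_map X Y f \<Longrightarrow> x \<in> simplices X n \<Longrightarrow> i \<le> j \<Longrightarrow> j \<le> n \<Longrightarrow>
    edge Y n (f n x) i j = f 1 (edge X n x i j)"
  by (simp add: edge_def simplicial_mapD2)

lemma simplicial_map_compose: "simplicial_map X Y f \<Longrightarrow> simplicial_map Y Z g \<Longrightarrow>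
    simplicial_map X Z (\<lambda>n x. g n (f n x))"
  by (simp add: simplicial_map_def)

lemma simplicial_map_cong: "simplicial_map X Y f \<Longrightarrow> simplicial_set X \<Longrightarrow>
    (\<And>n x. x \<in> simplices X n \<Longrightarrow> f n x = g n x) \<Longrightarrow> simplicial_map X Y g"
  by (simp add: simplicial_map_def simplicial_set_def)

text \<open>The inverse of a degreewise bijective simplicial map commutes with operators
  automatically: apply \<open>f\<close> to both sides and use injectivity.\<close>

lemma simplicial_isoI:
  assumes "simplicial_set X" "simplicial_map X Y f"
    and bij: "\<And>n. bij_betw (f n) (simplices X n) (simplices Y n)"
  shows "simplicial_iso X Y f"
proof -
  define g where "g n = inv_into (simplices X n) (f n)" for n
  have gf: "g n (f n x) = x" if "x \<in> simplices X n" for n x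
    using bij that by (simp add: g_def bij_betw_def)
  have fg: "f n (g n y) = y" if "y \<in> simplices Y n" for n y
    using bij that unfolding g_def by (rule bij_betw_inv_into_right)
  have gin: "g n y \<in> simplices X n" if "y \<in> simplices Y n" for n y
    using bij that unfolding g_def by (meson bij_betwE bij_betw_inv_into)
  have "g m (oper Y n \<theta> y) = oper X n \<theta> (g n y)" if "\<theta> \<in> ops m n" "y \<in> simplices Y n" for m n \<theta> y
  proof -
    have "oper Y n \<theta> y = f m (oper X n \<theta> (g n y))"
      using that simplicial_mapD2[OF assms(2) that(1) gin] fg by simp
    moreover have "oper X n \<theta> (g n y) \<in> simplices X m"
      using that gin sset.oper_in[OF sset.intro[OF assms(1)]] by blast
    ultimately show ?thesis using gf by simp
  qed
  then have "simplicial_map Y X g"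
    using gin by (simp add: simplicial_map_def)
  then show ?thesis
    using assms(2) gf fg by (auto simp: simplicial_iso_def)
qed

lemma simplicial_iso_bij: "simplicial_iso X Y f \<Longrightarrow> bij_betw (f n) (simplices X n) (simplices Y n)"
  unfolding simplicial_iso_def
  by (elim conjE exE) (rule_tac f' = "g n" in bij_betw_byWitness, auto simp: simplicial_mapD1)

lemma simplicial_iso_map: "simplicial_iso X Y f \<Longrightarrow> simplicial_map X Y f"
  by (simp add: simplicial_iso_def)

lemma simplicial_iso_compose:
  assumes "simplicial_iso X Y f" "simplicial_iso Y Z g"
  shows "simplicial_iso X Z (\<lambda>n x. g n (f n x))"
proof -
  obtain f' g' where f': "simplicial_map Y X f'" "\<forall>n. \<forall>x\<in>simplices X n. f' n (f n x) = x"
      "\<forall>n. \<forall>y\<in>simplices Y n. f n (f' n y) = y"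
    and g': "simplicial_map Z Y g'" "\<forall>n. \<forall>x\<in>simplices Y n. g' n (g n x) = x"
      "\<forall>n. \<forall>y\<in>simplices Z n. g n (g' n y) = y"
    using assms by (auto simp: simplicial_iso_def)
  show ?thesis
    unfolding simplicial_iso_def
  proof (intro conjI exI[of _ "\<lambda>n z. f' n (g' n z)"])
    show "simplicial_map X Z (\<lambda>n x. g n (f n x))"
      by (rule simplicial_map_compose[OF simplicial_iso_map simplicial_iso_map]) (rule assms)+
    show "simplicial_map Z X (\<lambda>n z. f' n (g' n z))"
      by (rule simplicial_map_compose[OF g'(1) f'(1)])
    show "\<forall>n. \<forall>x\<in>simplices X n. f' n (g' n (g n (f n x))) = x"
      using f'(2) g'(2) simplicial_mapD1[OF simplicial_iso_map[OF assms(1)]] by simp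
    show "\<forall>n. \<forall>y\<in>simplices Z n. g n (f n (f' n (g' n y))) = y"
      using f'(3) g'(3) simplicial_mapD1[OF g'(1)] by simp
  qed
qed

lemma simplicial_iso_inverse:
  assumes "simplicial_iso X Y f"
  obtains g where "simplicial_iso Y X g"
    "\<And>n x. x \<in> simplices X n \<Longrightarrow> g n (f n x) = x" "\<And>n y. y \<in> simplices Y n \<Longrightarrow> f n (g n y) = y"
proof -
  obtain g where g: "simplicial_map Y X g" "\<forall>n. \<forall>x\<in>simplices X n. g n (f n x) = x"
      "\<forall>n. \<forall>y\<in>simplices Y n. f n (g n y) = y"
    using assms by (auto simp: simplicial_iso_def)
  then have "simplicial_iso Y X g"
    using simplicial_iso_map[OF assms] unfolding simplicial_iso_def by blast
  then show thesis using that g by blast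
qed

section \<open>Partial monoids: words, products and edges\<close>

locale partial_mon =
  fixes M :: "'a sset"
  assumes partial_monoid: "partial_monoid M"

sublocale partial_mon \<subseteq> sset M
  using partial_monoid by unfold_locales (simp add: partial_monoid_def)

context partial_mon
begin

lemma vertex_eq: "v \<in> simplices M 0 \<longleftrightarrow> v = vertex M"
proof -
  have ex1: "\<exists>!v. v \<in> simplices M 0"
    using partial_monoid by (simp add: partial_monoid_def)
  from theI'[OF ex1] ex1 show ?thesis
    unfolding vertex_def by blast
qed

lemma vertex_in [simp]: "vertex M \<in> simplices M 0"
  by (simp add: vertex_eq)

text \<open>Injectivity of the spine covers dimensions from 1 on; in dimension 0 there is only the
  vertex.\<close>

lemma simplex_eqI:
  assumes "u \<in> simplices M n" "v \<in> simplices M n"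
    "\<And>i. i < n \<Longrightarrow> edge M n u i (Suc i) = edge M n v i (Suc i)"
  shows "u = v"
proof (cases "n = 0")
  case True
  then show ?thesis using assms vertex_eq by simp
next
  case False
  then have "inj_on (spine M n) (simplices M n)"
    using partial_monoid by (auto simp: partial_monoid_def)
  moreover have "spine M n u = spine M n v"
    using assms by (auto simp: spine_def edge_def)
  ultimately show ?thesis using assms by (auto dest: inj_onD)
qed

lemma spine_edge: "spine M n u = map (\<lambda>i. edge M n u i (Suc i)) [0..<n]"
  by (simp add: spine_def edge_def)

lemma edge_refl [simp]: "u \<in> simplices M n \<Longrightarrow> i \<le> n \<Longrightarrow> edge M n u i i = pg_one M"
proof -
  assume u: "u \<in> simplices M n" "i \<le> n"
  have "oper M n [i] u = vertex M"
    using u oper_in[of "[i]" 0 n u] by (simp add: vertex_eq)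
  then have "edge M n u i i = oper M 0 [0, 0] (vertex M)"
    using u oper_oper[of "[i]" 0 n "[0, 0]" 1 u] by (simp add: edge_def op_comp_def)
  then show ?thesis by (simp add: pg_one_def)
qed

lemma one_in [simp]: "pg_one M \<in> simplices M 1"
  by (simp add: pg_one_def oper_in)

lemma length_spine [simp]: "length (spine M n u) = n"
  by (simp add: spine_def)

lemma spine_nth [simp]: "i < n \<Longrightarrow> spine M n u ! i = edge M n u i (Suc i)"
  by (simp add: spine_edge)

lemma spine_2: "spine M 2 u = [edge M 2 u 0 1, edge M 2 u 1 2]"
  by (simp add: spine_edge numeral_2_eq_2 One_nat_def)

lemma spine_3: "spine M 3 u = [edge M 3 u 0 1, edge M 3 u 1 2, edge M 3 u 2 3]"
  by (simp add: spine_edge numeral_3_eq_3 numeral_2_eq_2 One_nat_def)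

lemma spine_eqD: "u \<in> simplices M n \<Longrightarrow> v \<in> simplices M n \<Longrightarrow> spine M n u = spine M n v \<Longrightarrow> u = v"
  using simplex_eqI[of u n v] spine_nth by metis

lemma is_word_spine [simp]: "u \<in> simplices M n \<Longrightarrow> is_word M (spine M n u)"
  by (auto simp: is_word_def)

lemma is_wordE:
  assumes "is_word M xs" "length xs = n"
  obtains u where "u \<in> simplices M n" "xs = spine M n u"
  using assms by (auto simp: is_word_def)

lemma simplex_spine [simp]: "u \<in> simplices M n \<Longrightarrow> simplex M (spine M n u) = u"
  unfolding simplex_def by (rule the_equality) (auto intro: spine_eqD)

lemma simplex_eqI': "u \<in> simplices M n \<Longrightarrow> length xs = n \<Longrightarrow>
    (\<And>i. i < n \<Longrightarrow> xs ! i = edge M n u i (Suc i)) \<Longrightarrow> is_word M xs \<and> simplex M xs = u"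
  by (metis is_word_spine length_spine nth_equalityI simplex_spine spine_nth)

lemma less_3_cases_iff: "i < 3 \<longleftrightarrow> i = 0 \<or> i = 1 \<or> i = (2::nat)"
  by auto

lemma simplex_2: "u \<in> simplices M n \<Longrightarrow> i \<le> j \<Longrightarrow> j \<le> k \<Longrightarrow> k \<le> n \<Longrightarrow>
    is_word M [edge M n u i j, edge M n u j k] \<and>
    simplex M [edge M n u i j, edge M n u j k] = oper M n [i, j, k] u"
  by (rule simplex_eqI'[of _ 2])
    (auto simp: oper_in edge_oper less_2_cases_iff One_nat_def[symmetric])

lemma simplex_3: "u \<in> simplices M n \<Longrightarrow> i \<le> j \<Longrightarrow> j \<le> k \<Longrightarrow> k \<le> l \<Longrightarrow> l \<le> n \<Longrightarrow>
    is_word M [edge M n u i j, edge M n u j k, edge M n u k l] \<and>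
    simplex M [edge M n u i j, edge M n u j k, edge M n u k l] = oper M n [i, j, k, l] u"
  by (rule simplex_eqI'[of _ 3])
    (auto simp: oper_in edge_oper less_3_cases_iff One_nat_def[symmetric])

text \<open>This takes the place of associativity. All composites of edges of one simplex are again
  its edges, so two bracketings agree as soon as a common simplex carries them.\<close>

lemma mult_edge: "u \<in> simplices M n \<Longrightarrow> i \<le> j \<Longrightarrow> j \<le> k \<Longrightarrow> k \<le> n \<Longrightarrow>
    pg_mult M (edge M n u i j) (edge M n u j k) = edge M n u i k"
  by (simp add: pg_prod_def Pi_map_def simplex_2 oper_oper[where k = 1] numeral_2_eq_2[symmetric])
    (simp add: edge_def op_comp_def)

lemma mult_edge_3: "u \<in> simplices M n \<Longrightarrow> i \<le> j \<Longrightarrow> j \<le> k \<Longrightarrow> k \<le> l \<Longrightarrow> l \<le> n \<Longrightarrow>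
    pg_prod M [edge M n u i j, edge M n u j k, edge M n u k l] = edge M n u i l"
  by (simp add: pg_prod_def Pi_map_def simplex_3 oper_oper[where k = 1] numeral_3_eq_3[symmetric])
    (simp add: edge_def op_comp_def)

lemma word2E:
  assumes "is_word M [x, y]"
  obtains u where "u \<in> simplices M 2" "edge M 2 u 0 1 = x" "edge M 2 u 1 2 = y" "simplex M [x, y] = u"
    "edge M 2 u 0 2 = pg_mult M x y"
proof -
  obtain u where u: "u \<in> simplices M 2" "[x, y] = spine M 2 u"
    using assms is_wordE[of "[x, y]" 2] by auto
  then have "x = edge M 2 u 0 1" "y = edge M 2 u 1 2"
    by (simp_all add: spine_2)
  then show thesis
    using that[of u] u mult_edge[of u 2 0 1 2] by (metis one_le_numeral order_refl simplex_spine zero_le)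
qed

lemma word3E:
  assumes "is_word M [x, y, z]"
  obtains u where "u \<in> simplices M 3" "edge M 3 u 0 1 = x" "edge M 3 u 1 2 = y" "edge M 3 u 2 3 = z"
proof -
  obtain u where u: "u \<in> simplices M 3" "[x, y, z] = spine M 3 u"
    using assms is_wordE[of "[x, y, z]" 3] by auto
  then have "x = edge M 3 u 0 1" "y = edge M 3 u 1 2" "z = edge M 3 u 2 3"
    by (simp_all add: spine_3)
  then show thesis using that u by simp
qed

lemma s0_in [simp]: "x \<in> simplices M 1 \<Longrightarrow> oper M 1 [0, 0, 1] x \<in> simplices M 2"
  and s1_in [simp]: "x \<in> simplices M 1 \<Longrightarrow> oper M 1 [0, 1, 1] x \<in> simplices M 2"
  by (simp_all add: oper_in)

lemma edge_s0: "x \<in> simplices M 1 \<Longrightarrow> edge M 2 (oper M 1 [0, 0, 1] x) 0 1 = pg_one M"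
    "x \<in> simplices M 1 \<Longrightarrow> edge M 2 (oper M 1 [0, 0, 1] x) 1 2 = x"
    "x \<in> simplices M 1 \<Longrightarrow> edge M 2 (oper M 1 [0, 0, 1] x) 0 2 = x"
  by (simp_all add: edge_oper)

lemma edge_s1: "x \<in> simplices M 1 \<Longrightarrow> edge M 2 (oper M 1 [0, 1, 1] x) 0 1 = x"
    "x \<in> simplices M 1 \<Longrightarrow> edge M 2 (oper M 1 [0, 1, 1] x) 1 2 = pg_one M"
    "x \<in> simplices M 1 \<Longrightarrow> edge M 2 (oper M 1 [0, 1, 1] x) 0 2 = x"
  by (simp_all add: edge_oper)

lemma one_mult [simp]: "x \<in> simplices M 1 \<Longrightarrow> pg_mult M (pg_one M) x = x"
  using mult_edge[of "oper M 1 [0, 0, 1] x" 2 0 1 2] by (simp add: edge_s0)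

lemma mult_one [simp]: "x \<in> simplices M 1 \<Longrightarrow> pg_mult M x (pg_one M) = x"
  using mult_edge[of "oper M 1 [0, 1, 1] x" 2 0 1 2] by (simp add: edge_s1)

lemma simplex_s0: "x \<in> simplices M 1 \<Longrightarrow>
    is_word M [pg_one M, x] \<and> simplex M [pg_one M, x] = oper M 1 [0, 0, 1] x"
  using simplex_2[of x 1 0 0 1] by simp

lemma simplex_s1: "x \<in> simplices M 1 \<Longrightarrow>
    is_word M [x, pg_one M] \<and> simplex M [x, pg_one M] = oper M 1 [0, 1, 1] x"
  using simplex_2[of x 1 0 1 1] by simp

end

section \<open>Partial groups: inverses and cancellation\<close>

locale partial_grp =
  fixes M :: "'a sset"
  assumes partial_group: "partial_group M"

sublocale partial_grp \<subseteq> partial_mon M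
  using partial_group by unfold_locales (simp add: partial_group_def)

context partial_grp
begin

definition invers where "invers = (SOME \<nu>. inversion M \<nu>)"

lemma inversion: "inversion M invers"
  using partial_group unfolding partial_group_def invers_def by (metis someI)

lemma invers_in: "u \<in> simplices M n \<Longrightarrow> invers n u \<in> simplices M n"
  using inversion by (auto simp: inversion_def simplicial_map_def sset_op_def)

lemma invers_oper: "\<theta> \<in> ops m n \<Longrightarrow> u \<in> simplices M n \<Longrightarrow>
   invers m (oper M n \<theta> u) = oper M n (map (\<lambda>i. n - i) (rev \<theta>)) (invers n u)"
  using inversion by (auto simp: inversion_def simplicial_map_def sset_op_def)

lemma invers_invers: "u \<in> simplices M n \<Longrightarrow> invers n (invers n u) = u"
  using inversion by (auto simp: inversion_def)

lemma edge_invers: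
  assumes "u \<in> simplices M n" "i \<le> j" "j \<le> n"
  shows "edge M n (invers n u) i j = invers 1 (edge M n u (n - j) (n - i))"
  using invers_oper[of "[n - j, n - i]" 1 n u] assms by (simp add: edge_def)

lemma invers_word:
  assumes "u \<in> simplices M n" "n \<ge> 1"
  obtains w where "w \<in> simplices M (2 * n)" "spine M (2 * n) w = spine M n (invers n u) @ spine M n u"
    "edge M (2 * n) w 0 (2 * n) = pg_one M"
  using assms inversion by (fastforce simp: inversion_def Pi_map_def edge_def)

lemma invers_mult: "x \<in> simplices M 1 \<Longrightarrow> pg_mult M (invers 1 x) x = pg_one M"
proof -
  assume x: "x \<in> simplices M 1"
  obtain w where w: "w \<in> simplices M 2" "spine M 2 w = spine M 1 (invers 1 x) @ spine M 1 x"
    "edge M 2 w 0 2 = pg_one M"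
    using invers_word[OF x] by auto
  have *: "spine M 1 y = [y]" if "y \<in> simplices M 1" for y
    using that by (simp add: spine_edge) (simp add: One_nat_def edge_1[unfolded One_nat_def])
  then have "spine M 2 w = [invers 1 x, x]"
    using w x invers_in by simp
  then have "edge M 2 w 0 1 = invers 1 x" "edge M 2 w 1 2 = x"
    by (simp_all add: spine_2)
  then show ?thesis using mult_edge[of w 2 0 1 2] w by simp
qed

text \<open>The inversion axiom is applied to the 2-simplex [x|a], not just to \<open>x\<close>. It
  yields a 4-simplex with spine a^-1, x^-1, x, a; its edge from 1 to 3 is trivial, so the edge from
  1 to 4 is both \<open>a\<close> and x^-1 (x a).\<close>

lemma invers_cancel:
  assumes "is_word M [x, a]"
  shows "pg_mult M (invers 1 x) (pg_mult M x a) = a"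
proof -
  obtain u where u: "u \<in> simplices M 2" "edge M 2 u 0 1 = x" "edge M 2 u 1 2 = a"
      "edge M 2 u 0 2 = pg_mult M x a"
    using assms word2E by blast
  obtain w where w: "w \<in> simplices M 4" "spine M 4 w = spine M 2 (invers 2 u) @ spine M 2 u"
    using invers_word[OF u(1)] by auto
  have "spine M 4 w ! 1 = invers 1 x" "spine M 4 w ! 2 = x" "spine M 4 w ! 3 = a"
    using u unfolding w by (auto simp: nth_append edge_invers) (auto simp: One_nat_def numeral_2_eq_2)
  then have e: "edge M 4 w 1 2 = invers 1 x" "edge M 4 w 2 3 = x" "edge M 4 w 3 4 = a"
    by (simp_all add: One_nat_def numeral_2_eq_2 numeral_3_eq_3 eval_nat_numeral)
  have x: "x \<in> simplices M 1" "a \<in> simplices M 1"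
    using u edge_in by force+
  have "edge M 4 w 1 3 = pg_one M"
    using mult_edge[of w 4 1 2 3] w(1) e invers_mult x by simp
  then have "edge M 4 w 1 4 = a"
    using mult_edge[of w 4 1 3 4] w(1) e x by simp
  moreover have "edge M 4 w 2 4 = pg_mult M x a"
    using mult_edge[of w 4 2 3 4] w(1) e by simp
  ultimately show ?thesis
    using mult_edge[of w 4 1 2 4] w(1) e by simp
qed

lemma left_cancel:
  assumes "is_word M [x, a]" "is_word M [x, b]" "pg_mult M x a = pg_mult M x b"
  shows "a = b"
  using assms invers_cancel by metis

lemma invers_word2:
  assumes "is_word M [a, x]"
  shows "is_word M [invers 1 x, invers 1 a]"
    "pg_mult M (invers 1 x) (invers 1 a) = invers 1 (pg_mult M a x)"
proof -
  obtain u where u: "u \<in> simplices M 2" "edge M 2 u 0 1 = a" "edge M 2 u 1 2 = x"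
      "edge M 2 u 0 2 = pg_mult M a x"
    using assms word2E by blast
  have *: "edge M 2 (invers 2 u) 0 1 = invers 1 x" "edge M 2 (invers 2 u) 1 2 = invers 1 a"
    "edge M 2 (invers 2 u) 0 2 = invers 1 (pg_mult M a x)"
    using u by (simp_all add: edge_invers One_nat_def[symmetric])
  then show "is_word M [invers 1 x, invers 1 a]"
    "pg_mult M (invers 1 x) (invers 1 a) = invers 1 (pg_mult M a x)"
    using simplex_2[of "invers 2 u" 2 0 1 2] mult_edge[of "invers 2 u" 2 0 1 2] u invers_in
    by simp_all
qed

text \<open>Inversion reverses words, which turns right cancellation into left cancellation.\<close>

lemma right_cancel:
  assumes "is_word M [a, x]" "is_word M [b, x]" "pg_mult M a x = pg_mult M b x"
    "a \<in> simplices M 1" "b \<in> simplices M 1"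
  shows "a = b"
  using left_cancel[of "invers 1 x" "invers 1 a" "invers 1 b"] invers_word2[OF assms(1)]
    invers_word2[OF assms(2)] assms invers_invers by metis

end

section \<open>Homotopies and gauge transformations\<close>

lemma edge_sset_prod: "edge (sset_prod X Y) n (x, y) i j = (edge X n x i j, edge Y n y i j)"
  by (simp add: edge_def sset_prod_def)

lemma edge_std_simplex: "edge (std_simplex k) n \<sigma> i j = [\<sigma> ! i, \<sigma> ! j]"
  by (simp add: edge_def std_simplex_def op_comp_def)

lemma simplices_sset_prod [simp]: "simplices (sset_prod X Y) n = simplices X n \<times> simplices Y n"
  by (simp add: sset_prod_def)

lemma simplices_std_simplex [simp]: "simplices (std_simplex k) n = ops n k"
  by (simp add: std_simplex_def)

lemma oper_sset_prod [simp]: "oper (sset_prod X Y) n \<theta> (x, y) = (oper X n \<theta> x, oper Y n \<theta> y)"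
  by (simp add: sset_prod_def)

lemma oper_std_simplex [simp]: "oper (std_simplex k) n \<theta> \<sigma> = op_comp \<sigma> \<theta>"
  by (simp add: std_simplex_def)

lemma (in sset) simplicial_set_prod: "simplicial_set (sset_prod X (std_simplex k))"
  by (auto simp: simplicial_set_def op_comp_ops oper_in oper_id oper_oper op_comp_assoc op_comp_id_right
      simp del: upt_Suc)

section \<open>The automorphism group\<close>

context partial_mon
begin

abbreviation "A \<equiv> AutGroup M"

lemma aut_iso: "f \<in> carrier A \<Longrightarrow> simplicial_iso M M f"
  by (simp add: AutGroup_def)

lemma aut_map: "f \<in> carrier A \<Longrightarrow> simplicial_map M M f"
  by (simp add: aut_iso simplicial_iso_map)

lemma aut_in [simp]: "f \<in> carrier A \<Longrightarrow> z \<in> simplices M n \<Longrightarrow> f n z \<in> simplices M n"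
  using aut_map simplicial_mapD1 by metis

lemma aut_edge: "f \<in> carrier A \<Longrightarrow> z \<in> simplices M n \<Longrightarrow> i \<le> j \<Longrightarrow> j \<le> n \<Longrightarrow>
    edge M n (f n z) i j = f 1 (edge M n z i j)"
  using aut_map simplicial_map_edge by metis

lemma aut_mult [simp]: "z \<in> simplices M n \<Longrightarrow> (f \<otimes>\<^bsub>A\<^esub> g) n z = f n (g n z)"
  by (simp add: AutGroup_def compose_def)

lemma aut_one [simp]: "z \<in> simplices M n \<Longrightarrow> \<one>\<^bsub>A\<^esub> n z = z"
  by (simp add: AutGroup_def)

text \<open>Simplices are determined by their edges and automorphisms are extensional, so agreement
  in degree 1 gives equality of terms.\<close>

lemma aut_eqI:
  assumes "f \<in> carrier A" "g \<in> carrier A" "\<And>x. x \<in> simplices M 1 \<Longrightarrow> f 1 x = g 1 x"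
  shows "f = g"
proof
  fix n
  show "f n = g n"
  proof (rule extensionalityI)
    show "f n \<in> extensional (simplices M n)" "g n \<in> extensional (simplices M n)"
      using assms by (simp_all add: AutGroup_def)
    show "f n z = g n z" if "z \<in> simplices M n" for z
      by (rule simplex_eqI[of _ n]) (simp_all add: aut_edge assms that)
  qed
qed

lemma aut_restrictI:
  assumes "simplicial_iso M M f"
  shows "(\<lambda>n. restrict (f n) (simplices M n)) \<in> carrier A"
proof -
  have "simplicial_map M M (\<lambda>n. restrict (f n) (simplices M n))"
    using simplicial_map_cong[OF simplicial_iso_map[OF assms] simplicial_set] by simp
  then have "simplicial_iso M M (\<lambda>n. restrict (f n) (simplices M n))"
    using simplicial_iso_bij[OF assms] bij_betw_cong[of "simplices M n" "restrict (f n) (simplices M n)" "f n" for n]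
    by (intro simplicial_isoI[OF simplicial_set]) simp_all
  then show ?thesis by (simp add: AutGroup_def)
qed

lemma aut_group: "group A"
proof (rule groupI)
  show "\<one>\<^bsub>A\<^esub> \<in> carrier A"
    using aut_restrictI[of "\<lambda>n x. x"] simplicial_isoI[OF simplicial_set, of M "\<lambda>n x. x"]
    by (simp add: simplicial_map_def AutGroup_def bij_betw_def)
  show m: "f \<otimes>\<^bsub>A\<^esub> g \<in> carrier A" if "f \<in> carrier A" "g \<in> carrier A" for f g
    using aut_restrictI[OF simplicial_iso_compose[OF aut_iso aut_iso], OF that(2,1)]
    by (simp add: AutGroup_def compose_def)
  show "f \<otimes>\<^bsub>A\<^esub> g \<otimes>\<^bsub>A\<^esub> h = f \<otimes>\<^bsub>A\<^esub> (g \<otimes>\<^bsub>A\<^esub> h)"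
    if "f \<in> carrier A" "g \<in> carrier A" "h \<in> carrier A" for f g h
    using that by (intro aut_eqI m) simp_all
  show "\<one>\<^bsub>A\<^esub> \<otimes>\<^bsub>A\<^esub> f = f" if "f \<in> carrier A" for f
    using that \<open>\<one>\<^bsub>A\<^esub> \<in> carrier A\<close> by (intro aut_eqI m) simp_all
  show "\<exists>g\<in>carrier A. g \<otimes>\<^bsub>A\<^esub> f = \<one>\<^bsub>A\<^esub>" if f: "f \<in> carrier A" for f
  proof -
    obtain g where g: "simplicial_iso M M g" "\<And>n x. x \<in> simplices M n \<Longrightarrow> g n (f n x) = x"
      using simplicial_iso_inverse[OF aut_iso[OF f]] by metis
    have "(\<lambda>n. restrict (g n) (simplices M n)) \<otimes>\<^bsub>A\<^esub> f = \<one>\<^bsub>A\<^esub>"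
      using f g aut_restrictI[OF g(1)] \<open>\<one>\<^bsub>A\<^esub> \<in> carrier A\<close> by (intro aut_eqI m) simp_all
    then show ?thesis using aut_restrictI[OF g(1)] by blast
  qed
qed

end

sublocale partial_mon \<subseteq> A: group "AutGroup M"
  by (rule aut_group)

context partial_mon
begin

lemma aut_inv1 [simp]: "f \<in> carrier A \<Longrightarrow> z \<in> simplices M n \<Longrightarrow> (inv\<^bsub>A\<^esub> f) n (f n z) = z"
  by (metis A.l_inv aut_mult aut_one)

lemma aut_inv2 [simp]: "f \<in> carrier A \<Longrightarrow> z \<in> simplices M n \<Longrightarrow> f n ((inv\<^bsub>A\<^esub> f) n z) = z"
  by (metis A.r_inv aut_mult aut_one)

lemma aut_inv_in [simp]: "f \<in> carrier A \<Longrightarrow> z \<in> simplices M n \<Longrightarrow> (inv\<^bsub>A\<^esub> f) n z \<in> simplices M n"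
  by simp

lemma map_mult:
  assumes "simplicial_map M M f" "is_word M [x, y]"
  shows "is_word M [f 1 x, f 1 y]" "pg_mult M (f 1 x) (f 1 y) = f 1 (pg_mult M x y)"
proof -
  obtain u where u: "u \<in> simplices M 2" "edge M 2 u 0 1 = x" "edge M 2 u 1 2 = y"
      "edge M 2 u 0 2 = pg_mult M x y"
    using assms word2E by blast
  have "f 2 u \<in> simplices M 2"
    using u assms simplicial_mapD1 by metis
  moreover have "edge M 2 (f 2 u) 0 1 = f 1 x" "edge M 2 (f 2 u) 1 2 = f 1 y"
    "edge M 2 (f 2 u) 0 2 = f 1 (pg_mult M x y)"
    using u simplicial_map_edge[OF assms(1)] by simp_all
  ultimately show "is_word M [f 1 x, f 1 y]" "pg_mult M (f 1 x) (f 1 y) = f 1 (pg_mult M x y)"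
    using simplex_2[of "f 2 u" 2 0 1 2] mult_edge[of "f 2 u" 2 0 1 2] by simp_all
qed

lemma map_one:
  assumes "simplicial_map M M f"
  shows "f 1 (pg_one M) = pg_one M"
proof -
  have "f 0 (vertex M) = vertex M"
    using simplicial_mapD1[OF assms vertex_in] by (simp add: vertex_eq)
  then show ?thesis
    using simplicial_mapD2[OF assms, of "[0, 0]" 1 0 "vertex M"] by (simp add: pg_one_def)
qed

lemma aut_1 [simp]: "f \<in> carrier A \<Longrightarrow> f 1 (pg_one M) = pg_one M"
  by (simp add: aut_map map_one)

section \<open>Homotopies of maps from a partial monoid to itself\<close>

abbreviation "MI \<equiv> sset_prod M (std_simplex 1)"

text \<open>The prism over the edge \<open>x\<close> consists of two triangles with the common
  diagonal \<open>(x, [0, 1])\<close>. One passes along the bottom copy of \<open>x\<close> and then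
  up, the other goes up and then along the top copy; their images under \<open>F\<close> are the two
  words.\<close>

lemma homotopy_mult:
  assumes F: "simplicial_map MI M F" and x: "x \<in> simplices M 1"
  shows "is_word M [F 1 (x, [0, 0]), F 1 (pg_one M, [0, 1])]"
    "pg_mult M (F 1 (x, [0, 0])) (F 1 (pg_one M, [0, 1])) = F 1 (x, [0, 1])"
    "is_word M [F 1 (pg_one M, [0, 1]), F 1 (x, [1, 1])]"
    "pg_mult M (F 1 (pg_one M, [0, 1])) (F 1 (x, [1, 1])) = F 1 (x, [0, 1])"
proof -
  define u where "u = (oper M 1 [0, 1, 1] x, [0, 0, 1::nat])"
  define v where "v = (oper M 1 [0, 0, 1] x, [0, 1, 1::nat])"
  have uv: "u \<in> simplices MI 2" "v \<in> simplices MI 2"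
    using x by (simp_all add: u_def v_def)
  have Fuv: "F 2 u \<in> simplices M 2" "F 2 v \<in> simplices M 2"
    using uv F simplicial_mapD1 by metis+
  have eu: "edge M 2 (F 2 u) 0 1 = F 1 (x, [0, 0])" "edge M 2 (F 2 u) 1 2 = F 1 (pg_one M, [0, 1])"
    "edge M 2 (F 2 u) 0 2 = F 1 (x, [0, 1])"
    using simplicial_map_edge[OF F uv(1)] x
    by (simp_all add: u_def edge_sset_prod edge_std_simplex edge_s1)
  have ev: "edge M 2 (F 2 v) 0 1 = F 1 (pg_one M, [0, 1])" "edge M 2 (F 2 v) 1 2 = F 1 (x, [1, 1])"
    "edge M 2 (F 2 v) 0 2 = F 1 (x, [0, 1])"
    using simplicial_map_edge[OF F uv(2)] x
    by (simp_all add: v_def edge_sset_prod edge_std_simplex edge_s0)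
  show "is_word M [F 1 (x, [0, 0]), F 1 (pg_one M, [0, 1])]"
    "pg_mult M (F 1 (x, [0, 0])) (F 1 (pg_one M, [0, 1])) = F 1 (x, [0, 1])"
    using simplex_2[OF Fuv(1), of 0 1 2] mult_edge[OF Fuv(1), of 0 1 2] by (simp_all add: eu)
  show "is_word M [F 1 (pg_one M, [0, 1]), F 1 (x, [1, 1])]"
    "pg_mult M (F 1 (pg_one M, [0, 1])) (F 1 (x, [1, 1])) = F 1 (x, [0, 1])"
    using simplex_2[OF Fuv(2), of 0 1 2] mult_edge[OF Fuv(2), of 0 1 2] by (simp_all add: ev)
qed

text \<open>The witness \<open>F\<close> hidden in \<open>homotopic_via\<close> is kept explicit,
  since composition, inversion and evaluation on simplices all operate on it.\<close>

definition homotopy where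
  "homotopy F f \<eta> g \<longleftrightarrow> simplicial_map MI M F \<and>
        (\<forall>n. \<forall>y\<in>simplices M n. f n y = F n (y, replicate (Suc n) 0)) \<and>
        (\<forall>n. \<forall>y\<in>simplices M n. g n y = F n (y, replicate (Suc n) 1)) \<and>
        F 1 (pg_one M, [0, 1]) = \<eta>"

lemma homotopic_via_iff: "homotopic_via M M f \<eta> g \<longleftrightarrow> (\<exists>F. homotopy F f \<eta> g)"
  by (simp add: homotopic_via_def homotopy_def del: replicate_Suc)

lemma homotopyD:
  assumes F: "homotopy F f \<eta> g"
  shows "\<eta> \<in> simplices M 1"
    "x \<in> simplices M 1 \<Longrightarrow> F 1 (x, [0, 0]) = f 1 x"
    "x \<in> simplices M 1 \<Longrightarrow> F 1 (x, [1, 1]) = g 1 x"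
    "x \<in> simplices M 1 \<Longrightarrow> F 1 (x, [0, 1]) = pg_mult M \<eta> (g 1 x)"
    "x \<in> simplices M 1 \<Longrightarrow> pg_mult M (f 1 x) \<eta> = pg_mult M \<eta> (g 1 x)"
    "x \<in> simplices M 1 \<Longrightarrow> is_word M [f 1 x, \<eta>]"
    "x \<in> simplices M 1 \<Longrightarrow> is_word M [\<eta>, g 1 x]"
proof -
  have F': "simplicial_map MI M F" and \<eta>: "F 1 (pg_one M, [0, 1]) = \<eta>"
    using F by (auto simp: homotopy_def)
  have r: "replicate (Suc 1) k = [k, k]" for k :: nat
    by (simp add: One_nat_def)
  show "\<eta> \<in> simplices M 1"
    using simplicial_mapD1[OF F', of "(pg_one M, [0, 1])" 1] \<eta> by simp
  assume x: "x \<in> simplices M 1"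
  then show "F 1 (x, [0, 0]) = f 1 x" "F 1 (x, [1, 1]) = g 1 x"
    using F r unfolding homotopy_def by metis+
  then show "F 1 (x, [0, 1]) = pg_mult M \<eta> (g 1 x)" "pg_mult M (f 1 x) \<eta> = pg_mult M \<eta> (g 1 x)"
    "is_word M [f 1 x, \<eta>]" "is_word M [\<eta>, g 1 x]"
    using homotopy_mult[OF F' x] \<eta> by simp_all
qed

lemma homotopy_refl: "simplicial_map M M f \<Longrightarrow> homotopy (\<lambda>n p. f n (fst p)) f (pg_one M) f"
  by (auto simp: homotopy_def simplicial_map_def map_one)

text \<open>\<open>F'\<close> is applied first, the coordinate in \<Delta>[1] is carried along, and
  then \<open>F\<close> is applied. The label is \<open>F\<close> evaluated at the edge
  \<open>(\<theta>, [0, 1])\<close>.\<close>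

lemma homotopy_compose:
  assumes F: "homotopy F f \<eta> g" and F': "homotopy F' f' \<theta> g'"
    and g': "simplicial_map M M g'" and f': "simplicial_map M M f'"
  shows "homotopy (\<lambda>n p. F n (F' n p, snd p)) (f \<otimes>\<^bsub>A\<^esub> f') (pg_mult M \<eta> (g 1 \<theta>)) (g \<otimes>\<^bsub>A\<^esub> g')"
  unfolding homotopy_def
proof (intro conjI allI ballI)
  have m: "simplicial_map MI M F" "simplicial_map MI M F'"
    using F F' by (auto simp: homotopy_def)
  show "simplicial_map MI M (\<lambda>n p. F n (F' n p, snd p))"
    unfolding simplicial_map_def
  proof (intro conjI allI ballI)
    fix n p assume p: "p \<in> simplices MI n"
    then have *: "(F' n p, snd p) \<in> simplices MI n"
      using simplicial_mapD1[OF m(2)] by auto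
    then show "F n (F' n p, snd p) \<in> simplices M n"
      using simplicial_mapD1[OF m(1)] by blast
    fix m \<theta> assume "\<theta> \<in> ops m n"
    then show "F m (F' m (oper MI n \<theta> p), snd (oper MI n \<theta> p)) = oper M n \<theta> (F n (F' n p, snd p))"
      using simplicial_mapD2[OF m(1) _ *, of \<theta> m] simplicial_mapD2[OF m(2) _ p, of \<theta> m]
      by (cases p) simp
  qed
  show "F 1 (F' 1 (pg_one M, [0, 1]), snd (pg_one M, [0, 1])) = pg_mult M \<eta> (g 1 \<theta>)"
    using homotopyD[OF F] homotopyD(1)[OF F'] F' by (simp add: homotopy_def)
  fix n y assume y: "y \<in> simplices M n"
  then show "(f \<otimes>\<^bsub>A\<^esub> f') n y = F n (F' n (y, replicate (Suc n) 0), snd (y, replicate (Suc n) 0))"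
    using F F' simplicial_mapD1[OF f' y] unfolding homotopy_def by simp
  show "(g \<otimes>\<^bsub>A\<^esub> g') n y = F n (F' n (y, replicate (Suc n) 1), snd (y, replicate (Suc n) 1))"
    using F F' simplicial_mapD1[OF g' y] y unfolding homotopy_def by simp
qed

end

context partial_grp
begin

lemma invers_one: "invers 1 (pg_one M) = pg_one M"
  using invers_oper[of "[0, 0]" 1 0 "vertex M"] invers_in[of "vertex M" 0] vertex_eq
  by (simp add: pg_one_def)

lemma invers_is_word: "x \<in> simplices M 1 \<Longrightarrow> is_word M [invers 1 x, x]"
proof -
  assume x: "x \<in> simplices M 1"
  obtain w where w: "w \<in> simplices M 2" "spine M 2 w = spine M 1 (invers 1 x) @ spine M 1 x"
    using invers_word[OF x] by auto
  have *: "spine M 1 y = [y]" if "y \<in> simplices M 1" for y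
    using that by (simp add: spine_edge) (simp add: One_nat_def edge_1[unfolded One_nat_def])
  then have "spine M 2 w = [invers 1 x, x]"
    using w x invers_in by simp
  then show ?thesis using w is_word_spine by metis
qed

text \<open>On edges this is uniqueness of left inverses, by \<open>right_cancel\<close>; in higher
  dimensions both sides have the same spine.\<close>

lemma map_invers:
  assumes f: "simplicial_map M M f" and z: "z \<in> simplices M n"
  shows "f n (invers n z) = invers n (f n z)"
proof (rule simplex_eqI[of _ n])
  have *: "f 1 (invers 1 x) = invers 1 (f 1 x)" if x: "x \<in> simplices M 1" for x
  proof (rule right_cancel[of _ "f 1 x"])
    show "is_word M [f 1 (invers 1 x), f 1 x]" "is_word M [invers 1 (f 1 x), f 1 x]"
      "pg_mult M (f 1 (invers 1 x)) (f 1 x) = pg_mult M (invers 1 (f 1 x)) (f 1 x)"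
      using map_mult[OF f invers_is_word[OF x]] map_one[OF f] invers_mult[OF x]
        invers_is_word invers_mult simplicial_mapD1[OF f x] by simp_all
  qed (use x invers_in simplicial_mapD1[OF f] in blast)+
  show "f n (invers n z) \<in> simplices M n" "invers n (f n z) \<in> simplices M n"
    using z invers_in simplicial_mapD1[OF f] by blast+
  fix i assume "i < n"
  then show "edge M n (f n (invers n z)) i (Suc i) = edge M n (invers n (f n z)) i (Suc i)"
    using z invers_in simplicial_mapD1[OF f] by (simp add: simplicial_map_edge[OF f] edge_invers *)
qed

text \<open>Conjugating \<open>F\<close> with the inversion M -> M^op needs an identification of
  \<Delta>[1] with its opposite, namely reversal together with i -> 1 - i. This exchanges the two
  ends of the homotopy and inverts its label.\<close>

lemma homotopy_inverse:
  assumes F: "homotopy F f \<eta> g" and f: "simplicial_map M M f" and g: "simplicial_map M M g"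
  shows "homotopy (\<lambda>n p. invers n (F n (invers n (fst p), map (\<lambda>i. 1 - i) (rev (snd p))))) g (invers 1 \<eta>) f"
  unfolding homotopy_def
proof (intro conjI allI ballI)
  have m: "simplicial_map MI M F"
    using F by (auto simp: homotopy_def)
  show "simplicial_map MI M (\<lambda>n p. invers n (F n (invers n (fst p), map (\<lambda>i. 1 - i) (rev (snd p)))))"
    unfolding simplicial_map_def
  proof (intro conjI allI ballI)
    fix n p assume p: "p \<in> simplices MI n"
    define q where "q = (invers n (fst p), map (\<lambda>i. 1 - i) (rev (snd p)))"
    have flip: "map (\<lambda>i. 1 - i) (rev \<sigma>) \<in> ops k 1" if "\<sigma> \<in> ops k 1" for \<sigma> k
      using that by (auto simp: ops_def sorted_map sorted_wrt_rev elim!: sorted_wrt_mono_rel[rotated])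
    have q: "q \<in> simplices MI n"
      using p invers_in flip by (auto simp: q_def)
    then show in_M: "invers n (F n (invers n (fst p), map (\<lambda>i. 1 - i) (rev (snd p)))) \<in> simplices M n"
      using simplicial_mapD1[OF m] invers_in unfolding q_def by blast
    fix m' \<theta> assume \<theta>: "\<theta> \<in> ops m' n"
    define \<theta>' where "\<theta>' = map (\<lambda>i. n - i) (rev \<theta>)"
    have \<theta>': "\<theta>' \<in> ops m' n"
      using \<theta> by (auto simp: \<theta>'_def ops_def sorted_map sorted_wrt_rev elim!: sorted_wrt_mono_rel[rotated])
    have len: "length (snd p) = Suc n" using p ops_length by auto
    have "oper MI n \<theta>' q = (invers m' (fst (oper MI n \<theta> p)), map (\<lambda>i. 1 - i) (rev (snd (oper MI n \<theta> p))))"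
    proof -
      have "op_comp (map (\<lambda>i. 1 - i) (rev (snd p))) \<theta>' = map (\<lambda>i. 1 - i) (rev (op_comp (snd p) \<theta>))"
        using len \<theta> by (auto simp: op_comp_def \<theta>'_def rev_map rev_nth ops_def less_Suc_eq_le subset_iff)
      then show ?thesis
        using p \<theta> invers_oper[OF \<theta>, of "fst p"] by (cases p) (simp add: q_def \<theta>'_def)
    qed
    moreover have "invers m' (F m' (oper MI n \<theta>' q)) = oper M n \<theta> (invers n (F n q))"
    proof -
      have "map (\<lambda>i. n - i) (rev \<theta>') = \<theta>"
        using \<theta> by (auto simp: \<theta>'_def rev_map ops_def subset_iff intro!: map_idI)
      then show ?thesis
        using simplicial_mapD2[OF m \<theta>' q] invers_oper[OF \<theta>', of "F n q"] simplicial_mapD1[OF m q] by simp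
    qed
    ultimately show "invers m' (F m' (invers m' (fst (oper MI n \<theta> p)),
          map (\<lambda>i. 1 - i) (rev (snd (oper MI n \<theta> p))))) =
        oper M n \<theta> (invers n (F n (invers n (fst p), map (\<lambda>i. 1 - i) (rev (snd p)))))"
      by (simp add: q_def)
  qed
  show "invers 1 (F 1 (invers 1 (fst (pg_one M, [0, 1])), map (\<lambda>i. 1 - i) (rev (snd (pg_one M, [0, 1]))))) =
      invers 1 \<eta>"
    using F by (simp add: invers_one homotopy_def)
  fix n y assume y: "y \<in> simplices M n"
  have *: "map (\<lambda>i. 1 - i) (rev (replicate (Suc n) k)) = replicate (Suc n) (1 - k)" for k :: nat
    by (simp add: replicate_append_same)
  have Fgf: "F n (invers n y, replicate (Suc n) 1) = g n (invers n y)"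
    "F n (invers n y, replicate (Suc n) 0) = f n (invers n y)"
    using F invers_in[OF y] by (auto simp: homotopy_def simp del: replicate_Suc)
  show "g n y = invers n (F n (invers n (fst (y, replicate (Suc n) 0)),
      map (\<lambda>i. 1 - i) (rev (snd (y, replicate (Suc n) 0)))))"
    using map_invers[OF g y] Fgf invers_invers simplicial_mapD1[OF g y]
    by (simp add: * del: replicate_Suc)
  show "f n y = invers n (F n (invers n (fst (y, replicate (Suc n) 1)),
      map (\<lambda>i. 1 - i) (rev (snd (y, replicate (Suc n) 1)))))"
    using map_invers[OF f y] Fgf invers_invers simplicial_mapD1[OF f y]
    by (simp add: * del: replicate_Suc)
qed

section \<open>Conjugation automorphisms and the group N(M)\<close>

abbreviation "c \<equiv> conj_aut M"
abbreviation "N \<equiv> NGroup M"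

abbreviation nmult (infixl "\<cdot>" 70) where "x \<cdot> y \<equiv> x \<otimes>\<^bsub>NGroup M\<^esub> y"

text \<open>In f(x) \<eta> = \<eta> g(x) the element \<eta> can be cancelled on the right. This is
  what makes the description \<open>conj_aut\<close> meaningful.\<close>

lemma conj_unique:
  assumes "homotopic_via M M f \<eta> g" "homotopic_via M M f' \<eta> g" "f \<in> carrier A" "f' \<in> carrier A"
  shows "f = f'"
proof -
  obtain F F' where F: "homotopy F f \<eta> g" and F': "homotopy F' f' \<eta> g"
    using assms homotopic_via_iff by blast
  show ?thesis
  proof (rule aut_eqI)
    fix x assume x: "x \<in> simplices M 1"
    show "f 1 x = f' 1 x"
      using right_cancel[OF homotopyD(6)[OF F x] homotopyD(6)[OF F' x]] homotopyD(5)[OF F x] homotopyD(5)[OF F' x] x assms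
      by simp
  qed (use assms in auto)
qed

lemma NSetI:
  assumes "f \<in> carrier A" "homotopic_via M M f \<eta> \<one>\<^bsub>A\<^esub>"
  shows "\<eta> \<in> NSet M" "c \<eta> = f"
proof -
  show "\<eta> \<in> NSet M"
    using assms homotopyD(1) unfolding NSet_def homotopic_via_iff by blast
  show "c \<eta> = f"
    unfolding conj_aut_def
    by (rule the_equality) (use assms conj_unique in blast)+
qed

lemma NSetD:
  assumes "\<eta> \<in> NSet M"
  shows "\<eta> \<in> simplices M 1" "c \<eta> \<in> carrier A" "homotopic_via M M (c \<eta>) \<eta> \<one>\<^bsub>A\<^esub>"
  using assms NSetI unfolding NSet_def by auto

lemma NSet_homotopy: "\<eta> \<in> NSet M \<Longrightarrow> \<exists>F. homotopy F (c \<eta>) \<eta> \<one>\<^bsub>A\<^esub>"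
  using NSetD(3) homotopic_via_iff by blast

lemma lmul:
  assumes "\<eta> \<in> NSet M" "x \<in> simplices M 1"
  shows "is_word M [\<eta>, x]" "pg_mult M \<eta> x \<in> simplices M 1"
    "is_word M [c \<eta> 1 x, \<eta>]" "pg_mult M (c \<eta> 1 x) \<eta> = pg_mult M \<eta> x"
proof -
  obtain F where F: "homotopy F (c \<eta>) \<eta> \<one>\<^bsub>A\<^esub>"
    using assms NSet_homotopy by blast
  show w: "is_word M [\<eta>, x]" and "is_word M [c \<eta> 1 x, \<eta>]" "pg_mult M (c \<eta> 1 x) \<eta> = pg_mult M \<eta> x"
    using homotopyD[OF F] assms by auto
  show "pg_mult M \<eta> x \<in> simplices M 1"
    using word2E[OF w] edge_in by (metis le0 order_refl)
qed

text \<open>The composite homotopy has label \<eta> \<theta>. Evaluated at the edge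
  \<open>(x, [0, 1])\<close> it gives (\<eta> \<theta>) x from its label and \<eta> (\<theta> x)
  from its construction, which proves associativity although no simplex [\<eta>|\<theta>|x] is
  displayed.\<close>

lemma N_mult:
  assumes "\<eta> \<in> NSet M" "\<theta> \<in> NSet M"
  shows "pg_mult M \<eta> \<theta> \<in> NSet M" "c (pg_mult M \<eta> \<theta>) = c \<eta> \<otimes>\<^bsub>A\<^esub> c \<theta>"
    "x \<in> simplices M 1 \<Longrightarrow> pg_mult M (pg_mult M \<eta> \<theta>) x = pg_mult M \<eta> (pg_mult M \<theta> x)"
proof -
  obtain F F' where F: "homotopy F (c \<eta>) \<eta> \<one>\<^bsub>A\<^esub>" and F': "homotopy F' (c \<theta>) \<theta> \<one>\<^bsub>A\<^esub>"
    using assms NSet_homotopy by blast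
  have *: "homotopy (\<lambda>n p. F n (F' n p, snd p)) (c \<eta> \<otimes>\<^bsub>A\<^esub> c \<theta>) (pg_mult M \<eta> \<theta>) \<one>\<^bsub>A\<^esub>"
    using homotopy_compose[OF F F'] assms NSetD by (simp add: aut_map)
  then show "pg_mult M \<eta> \<theta> \<in> NSet M" "c (pg_mult M \<eta> \<theta>) = c \<eta> \<otimes>\<^bsub>A\<^esub> c \<theta>"
    using NSetI[of "c \<eta> \<otimes>\<^bsub>A\<^esub> c \<theta>" "pg_mult M \<eta> \<theta>"] NSetD(2) assms homotopic_via_iff by blast+
  assume x: "x \<in> simplices M 1"
  show "pg_mult M (pg_mult M \<eta> \<theta>) x = pg_mult M \<eta> (pg_mult M \<theta> x)"
    using homotopyD(4)[OF *, of x] homotopyD(4)[OF F, of "pg_mult M \<theta> x"] homotopyD(4)[OF F', of x]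
      x lmul(2)[OF assms(2) x] by simp
qed

lemma N_one: "pg_one M \<in> NSet M" "c (pg_one M) = \<one>\<^bsub>A\<^esub>"
proof -
  have "homotopic_via M M \<one>\<^bsub>A\<^esub> (pg_one M) \<one>\<^bsub>A\<^esub>"
    using homotopy_refl[OF aut_map[OF A.one_closed]] homotopic_via_iff by blast
  then show "pg_one M \<in> NSet M" "c (pg_one M) = \<one>\<^bsub>A\<^esub>"
    using NSetI A.one_closed by blast+
qed

lemma homotopic_compose_aut:
  assumes "homotopic_via M M f \<eta> g" "f \<in> carrier A" "g \<in> carrier A" "h \<in> carrier A"
  shows "homotopic_via M M (f \<otimes>\<^bsub>A\<^esub> h) \<eta> (g \<otimes>\<^bsub>A\<^esub> h)" "homotopic_via M M (h \<otimes>\<^bsub>A\<^esub> f) (h 1 \<eta>) (h \<otimes>\<^bsub>A\<^esub> g)"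
proof -
  obtain F where F: "homotopy F f \<eta> g"
    using assms homotopic_via_iff by blast
  have h: "homotopy (\<lambda>n p. h n (fst p)) h (pg_one M) h"
    using homotopy_refl[OF aut_map[OF assms(4)]] .
  show "homotopic_via M M (f \<otimes>\<^bsub>A\<^esub> h) \<eta> (g \<otimes>\<^bsub>A\<^esub> h)"
    using homotopy_compose[OF F h] assms aut_map homotopyD(1)[OF F] homotopic_via_iff by auto
  show "homotopic_via M M (h \<otimes>\<^bsub>A\<^esub> f) (h 1 \<eta>) (h \<otimes>\<^bsub>A\<^esub> g)"
    using homotopy_compose[OF h F] assms aut_map homotopyD(1)[OF F] homotopic_via_iff by auto
qed

text \<open>Composing a homotopy on the right with an automorphism leaves its label unchanged, so
  every homotopy between automorphisms reduces to one starting at the identity. Homotopies thereby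
  become equations in \<open>Aut(M)\<close>.\<close>

lemma homotopic_via_aut_iff:
  assumes "f \<in> carrier A" "g \<in> carrier A"
  shows "homotopic_via M M f \<eta> g \<longleftrightarrow> \<eta> \<in> NSet M \<and> f = c \<eta> \<otimes>\<^bsub>A\<^esub> g"
proof
  assume "homotopic_via M M f \<eta> g"
  then have "homotopic_via M M (f \<otimes>\<^bsub>A\<^esub> inv\<^bsub>A\<^esub> g) \<eta> \<one>\<^bsub>A\<^esub>"
    using homotopic_compose_aut(1)[of f \<eta> g "inv\<^bsub>A\<^esub> g"] assms by simp
  then show "\<eta> \<in> NSet M \<and> f = c \<eta> \<otimes>\<^bsub>A\<^esub> g"
    using NSetI[of "f \<otimes>\<^bsub>A\<^esub> inv\<^bsub>A\<^esub> g" \<eta>] assms by (simp add: A.m_assoc)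
next
  assume "\<eta> \<in> NSet M \<and> f = c \<eta> \<otimes>\<^bsub>A\<^esub> g"
  then show "homotopic_via M M f \<eta> g"
    using homotopic_compose_aut(1)[of "c \<eta>" \<eta> "\<one>\<^bsub>A\<^esub>" g] assms NSetD by simp
qed

text \<open>Composing c(\<eta>) <- 1 on the left with \<open>f\<close> moves the label to f(\<eta>);
  rewriting the result as an equation in \<open>Aut(M)\<close> gives the conjugation
  formula.\<close>

lemma aut_N:
  assumes "f \<in> carrier A" "\<eta> \<in> NSet M"
  shows "f 1 \<eta> \<in> NSet M" "c (f 1 \<eta>) = f \<otimes>\<^bsub>A\<^esub> c \<eta> \<otimes>\<^bsub>A\<^esub> inv\<^bsub>A\<^esub> f"
proof -
  have "homotopic_via M M (f \<otimes>\<^bsub>A\<^esub> c \<eta>) (f 1 \<eta>) (f \<otimes>\<^bsub>A\<^esub> \<one>\<^bsub>A\<^esub>)"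
    using homotopic_compose_aut(2)[OF NSetD(3)] NSetD(2) assms by blast
  then have "f 1 \<eta> \<in> NSet M \<and> f \<otimes>\<^bsub>A\<^esub> c \<eta> = c (f 1 \<eta>) \<otimes>\<^bsub>A\<^esub> f"
    using homotopic_via_aut_iff[of "f \<otimes>\<^bsub>A\<^esub> c \<eta>" f] assms NSetD(2) by simp
  then show "f 1 \<eta> \<in> NSet M" "c (f 1 \<eta>) = f \<otimes>\<^bsub>A\<^esub> c \<eta> \<otimes>\<^bsub>A\<^esub> inv\<^bsub>A\<^esub> f"
    using assms NSetD(2) by (simp_all add: A.inv_solve_right)
qed

text \<open>The reversed homotopy ends at the identity and starts at c(\<eta>); since this is again
  a homotopy between automorphisms, its label lies in \<open>N(M)\<close>.\<close>

lemma N_invers: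
  assumes "\<eta> \<in> NSet M"
  shows "invers 1 \<eta> \<in> NSet M"
proof -
  obtain F where F: "homotopy F (c \<eta>) \<eta> \<one>\<^bsub>A\<^esub>"
    using assms NSet_homotopy by blast
  have "homotopic_via M M \<one>\<^bsub>A\<^esub> (invers 1 \<eta>) (c \<eta>)"
    using homotopy_inverse[OF F] assms NSetD(2) aut_map homotopic_via_iff by blast
  then show ?thesis
    using homotopic_via_aut_iff[of "\<one>\<^bsub>A\<^esub>" "c \<eta>"] assms NSetD(2) by blast
qed

lemma N_group: "group N"
proof (rule groupI)
  show "\<exists>y\<in>carrier N. y \<cdot> x = \<one>\<^bsub>N\<^esub>" if "x \<in> carrier N" for x
    using that N_invers invers_mult NSetD(1) by (auto simp: NGroup_def)
qed (auto simp: NGroup_def N_mult N_one NSetD(1))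

end

sublocale partial_grp \<subseteq> N: group "NGroup M"
  by (rule N_group)

section \<open>Two-sided multiplication by N(M) and gauge transformations\<close>

context partial_grp
begin

lemma carrier_N: "carrier N = NSet M"
  and mult_N: "\<eta> \<cdot> \<theta> = pg_mult M \<eta> \<theta>"
  and one_N: "\<one>\<^bsub>N\<^esub> = pg_one M"
  by (simp_all add: NGroup_def)

lemma N_in [simp]: "\<eta> \<in> carrier N \<Longrightarrow> \<eta> \<in> simplices M 1"
  by (simp add: carrier_N NSetD)

lemma c_in [simp]: "\<eta> \<in> carrier N \<Longrightarrow> c \<eta> \<in> carrier A"
  by (simp add: carrier_N NSetD)

lemma c_mult: "\<eta> \<in> carrier N \<Longrightarrow> \<theta> \<in> carrier N \<Longrightarrow> c (\<eta> \<cdot> \<theta>) = c \<eta> \<otimes>\<^bsub>A\<^esub> c \<theta>"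
  by (simp add: carrier_N mult_N N_mult)

lemma c_one [simp]: "c \<one>\<^bsub>N\<^esub> = \<one>\<^bsub>A\<^esub>"
  by (simp add: one_N N_one)

lemma c_hom: "group_hom N A c"
  by (intro group_hom.intro group_hom_axioms.intro N.is_group A.is_group) (auto simp: hom_def c_mult)

lemma c_inv: "\<eta> \<in> carrier N \<Longrightarrow> c (inv\<^bsub>N\<^esub> \<eta>) = inv\<^bsub>A\<^esub> c \<eta>"
  by (rule group_hom.hom_inv[OF c_hom])

lemma aut_N_in [simp]: "f \<in> carrier A \<Longrightarrow> \<eta> \<in> carrier N \<Longrightarrow> f 1 \<eta> \<in> carrier N"
  by (simp add: carrier_N aut_N)

lemma aut_N_hom: "f \<in> carrier A \<Longrightarrow> group_hom N N (f 1)"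
  using map_mult(2)[OF aut_map lmul(1)]
  by (intro group_hom.intro group_hom_axioms.intro N.is_group)
    (auto simp: hom_def, simp add: carrier_N mult_N NSetD)

lemma aut_N_mult: "f \<in> carrier A \<Longrightarrow> \<eta> \<in> carrier N \<Longrightarrow> \<theta> \<in> carrier N \<Longrightarrow> f 1 (\<eta> \<cdot> \<theta>) = f 1 \<eta> \<cdot> f 1 \<theta>"
  using group_hom.hom_mult[OF aut_N_hom] by blast

lemma aut_N_inv: "f \<in> carrier A \<Longrightarrow> \<eta> \<in> carrier N \<Longrightarrow> f 1 (inv\<^bsub>N\<^esub> \<eta>) = inv\<^bsub>N\<^esub> (f 1 \<eta>)"
  using group_hom.hom_inv[OF aut_N_hom] by blast

lemma aut_N_one [simp]: "f \<in> carrier A \<Longrightarrow> f 1 \<one>\<^bsub>N\<^esub> = \<one>\<^bsub>N\<^esub>"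
  by (simp add: one_N)

lemma c_aut: "f \<in> carrier A \<Longrightarrow> \<eta> \<in> carrier N \<Longrightarrow> c (f 1 \<eta>) = f \<otimes>\<^bsub>A\<^esub> c \<eta> \<otimes>\<^bsub>A\<^esub> inv\<^bsub>A\<^esub> f"
  by (simp add: carrier_N aut_N)

lemma c_conj: "\<eta> \<in> carrier N \<Longrightarrow> \<theta> \<in> carrier N \<Longrightarrow> c \<eta> 1 \<theta> = \<eta> \<cdot> \<theta> \<cdot> inv\<^bsub>N\<^esub> \<eta>"
  using lmul(4)[of \<eta> \<theta>] by (simp add: N.inv_solve_right) (simp add: carrier_N mult_N NSetD)

text \<open>
  \<open>gact a x b\<close> is \<open>a x b\<^sup>-\<^sup>1\<close>. It is written with left multiplications only, using that conjugation
  by \<open>b\<close> moves \<open>b\<close> past \<open>x\<close>: \<open>c(b)(x) b = b x\<close>.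
\<close>

definition gact :: "'a \<Rightarrow> 'a \<Rightarrow> 'a \<Rightarrow> 'a" where
  "gact a x b = pg_mult M (a \<cdot> inv\<^bsub>N\<^esub> b) (c b 1 x)"

lemma lmul_in [simp]: "\<eta> \<in> carrier N \<Longrightarrow> x \<in> simplices M 1 \<Longrightarrow> pg_mult M \<eta> x \<in> simplices M 1"
  by (simp add: carrier_N lmul)

lemma lmul_lmul: "\<eta> \<in> carrier N \<Longrightarrow> \<theta> \<in> carrier N \<Longrightarrow> x \<in> simplices M 1 \<Longrightarrow>
    pg_mult M \<eta> (pg_mult M \<theta> x) = pg_mult M (\<eta> \<cdot> \<theta>) x"
  by (simp add: carrier_N mult_N N_mult)

lemma aut_lmul: "f \<in> carrier A \<Longrightarrow> \<eta> \<in> carrier N \<Longrightarrow> x \<in> simplices M 1 \<Longrightarrow>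
    f 1 (pg_mult M \<eta> x) = pg_mult M (f 1 \<eta>) (f 1 x)"
  using map_mult(2)[OF aut_map lmul(1)] by (simp add: carrier_N)

lemma gact_in [simp]: "a \<in> carrier N \<Longrightarrow> b \<in> carrier N \<Longrightarrow> x \<in> simplices M 1 \<Longrightarrow> gact a x b \<in> simplices M 1"
  by (simp add: gact_def)

lemma inv_cancel1: "a \<in> carrier N \<Longrightarrow> b \<in> carrier N \<Longrightarrow> inv\<^bsub>N\<^esub> a \<cdot> (a \<cdot> b) = b"
  by (simp add: N.m_assoc[symmetric])

lemma inv_cancel2: "a \<in> carrier N \<Longrightarrow> b \<in> carrier N \<Longrightarrow> a \<cdot> (inv\<^bsub>N\<^esub> a \<cdot> b) = b"
  by (simp add: N.m_assoc[symmetric])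

lemmas N_simps = N.m_assoc N.inv_mult_group inv_cancel1 inv_cancel2

lemma gact_gact: "a \<in> carrier N \<Longrightarrow> b \<in> carrier N \<Longrightarrow> a' \<in> carrier N \<Longrightarrow> b' \<in> carrier N \<Longrightarrow> x \<in> simplices M 1 \<Longrightarrow>
    gact a (gact a' x b') b = gact (a \<cdot> a') x (b \<cdot> b')"
  by (simp add: gact_def aut_lmul lmul_lmul c_mult c_conj N_simps)

lemma gact_one [simp]: "x \<in> simplices M 1 \<Longrightarrow> gact \<one>\<^bsub>N\<^esub> x \<one>\<^bsub>N\<^esub> = x"
  by (simp add: gact_def) (simp add: one_N)

lemma gact_same: "a \<in> carrier N \<Longrightarrow> x \<in> simplices M 1 \<Longrightarrow> gact a x a = c a 1 x"
  by (simp add: gact_def) (simp add: one_N)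

lemma gact_N: "a \<in> carrier N \<Longrightarrow> b \<in> carrier N \<Longrightarrow> x \<in> carrier N \<Longrightarrow> gact a x b = a \<cdot> x \<cdot> inv\<^bsub>N\<^esub> b"
  by (simp add: gact_def c_conj mult_N[symmetric] N_simps)

lemma gact_aut: "f \<in> carrier A \<Longrightarrow> a \<in> carrier N \<Longrightarrow> b \<in> carrier N \<Longrightarrow> x \<in> simplices M 1 \<Longrightarrow>
    f 1 (gact a x b) = gact (f 1 a) (f 1 x) (f 1 b)"
  by (simp add: gact_def aut_lmul aut_N_mult aut_N_inv c_aut)

lemma gact_inv: "a \<in> carrier N \<Longrightarrow> b \<in> carrier N \<Longrightarrow> x \<in> simplices M 1 \<Longrightarrow> gact (inv\<^bsub>N\<^esub> a) (gact a x b) (inv\<^bsub>N\<^esub> b) = x"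
  by (simp add: gact_gact)

lemma lmul_gact: "a \<in> carrier N \<Longrightarrow> x \<in> simplices M 1 \<Longrightarrow> pg_mult M a x = gact a x \<one>\<^bsub>N\<^esub>"
  by (simp add: gact_def)

text \<open>The three positions of an edge relative to \<open>k\<close> match the three edges of
  \<Delta>[1]: both ends below \<open>k\<close> give c(\<eta>), an edge crossing \<open>k\<close> is
  multiplied by \<eta> on the left, and the remaining edges stay unchanged.\<close>

lemma gauge_prefix:
  assumes \<eta>: "\<eta> \<in> carrier N" and z: "z \<in> simplices M n"
  shows "\<exists>w\<in>simplices M n. \<forall>i j. i \<le> j \<longrightarrow> j \<le> n \<longrightarrow>
    edge M n w i j = gact (if i < k then \<eta> else \<one>\<^bsub>N\<^esub>) (edge M n z i j) (if j < k then \<eta> else \<one>\<^bsub>N\<^esub>)"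
proof -
  obtain F where F: "homotopy F (c \<eta>) \<eta> \<one>\<^bsub>A\<^esub>"
    using \<eta> NSet_homotopy carrier_N by blast
  define \<sigma> where "\<sigma> = map (\<lambda>i. if i < k then 0 else 1 :: nat) [0..<Suc n]"
  have \<sigma>: "\<sigma> \<in> ops n 1"
    by (auto simp: \<sigma>_def ops_def sorted_iff_nth_mono simp del: upt_Suc)
  have \<sigma>_nth: "\<sigma> ! i = (if i < k then 0 else 1)" if "i \<le> n" for i
    using that by (simp add: \<sigma>_def nth_append del: upt_Suc)
  have m: "simplicial_map MI M F"
    using F by (auto simp: homotopy_def)
  have z\<sigma>: "(z, \<sigma>) \<in> simplices MI n"
    using z \<sigma> by simp
  show ?thesis
  proof (intro bexI allI impI)
    show "F n (z, \<sigma>) \<in> simplices M n"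
      using simplicial_mapD1[OF m z\<sigma>] .
    fix i j assume ij: "i \<le> j" "j \<le> n"
    have "edge M n (F n (z, \<sigma>)) i j = F 1 (edge M n z i j, [\<sigma> ! i, \<sigma> ! j])"
      using simplicial_map_edge[OF m z\<sigma> ij] by (simp add: edge_sset_prod edge_std_simplex)
    then show "edge M n (F n (z, \<sigma>)) i j =
        gact (if i < k then \<eta> else \<one>\<^bsub>N\<^esub>) (edge M n z i j) (if j < k then \<eta> else \<one>\<^bsub>N\<^esub>)"
      using ij z \<eta> homotopyD[OF F] by (simp add: \<sigma>_nth gact_same lmul_gact)
  qed
qed

text \<open>Induction on a bound \<open>k\<close> from which on \<nu> is trivial, composing one
  prefix transformation in each step.\<close>

lemma gauge:
  assumes z: "z \<in> simplices M n" and \<nu>: "\<And>i. i \<le> n \<Longrightarrow> \<nu> i \<in> carrier N"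
  shows "\<exists>w\<in>simplices M n. \<forall>i j. i \<le> j \<longrightarrow> j \<le> n \<longrightarrow> edge M n w i j = gact (\<nu> i) (edge M n z i j) (\<nu> j)"
proof -
  have *: "\<exists>w\<in>simplices M n. \<forall>i j. i \<le> j \<longrightarrow> j \<le> n \<longrightarrow> edge M n w i j = gact (\<nu> i) (edge M n z i j) (\<nu> j)"
    if "\<And>i. \<nu> i \<in> carrier N" "\<And>i. i \<ge> k \<Longrightarrow> \<nu> i = \<one>\<^bsub>N\<^esub>" for k and \<nu> :: "nat \<Rightarrow> 'a"
    using that
  proof (induction k arbitrary: \<nu>)
    case 0
    then show ?case using z by (intro bexI[of _ z]) simp_all
  next
    case (Suc k)
    \<comment> \<open>Dividing by \<nu>(k) on the left makes the entry at \<open>k\<close> trivial,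
      so that the induction hypothesis applies; the prefix transformation by \<nu>(k) on the indices
      up to \<open>k\<close> then restores all entries.\<close>
    define \<nu>' where "\<nu>' i = (if i \<le> k then inv\<^bsub>N\<^esub> \<nu> k \<cdot> \<nu> i else \<one>\<^bsub>N\<^esub>)" for i
    obtain w where w: "w \<in> simplices M n"
      "\<And>i j. i \<le> j \<Longrightarrow> j \<le> n \<Longrightarrow> edge M n w i j = gact (\<nu>' i) (edge M n z i j) (\<nu>' j)"
      using Suc.IH[of \<nu>'] Suc.prems by (force simp: \<nu>'_def)
    obtain w' where w': "w' \<in> simplices M n" "\<And>i j. i \<le> j \<Longrightarrow> j \<le> n \<Longrightarrow> edge M n w' i j =
        gact (if i < Suc k then \<nu> k else \<one>\<^bsub>N\<^esub>) (edge M n w i j) (if j < Suc k then \<nu> k else \<one>\<^bsub>N\<^esub>)"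
      using gauge_prefix[of "\<nu> k" w n "Suc k"] w(1) Suc.prems(1) by blast
    have *: "(if i < Suc k then \<nu> k else \<one>\<^bsub>N\<^esub>) \<cdot> \<nu>' i = \<nu> i" for i
      using Suc.prems by (auto simp: \<nu>'_def inv_cancel2)
    have "edge M n w' i j = gact (\<nu> i) (edge M n z i j) (\<nu> j)" if ij: "i \<le> j" "j \<le> n" for i j
    proof -
      define a where "a i = (if i < Suc k then \<nu> k else \<one>\<^bsub>N\<^esub>)" for i
      have "a i \<in> carrier N" "\<nu>' i \<in> carrier N" for i
        using Suc.prems(1) by (auto simp: a_def \<nu>'_def)
      then have "gact (a i) (gact (\<nu>' i) (edge M n z i j) (\<nu>' j)) (a j) =
          gact (a i \<cdot> \<nu>' i) (edge M n z i j) (a j \<cdot> \<nu>' j)"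
        using ij z by (intro gact_gact) simp_all
      then show ?thesis
        using w'(2)[OF ij] w(2)[OF ij] * by (simp add: a_def)
    qed
    then show ?case using w'(1) by blast
  qed
  define \<nu>' where "\<nu>' i = (if i \<le> n then \<nu> i else \<one>\<^bsub>N\<^esub>)" for i
  have "\<exists>w\<in>simplices M n. \<forall>i j. i \<le> j \<longrightarrow> j \<le> n \<longrightarrow> edge M n w i j = gact (\<nu>' i) (edge M n z i j) (\<nu>' j)"
    by (rule *[of \<nu>' "Suc n"]) (auto simp: \<nu>'_def \<nu>)
  then obtain w where "w \<in> simplices M n"
    "\<And>i j. i \<le> j \<Longrightarrow> j \<le> n \<Longrightarrow> edge M n w i j = gact (\<nu>' i) (edge M n z i j) (\<nu>' j)"
    by blast
  then show ?thesis
    by (intro bexI[of _ w]) (auto simp: \<nu>'_def)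
qed

end

section \<open>The twisted product is an extension\<close>

locale pg_pair = M: partial_grp M + H: partial_mon H
  for M :: "'m sset" and H :: "'h sset"
begin

abbreviation "A \<equiv> AutGroup M"
abbreviation "N \<equiv> NGroup M"
abbreviation "c \<equiv> conj_aut M"

text \<open>Words [g|h] are replaced by 2-simplices with their three edges, which is the form that
  applies to the faces of larger simplices. The homotopy condition becomes an equation in
  \<open>Aut(M)\<close>, and normalization becomes triviality on both degeneracies of an
  edge.\<close>

lemma pre_twisting_pair_iff:
  "pre_twisting_pair M H t \<eta> \<longleftrightarrow>
     (\<forall>g\<in>simplices H 1. t g \<in> carrier A) \<and>
     (\<forall>u\<in>simplices H 2. \<eta> u \<in> carrier N) \<and>
     (\<forall>u\<in>simplices H 2. t (edge H 2 u 0 1) \<otimes>\<^bsub>A\<^esub> t (edge H 2 u 1 2) = c (\<eta> u) \<otimes>\<^bsub>A\<^esub> t (edge H 2 u 0 2)) \<and>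
     t (pg_one H) = \<one>\<^bsub>A\<^esub> \<and>
     (\<forall>g\<in>simplices H 1. \<eta> (oper H 1 [0, 0, 1] g) = \<one>\<^bsub>N\<^esub> \<and> \<eta> (oper H 1 [0, 1, 1] g) = \<one>\<^bsub>N\<^esub>)"
proof -
  have "(\<forall>g h. is_word H [g, h] \<longrightarrow>
        homotopic_via M M (t g \<otimes>\<^bsub>A\<^esub> t h) (\<eta> (simplex H [g, h])) (t (pg_mult H g h))) \<longleftrightarrow>
     (\<forall>u\<in>simplices H 2. t (edge H 2 u 0 1) \<otimes>\<^bsub>A\<^esub> t (edge H 2 u 1 2) = c (\<eta> u) \<otimes>\<^bsub>A\<^esub> t (edge H 2 u 0 2))"
    (is "?L \<longleftrightarrow> ?R")
    if "\<forall>g\<in>simplices H 1. t g \<in> carrier A" "\<forall>u\<in>simplices H 2. \<eta> u \<in> carrier N"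
  proof -
    have *: "homotopic_via M M (t (edge H 2 u 0 1) \<otimes>\<^bsub>A\<^esub> t (edge H 2 u 1 2)) (\<eta> u) (t (edge H 2 u 0 2)) \<longleftrightarrow>
        t (edge H 2 u 0 1) \<otimes>\<^bsub>A\<^esub> t (edge H 2 u 1 2) = c (\<eta> u) \<otimes>\<^bsub>A\<^esub> t (edge H 2 u 0 2)"
      if u: "u \<in> simplices H 2" for u
      using u \<open>\<forall>g\<in>simplices H 1. t g \<in> carrier A\<close> \<open>\<forall>u\<in>simplices H 2. \<eta> u \<in> carrier N\<close>
      by (subst M.homotopic_via_aut_iff) (auto simp: M.carrier_N)
    show ?thesis
    proof
      assume L: ?L
      show ?R
      proof
        fix u assume u: "u \<in> simplices H 2"
        have "simplex H [edge H 2 u 0 1, edge H 2 u 1 2] = u"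
          using H.simplex_spine[OF u] by (simp add: H.spine_2)
        then show "t (edge H 2 u 0 1) \<otimes>\<^bsub>A\<^esub> t (edge H 2 u 1 2) = c (\<eta> u) \<otimes>\<^bsub>A\<^esub> t (edge H 2 u 0 2)"
          using L[rule_format, of "edge H 2 u 0 1" "edge H 2 u 1 2"] *[OF u] u
            H.simplex_2[OF u, of 0 1 2] H.mult_edge[OF u, of 0 1 2] by simp
      qed
    next
      assume R: ?R
      show ?L
      proof (intro allI impI)
        fix g h assume "is_word H [g, h]"
        then obtain u where "u \<in> simplices H 2" "edge H 2 u 0 1 = g" "edge H 2 u 1 2 = h"
          "simplex H [g, h] = u" "edge H 2 u 0 2 = pg_mult H g h"
          using H.word2E by blast
        then show "homotopic_via M M (t g \<otimes>\<^bsub>A\<^esub> t h) (\<eta> (simplex H [g, h])) (t (pg_mult H g h))"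
          using * R by metis
      qed
    qed
  qed
  then show ?thesis
    unfolding pre_twisting_pair_def normalized_def
    using H.simplex_s0 H.simplex_s1 by (auto simp: M.carrier_N M.one_N)
qed

lemma twisting_pair_iff:
  "twisting_pair M H t \<eta> \<longleftrightarrow> pre_twisting_pair M H t \<eta> \<and>
     (\<forall>u\<in>simplices H 3. t (edge H 3 u 0 1) 1 (\<eta> (oper H 3 [1, 2, 3] u)) \<cdot> \<eta> (oper H 3 [0, 1, 3] u) =
        \<eta> (oper H 3 [0, 1, 2] u) \<cdot> \<eta> (oper H 3 [0, 2, 3] u))"
proof -
  have *: "simplex H [edge H 3 u 0 1, edge H 3 u 1 2] = oper H 3 [0, 1, 2] u"
    "simplex H [edge H 3 u 1 2, edge H 3 u 2 3] = oper H 3 [1, 2, 3] u"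
    "simplex H [edge H 3 u 0 1, pg_mult H (edge H 3 u 1 2) (edge H 3 u 2 3)] = oper H 3 [0, 1, 3] u"
    "simplex H [pg_mult H (edge H 3 u 0 1) (edge H 3 u 1 2), edge H 3 u 2 3] = oper H 3 [0, 2, 3] u"
    if "u \<in> simplices H 3" for u
    using that H.simplex_2[OF that] H.mult_edge[OF that] by simp_all
  have "(\<forall>g h k. is_word H [g, h, k] \<longrightarrow> P g h k) \<longleftrightarrow>
      (\<forall>u\<in>simplices H 3. P (edge H 3 u 0 1) (edge H 3 u 1 2) (edge H 3 u 2 3))" for P
    using H.word3E H.simplex_3[of _ 3 0 1 2 3] by (metis le_numeral_extra(3) le0 order_refl one_le_numeral
        numeral_le_iff semiring_norm(69) semiring_norm(72))
  then show ?thesis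
    unfolding twisting_pair_def using * by (simp add: M.mult_N)
qed

lemma normalized_iff: "normalized M H v \<longleftrightarrow>
    (\<forall>g\<in>simplices H 1. v (oper H 1 [0, 0, 1] g) = \<one>\<^bsub>N\<^esub> \<and> v (oper H 1 [0, 1, 1] g) = \<one>\<^bsub>N\<^esub>)"
  unfolding normalized_def using H.simplex_s0 H.simplex_s1 by (auto simp: M.one_N)

end

locale twisting = pg_pair M H
  for M :: "'m sset" and H :: "'h sset" +
  fixes t :: "'h \<Rightarrow> nat \<Rightarrow> 'm \<Rightarrow> 'm" and \<eta> :: "'h \<Rightarrow> 'm"
  assumes twisting_pair: "twisting_pair M H t \<eta>"
begin

lemma pre: "pre_twisting_pair M H t \<eta>"
  using twisting_pair by (simp add: twisting_pair_def)

lemma t_in [simp]: "g \<in> simplices H 1 \<Longrightarrow> t g \<in> carrier A"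
  using pre by (simp add: pre_twisting_pair_iff)

lemma t_one [simp]: "t (pg_one H) = \<one>\<^bsub>A\<^esub>"
  using pre by (simp add: pre_twisting_pair_iff)

text \<open>The value of \<eta> on the face of \<open>b\<close> with vertices i, j, k. Repeated
  vertices are allowed, so the identities below cover degenerate faces too.\<close>

definition et where "et n b i j k = \<eta> (oper H n [i, j, k] b)"

lemma et_in [simp]: "b \<in> simplices H n \<Longrightarrow> i \<le> j \<Longrightarrow> j \<le> k \<Longrightarrow> k \<le> n \<Longrightarrow> et n b i j k \<in> carrier N"
  using pre H.oper_in[of "[i, j, k]" 2 n b] by (simp add: pre_twisting_pair_iff et_def)

lemma t_et:
  assumes "b \<in> simplices H n" "i \<le> j" "j \<le> k" "k \<le> n"
  shows "t (edge H n b i j) \<otimes>\<^bsub>A\<^esub> t (edge H n b j k) = c (et n b i j k) \<otimes>\<^bsub>A\<^esub> t (edge H n b i k)"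
  using pre H.oper_in[of "[i, j, k]" 2 n b] H.edge_oper[of "[i, j, k]" 2 n b] assms
  unfolding pre_twisting_pair_iff et_def by force

lemma t_et_act:
  assumes "b \<in> simplices H n" "i \<le> j" "j \<le> k" "k \<le> n" "x \<in> simplices M 1"
  shows "t (edge H n b i j) 1 (t (edge H n b j k) 1 x) = c (et n b i j k) 1 (t (edge H n b i k) 1 x)"
  using t_et[OF assms(1-4)] assms by (metis M.aut_mult)

text \<open>A face with a repeated first or last vertex has the form [1|g] or [g|1], so
  normalization applies.\<close>

lemma et_same [simp]:
  assumes "b \<in> simplices H n" "i \<le> k" "k \<le> n"
  shows "et n b i i k = \<one>\<^bsub>N\<^esub>" "et n b i k k = \<one>\<^bsub>N\<^esub>"
proof -
  have "oper H n [i, i, k] b = oper H 1 [0, 0, 1] (edge H n b i k)"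
    "oper H n [i, k, k] b = oper H 1 [0, 1, 1] (edge H n b i k)"
    using assms by (simp_all add: edge_def H.oper_oper[where k = 2] op_comp_def)
  then show "et n b i i k = \<one>\<^bsub>N\<^esub>" "et n b i k k = \<one>\<^bsub>N\<^esub>"
    using pre assms by (simp_all add: pre_twisting_pair_iff et_def)
qed

lemma et_cocycle:
  assumes "b \<in> simplices H n" "i \<le> j" "j \<le> k" "k \<le> l" "l \<le> n"
  shows "t (edge H n b i j) 1 (et n b j k l) \<cdot> et n b i j l = et n b i j k \<cdot> et n b i k l"
proof -
  have u: "oper H n [i, j, k, l] b \<in> simplices H 3"
    using assms by (simp add: H.oper_in)
  show ?thesis
    using twisting_pair[unfolded twisting_pair_iff] u assms
      H.edge_oper[of "[i, j, k, l]" 3 n b 0 1]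
      H.oper_oper[of "[i, j, k, l]" 3 n "[1, 2, 3]" 2 b] H.oper_oper[of "[i, j, k, l]" 3 n "[0, 1, 3]" 2 b]
      H.oper_oper[of "[i, j, k, l]" 3 n "[0, 1, 2]" 2 b] H.oper_oper[of "[i, j, k, l]" 3 n "[0, 2, 3]" 2 b]
    by (auto simp: et_def op_comp_def)
qed

text \<open>
  For \<open>b \<in> H\<^sub>n\<close> and an operator \<open>\<xi> : [k] \<rightarrow> [n]\<close>, \<open>wd n b \<xi> k w\<close> is the \<open>k\<close>-simplex of the twisted product
  lying over \<open>\<xi>\<^sup>*b\<close> whose coordinates with respect to \<open>b\<close> are the edges of \<open>w \<in> M\<^sub>k\<close>, and \<open>pe n b \<xi> k w i j\<close>
  is its edge from \<open>i\<close> to \<open>j\<close>. Keeping \<open>b\<close> and \<open>\<xi>\<close> apart makes the coordinates natural in \<open>[k]\<close>, also for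
  operators that do not preserve \<open>0\<close>.
\<close>

definition xe where
  "xe n b \<xi> k w i j = (inv\<^bsub>A\<^esub> t (edge H n b 0 (\<xi> ! i))) 1
     (M.gact \<one>\<^bsub>N\<^esub> (edge M k w i j) (et n b 0 (\<xi> ! i) (\<xi> ! j)))"

definition pe where
  "pe n b \<xi> k w i j = (xe n b \<xi> k w i j, edge H n b (\<xi> ! i) (\<xi> ! j))"

definition wd where
  "wd n b \<xi> k w = map (\<lambda>i. pe n b \<xi> k w i (Suc i)) [0..<k]"

context
  fixes n b \<xi> k
  assumes b: "b \<in> simplices H n" and \<xi>: "\<xi> \<in> ops k n"
begin

lemma \<xi>_le: "i \<le> j \<Longrightarrow> j \<le> k \<Longrightarrow> \<xi> ! i \<le> \<xi> ! j" "i \<le> k \<Longrightarrow> \<xi> ! i \<le> n"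
  using ops_nth_mono[OF \<xi>] ops_nth[OF \<xi>] by auto

lemma xe_in: "w \<in> simplices M k \<Longrightarrow> i \<le> j \<Longrightarrow> j \<le> k \<Longrightarrow> xe n b \<xi> k w i j \<in> simplices M 1"
  using b \<xi>_le by (simp add: xe_def)

text \<open>The coordinate equation t(b_0i)(x) \<eta>(b_0i, b_ij) = w_ij, with indices read through
  \<xi>; \<open>xe\<close> is its solution for \<open>x\<close>.\<close>

lemma t_xe: "w \<in> simplices M k \<Longrightarrow> i \<le> j \<Longrightarrow> j \<le> k \<Longrightarrow>
    t (edge H n b 0 (\<xi> ! i)) 1 (xe n b \<xi> k w i j) = M.gact \<one>\<^bsub>N\<^esub> (edge M k w i j) (et n b 0 (\<xi> ! i) (\<xi> ! j))"
  using b \<xi>_le by (simp add: xe_def)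

lemma pe_refl: "w \<in> simplices M k \<Longrightarrow> i \<le> k \<Longrightarrow> pe n b \<xi> k w i i = (pg_one M, pg_one H)"
  using b \<xi>_le(2)[of i] by (simp add: pe_def xe_def)

text \<open>The threefold product in \<open>tw_mult\<close> needs a 3-simplex. Write t0 for t at the
  edge from 0 to \<xi>(i), and e_ij for the factors \<open>?e i j\<close>. After applying t0, the
  three factors are w_ij e_ij^-1, then e_ij w_jl e_jl^-1 e_ij^-1 by the twisting relation, then e_ij
  e_jl e_il^-1 by the cocycle condition. They telescope to w_il e_il^-1, which is t0 of the required
  letter.\<close>

lemma pe_mult:
  assumes w: "w \<in> simplices M k" and ij: "i \<le> j" "j \<le> l" "l \<le> k"
  shows "tw_mult M H t \<eta> (pe n b \<xi> k w i j) (pe n b \<xi> k w j l) = pe n b \<xi> k w i l"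
proof -
  have le: "\<xi> ! i \<le> \<xi> ! j" "\<xi> ! j \<le> \<xi> ! l" "\<xi> ! l \<le> n" "\<xi> ! i \<le> n" "\<xi> ! j \<le> n" "\<xi> ! i \<le> \<xi> ! l"
    using \<xi>_le ij by simp_all
  let ?t0 = "t (edge H n b 0 (\<xi> ! i))" and ?e = "\<lambda>i j. et n b 0 (\<xi> ! i) (\<xi> ! j)"
  have t0: "?t0 \<in> carrier A" using b le by simp
  have e: "?e i j \<in> carrier N" "?e j l \<in> carrier N" "?e i l \<in> carrier N"
    "et n b (\<xi> ! i) (\<xi> ! j) (\<xi> ! l) \<in> carrier N"
    using b le by simp_all
  \<comment> \<open>The repeated vertex \<open>l\<close> adds a trivial third edge to w_ij, w_jl.
    Gauging by \<mu> = (1, e_ij, e_ij e_jl, e_il) turns the spine into the three factors above; in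
    particular the trivial edge becomes the image of \<eta> under t0.\<close>
  have q: "oper M k [i, j, l, l] w \<in> simplices M 3"
    using w ij by (simp add: M.oper_in)
  define \<mu> where "\<mu> m = [\<one>\<^bsub>N\<^esub>, ?e i j, ?e i j \<cdot> ?e j l, ?e i l] ! m" for m
  have \<mu>': "\<mu> 0 = \<one>\<^bsub>N\<^esub>" "\<mu> 1 = ?e i j" "\<mu> 2 = ?e i j \<cdot> ?e j l" "\<mu> 3 = ?e i l"
    by (simp_all add: \<mu>_def)
  have \<mu>: "\<mu> m \<in> carrier N" if "m \<le> 3" for m
  proof -
    have "m = 0 \<or> m = 1 \<or> m = 2 \<or> m = 3"
      using that by linarith
    then show ?thesis using e \<mu>' by auto
  qed
  obtain s where s: "s \<in> simplices M 3" "\<And>i' j'. i' \<le> j' \<Longrightarrow> j' \<le> 3 \<Longrightarrow> edge M 3 s i' j' =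
      M.gact (\<mu> i') (edge M 3 (oper M k [i, j, l, l] w) i' j') (\<mu> j')"
    using M.gauge[of _ 3 \<mu>, OF q \<mu>] by blast
  have s01: "edge M 3 s 0 1 = ?t0 1 (xe n b \<xi> k w i j)"
    using s(2)[of 0 1] w ij t_xe[OF w] by (simp add: M.edge_oper \<mu>')
  have "M.gact (?e i j) (edge M k w j l) (?e i j \<cdot> ?e j l) =
      M.gact (?e i j) (M.gact \<one>\<^bsub>N\<^esub> (edge M k w j l) (?e j l)) (?e i j)"
    using e w ij by (simp add: M.gact_gact)
  also have "\<dots> = c (?e i j) 1 (t (edge H n b 0 (\<xi> ! j)) 1 (xe n b \<xi> k w j l))"
    using e w ij t_xe[OF w, of j l] xe_in[OF w, of j l] b le by (simp add: M.gact_same)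
  also have "\<dots> = ?t0 1 (t (edge H n b (\<xi> ! i) (\<xi> ! j)) 1 (xe n b \<xi> k w j l))"
    using t_et_act[OF b _ le(1,5) xe_in[OF w ij(2,3)], of 0] by simp
  finally have s12: "edge M 3 s 1 2 = ?t0 1 (t (edge H n b (\<xi> ! i) (\<xi> ! j)) 1 (xe n b \<xi> k w j l))"
    using s(2)[of 1 2] w ij by (simp add: M.edge_oper \<mu>')
  have "edge M 3 s 2 3 = M.gact (?e i j \<cdot> ?e j l) \<one>\<^bsub>N\<^esub> (?e i l)"
    using s(2)[of 2 3] w ij by (simp add: M.edge_oper \<mu>' M.one_N)
  also have "\<dots> = ?e i j \<cdot> ?e j l \<cdot> inv\<^bsub>N\<^esub> ?e i l"
    using e by (simp add: M.gact_N)
  also have "\<dots> = ?t0 1 (et n b (\<xi> ! i) (\<xi> ! j) (\<xi> ! l))"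
    using et_cocycle[OF b _ le(1-3), of 0] e t0 by (simp add: M.N.inv_solve_right')
  finally have s23: "edge M 3 s 2 3 = ?t0 1 (et n b (\<xi> ! i) (\<xi> ! j) (\<xi> ! l))" .
  have s03: "edge M 3 s 0 3 = ?t0 1 (xe n b \<xi> k w i l)"
    using s(2)[of 0 3] w ij t_xe[OF w] by (simp add: M.edge_oper \<mu>')
  define s' where "s' = (inv\<^bsub>A\<^esub> ?t0) 3 s"
  have s': "s' \<in> simplices M 3"
    using s t0 by (simp add: s'_def)
  have edge_s': "edge M 3 s' i' j' = (inv\<^bsub>A\<^esub> ?t0) 1 (edge M 3 s i' j')" if "i' \<le> j'" "j' \<le> 3" for i' j'
    using s t0 that by (simp add: s'_def M.aut_edge)
  have "edge M 3 s' 0 1 = xe n b \<xi> k w i j"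
    "edge M 3 s' 1 2 = t (edge H n b (\<xi> ! i) (\<xi> ! j)) 1 (xe n b \<xi> k w j l)"
    "edge M 3 s' 2 3 = et n b (\<xi> ! i) (\<xi> ! j) (\<xi> ! l)"
    "edge M 3 s' 0 3 = xe n b \<xi> k w i l"
    using t0 xe_in[OF w] ij b le e by (simp_all add: edge_s' s01 s12 s23 s03)
  then have "pg_prod M [xe n b \<xi> k w i j, t (edge H n b (\<xi> ! i) (\<xi> ! j)) 1 (xe n b \<xi> k w j l),
      et n b (\<xi> ! i) (\<xi> ! j) (\<xi> ! l)] = xe n b \<xi> k w i l"
    using M.mult_edge_3[OF s', of 0 1 2 3] by simp
  then show ?thesis
    using H.simplex_2[OF b le(1-3)] H.mult_edge[OF b le(1-3)] by (simp add: tw_mult_def pe_def et_def)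
qed

text \<open>The unit from which the fold starts is the degenerate edge from \<open>i\<close> to
  \<open>i\<close>, and each further letter extends the edge by one vertex.\<close>

lemma foldl_pe: "w \<in> simplices M k \<Longrightarrow> i \<le> j \<Longrightarrow> j \<le> k \<Longrightarrow>
    foldl (tw_mult M H t \<eta>) (pg_one M, pg_one H) (take (j - i) (drop i (wd n b \<xi> k w))) = pe n b \<xi> k w i j"
proof -
  assume w: "w \<in> simplices M k" and ij: "i \<le> j" "j \<le> k"
  have "foldl (tw_mult M H t \<eta>) (pg_one M, pg_one H) (map (\<lambda>i. pe n b \<xi> k w i (Suc i)) [i..<j]) = pe n b \<xi> k w i j"
    using ij by (induction j rule: dec_induct) (simp_all add: w pe_refl pe_mult)
  then show ?thesis
    using ij by (simp add: wd_def drop_map take_map)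
qed

lemma length_wd [simp]: "length (wd n b \<xi> k w) = k"
  by (simp add: wd_def)

lemma map_snd_wd: "map snd (wd n b \<xi> k w) = spine H k (oper H n \<xi> b)"
  using b \<xi> by (auto simp: wd_def pe_def H.spine_edge H.edge_oper)

lemma set_wd: "w \<in> simplices M k \<Longrightarrow> set (wd n b \<xi> k w) \<subseteq> simplices M 1 \<times> simplices H 1"
  using xe_in b \<xi>_le by (auto simp: wd_def pe_def)

text \<open>
  The letters of the untwisted word \<open>tw_word\<close> are the edges of the gauge transform of \<open>w\<close> by \<open>nu\<close>,
  up to the automorphism \<open>t(b\<^bsub>0,\<xi>(0)\<^esub>)\<close>.
\<close>

primrec nu :: "nat \<Rightarrow> 'm" where
  "nu 0 = \<one>\<^bsub>N\<^esub>"
| "nu (Suc i) = nu i \<cdot> et n b 0 (\<xi> ! i) (\<xi> ! Suc i)"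

lemma nu_in [simp]: "i \<le> k \<Longrightarrow> nu i \<in> carrier N"
  using b \<xi>_le by (induction i) simp_all

text \<open>Each twisting relation merges two consecutive values of \<open>t\<close> into one at the
  cost of a conjugation; \<open>nu i\<close> collects these conjugating elements.\<close>

lemma t_foldr:
  assumes "i \<le> k" "x \<in> simplices M 1"
  shows "t (edge H n b 0 (\<xi> ! 0)) 1 (foldr (\<lambda>g. t g 1) (map (\<lambda>i. edge H n b (\<xi> ! i) (\<xi> ! Suc i)) [0..<i]) x) =
    c (nu i) 1 (t (edge H n b 0 (\<xi> ! i)) 1 x)"
  using assms
proof (induction i arbitrary: x)
  case 0
  then show ?case using b \<xi>_le by simp
next
  case (Suc i)
  have le: "\<xi> ! i \<le> \<xi> ! Suc i" "\<xi> ! Suc i \<le> n" "\<xi> ! i \<le> n"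
    using \<xi>_le Suc.prems by simp_all
  show ?case
    using Suc.IH[of "t (edge H n b (\<xi> ! i) (\<xi> ! Suc i)) 1 x"] Suc.prems b le
      t_et_act[OF b _ le(1,2) Suc.prems(2), of 0]
    by (simp add: M.c_mult)
qed

lemma tw_word_nth:
  assumes "length ps = k" "set ps \<subseteq> simplices M 1 \<times> simplices H 1"
    "map snd ps = spine H k (oper H n \<xi> b)" "i < k"
  shows "t (edge H n b 0 (\<xi> ! 0)) 1 (tw_word t ps ! i) = c (nu i) 1 (t (edge H n b 0 (\<xi> ! i)) 1 (fst (ps ! i)))"
    "tw_word t ps ! i \<in> simplices M 1"
proof -
  have fst_in: "fst (ps ! i) \<in> simplices M 1"
    using subsetD[OF assms(2) nth_mem[of i ps]] assms(1,4) by (simp add: mem_Times_iff)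
  have "map snd (take i ps) = map (\<lambda>i. edge H n b (\<xi> ! i) (\<xi> ! Suc i)) [0..<i]"
    unfolding take_map[symmetric] assms(3) using assms b \<xi>
    by (auto simp: H.spine_edge take_map H.edge_oper)
  then have *: "tw_word t ps ! i = foldr (\<lambda>g. t g 1) (map (\<lambda>i. edge H n b (\<xi> ! i) (\<xi> ! Suc i)) [0..<i]) (fst (ps ! i))"
    using assms by (simp add: tw_word_def)
  then show "t (edge H n b 0 (\<xi> ! 0)) 1 (tw_word t ps ! i) = c (nu i) 1 (t (edge H n b 0 (\<xi> ! i)) 1 (fst (ps ! i)))"
    using t_foldr[OF _ fst_in] assms by simp
  have **: "foldr (\<lambda>g. t g 1) gs x \<in> simplices M 1" if "set gs \<subseteq> simplices H 1" "x \<in> simplices M 1" for gs x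
    using that by (induction gs) simp_all
  show "tw_word t ps ! i \<in> simplices M 1"
    unfolding * by (rule **) (use fst_in assms(4) b \<xi>_le in auto)
qed

text \<open>Being a word has to be witnessed by a simplex of \<open>M\<close>: gauge
  \<open>w\<close> by \<open>nu\<close> and undo the automorphism \<open>?t0\<close>. The factor
  from \<eta> in each letter is absorbed by the step from \<open>nu i\<close> to
  \<open>nu (Suc i)\<close>.\<close>

lemma wd_in:
  assumes w: "w \<in> simplices M k"
  shows "wd n b \<xi> k w \<in> simplices (tw_total M H t \<eta>) k"
proof -
  let ?ps = "wd n b \<xi> k w" and ?t0 = "t (edge H n b 0 (\<xi> ! 0))"
  have t0: "?t0 \<in> carrier A" using b \<xi>_le by simp
  obtain y where y: "y \<in> simplices M k"
    "\<And>i j. i \<le> j \<Longrightarrow> j \<le> k \<Longrightarrow> edge M k y i j = M.gact (nu i) (edge M k w i j) (nu j)"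
    using M.gauge[of w k nu] w nu_in by blast
  have "tw_word t ?ps = spine M k ((inv\<^bsub>A\<^esub> ?t0) k y)"
  proof (rule nth_equalityI)
    show "length (tw_word t ?ps) = length (spine M k ((inv\<^bsub>A\<^esub> ?t0) k y))"
      by (simp add: tw_word_def)
    fix i assume "i < length (tw_word t ?ps)"
    then have i: "i < k" by (simp add: tw_word_def)
    have fst: "fst (?ps ! i) = xe n b \<xi> k w i (Suc i)"
      using i by (simp add: wd_def pe_def)
    note tw = tw_word_nth[OF length_wd set_wd[OF w] map_snd_wd i]
    have "?t0 1 (tw_word t ?ps ! i) =
        c (nu i) 1 (M.gact \<one>\<^bsub>N\<^esub> (edge M k w i (Suc i)) (et n b 0 (\<xi> ! i) (\<xi> ! Suc i)))"
      using tw(1) t_xe[OF w, of i "Suc i"] i by (simp add: fst)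
    also have "\<dots> = M.gact (nu i) (edge M k w i (Suc i)) (nu (Suc i))"
      using i w b \<xi>_le by (simp add: M.gact_same[symmetric] M.gact_gact)
    finally have "?t0 1 (tw_word t ?ps ! i) = edge M k y i (Suc i)"
      using y(2)[of i "Suc i"] i by simp
    then have "tw_word t ?ps ! i = (inv\<^bsub>A\<^esub> ?t0) 1 (edge M k y i (Suc i))"
      using tw(2) t0 by (metis M.aut_inv1)
    then show "tw_word t ?ps ! i = spine M k ((inv\<^bsub>A\<^esub> ?t0) k y) ! i"
      using i y t0 by (simp add: M.aut_edge)
  qed
  then have "is_word M (tw_word t ?ps)"
    using y t0 by simp
  then show ?thesis
    using set_wd[OF w] map_snd_wd b \<xi> by (simp add: tw_total_def H.oper_in)
qed

text \<open>The construction of \<open>wd_in\<close> run backwards: the untwisted word is a simplex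
  of \<open>M\<close>, and applying \<open>?t0\<close> and then gauging by the inverses of
  \<open>nu\<close> recovers the coordinates.\<close>

lemma wd_surj:
  assumes ps: "ps \<in> simplices (tw_total M H t \<eta>) k" "map snd ps = spine H k (oper H n \<xi> b)"
  obtains w where "w \<in> simplices M k" "wd n b \<xi> k w = ps"
proof -
  let ?t0 = "t (edge H n b 0 (\<xi> ! 0))"
  have t0: "?t0 \<in> carrier A" using b \<xi>_le by simp
  have len: "length ps = k" and set: "set ps \<subseteq> simplices M 1 \<times> simplices H 1"
    and word: "is_word M (tw_word t ps)"
    using ps by (auto simp: tw_total_def)
  obtain z where z: "z \<in> simplices M k" "tw_word t ps = spine M k z"
    using M.is_wordE[OF word, of k] len by (auto simp: tw_word_def)
  obtain w where w: "w \<in> simplices M k" "\<And>i j. i \<le> j \<Longrightarrow> j \<le> k \<Longrightarrow>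
      edge M k w i j = M.gact (inv\<^bsub>N\<^esub> nu i) (edge M k (?t0 k z) i j) (inv\<^bsub>N\<^esub> nu j)"
    using M.gauge[of "?t0 k z" k "\<lambda>i. inv\<^bsub>N\<^esub> nu i"] z(1) t0 by auto
  have "wd n b \<xi> k w = ps"
  proof (rule nth_equalityI)
    show "length (wd n b \<xi> k w) = length ps"
      by (simp add: len)
    fix i assume "i < length (wd n b \<xi> k w)"
    then have i: "i < k" by simp
    let ?e = "et n b 0 (\<xi> ! i) (\<xi> ! Suc i)" and ?ti = "t (edge H n b 0 (\<xi> ! i))"
    have fst_in: "fst (ps ! i) \<in> simplices M 1"
      using subsetD[OF set nth_mem[of i ps]] i len by (simp add: mem_Times_iff)
    have ti: "?ti \<in> carrier A" and e: "?e \<in> carrier N"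
      using b i \<xi>_le by simp_all
    have "edge M k (?t0 k z) i (Suc i) = c (nu i) 1 (?ti 1 (fst (ps ! i)))"
      using tw_word_nth(1)[OF len set ps(2) i] i z t0 by (simp add: M.aut_edge)
    then have "edge M k w i (Suc i) = M.gact (inv\<^bsub>N\<^esub> nu i) (M.gact (nu i) (?ti 1 (fst (ps ! i))) (nu i)) (inv\<^bsub>N\<^esub> nu (Suc i))"
      using w(2)[of i "Suc i"] i ti fst_in by (simp add: M.gact_same)
    also have "\<dots> = M.gact \<one>\<^bsub>N\<^esub> (?ti 1 (fst (ps ! i))) (inv\<^bsub>N\<^esub> ?e)"
      using i ti fst_in e by (simp add: M.gact_gact M.N_simps)
    finally have "xe n b \<xi> k w i (Suc i) = fst (ps ! i)"
      using fst_in e ti by (simp add: xe_def M.gact_gact)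
    moreover have "edge H n b (\<xi> ! i) (\<xi> ! Suc i) = snd (ps ! i)"
      using arg_cong[OF ps(2), of "\<lambda>l. l ! i"] i len b \<xi> by (simp add: H.edge_oper H.oper_in)
    ultimately show "wd n b \<xi> k w ! i = ps ! i"
      using i by (simp add: wd_def pe_def)
  qed
  then show thesis using that w(1) by blast
qed

lemma wd_inj:
  assumes "w \<in> simplices M k" "w' \<in> simplices M k" "wd n b \<xi> k w = wd n b \<xi> k w'"
  shows "w = w'"
proof (rule M.simplex_eqI[OF assms(1,2)])
  fix i assume i: "i < k"
  let ?e = "et n b 0 (\<xi> ! i) (\<xi> ! Suc i)"
  have e: "?e \<in> carrier N"
    using b i \<xi>_le by simp
  have "xe n b \<xi> k w i (Suc i) = xe n b \<xi> k w' i (Suc i)"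
    using arg_cong[OF assms(3), of "\<lambda>l. l ! i"] i by (simp add: wd_def pe_def)
  then have "M.gact \<one>\<^bsub>N\<^esub> (edge M k w i (Suc i)) ?e = M.gact \<one>\<^bsub>N\<^esub> (edge M k w' i (Suc i)) ?e"
    using t_xe[OF assms(1), of i "Suc i"] t_xe[OF assms(2), of i "Suc i"] i by simp
  then show "edge M k w i (Suc i) = edge M k w' i (Suc i)"
    using M.gact_inv[of "\<one>\<^bsub>N\<^esub>" ?e "edge M k w i (Suc i)"] M.gact_inv[of "\<one>\<^bsub>N\<^esub>" ?e "edge M k w' i (Suc i)"]
      assms i e by simp
qed

end

lemma pe_natural:
  assumes "b \<in> simplices H n" "\<xi> \<in> ops k n" "\<theta> \<in> ops m k" "w \<in> simplices M k" "i \<le> j" "j \<le> m"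
  shows "pe n b (op_comp \<xi> \<theta>) m (oper M k \<theta> w) i j = pe n b \<xi> k w (\<theta> ! i) (\<theta> ! j)"
  using assms ops_length[OF assms(3)] by (simp add: pe_def xe_def op_comp_nth M.edge_oper)

text \<open>An operator multiplies blocks of letters, and \<open>foldl_pe\<close> identifies each
  block with an edge; in coordinates the operator acts on \<xi> and \<open>w\<close>
  separately.\<close>

lemma wd_oper:
  assumes "b \<in> simplices H n" "\<xi> \<in> ops k n" "\<theta> \<in> ops m k" "w \<in> simplices M k"
  shows "oper (tw_total M H t \<eta>) k \<theta> (wd n b \<xi> k w) = wd n b (op_comp \<xi> \<theta>) m (oper M k \<theta> w)"
proof -
  have "oper (tw_total M H t \<eta>) k \<theta> (wd n b \<xi> k w) = map (\<lambda>i. pe n b \<xi> k w (\<theta> ! i) (\<theta> ! Suc i)) [0..<m]"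
    using assms ops_length[OF assms(3)] ops_nth[OF assms(3)] ops_nth_mono[OF assms(3)]
    by (auto simp: tw_total_def word_oper_def foldl_pe)
  also have "\<dots> = wd n b (op_comp \<xi> \<theta>) m (oper M k \<theta> w)"
    using assms by (simp add: wd_def pe_natural)
  finally show ?thesis .
qed

lemma tw_simplexE:
  assumes "ps \<in> simplices (tw_total M H t \<eta>) n"
  obtains u w where "u \<in> simplices H n" "w \<in> simplices M n" "map snd ps = spine H n u"
    "wd n u [0..<Suc n] n w = ps" "simplex H (map snd ps) = u"
proof -
  have "is_word H (map snd ps)" "length ps = n"
    using assms by (auto simp: tw_total_def)
  then obtain u where u: "u \<in> simplices H n" "map snd ps = spine H n u"
    using H.is_wordE[of "map snd ps" n] by auto
  then show thesis
    using wd_surj[OF u(1) ops_id assms] H.oper_id[OF u(1)] that[of u] by (metis H.simplex_spine)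
qed

text \<open>Every simplex is a \<open>wd\<close> over its own projection, so the simplicial
  identities are inherited from \<open>M\<close> through \<open>wd_oper\<close>; associativity of
  \<open>tw_mult\<close> is never treated as a law of its own.\<close>

lemma simplicial_set_tw_total: "simplicial_set (tw_total M H t \<eta>)"
  unfolding simplicial_set_def
proof (intro conjI allI ballI)
  fix n ps assume "ps \<in> simplices (tw_total M H t \<eta>) n"
  then obtain u w where u: "u \<in> simplices H n" and w: "w \<in> simplices M n" and
    ps: "wd n u [0..<Suc n] n w = ps"
    using tw_simplexE by metis
  have o: "oper (tw_total M H t \<eta>) n \<theta> ps = wd n u \<theta> m (oper M n \<theta> w)" if "\<theta> \<in> ops m n" for m \<theta>
    unfolding ps[symmetric] using wd_oper[OF u ops_id that w] op_comp_id[OF that] by simp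
  show "oper (tw_total M H t \<eta>) n [0..<Suc n] ps = ps"
    using o[OF ops_id] M.oper_id[OF w] ps by simp
  fix m \<theta> assume \<theta>: "\<theta> \<in> ops m n"
  show "oper (tw_total M H t \<eta>) n \<theta> ps \<in> simplices (tw_total M H t \<eta>) m"
    unfolding o[OF \<theta>] using wd_in[OF u \<theta>] M.oper_in[OF \<theta> w] by blast
  fix k \<phi> assume \<phi>: "\<phi> \<in> ops k m"
  show "oper (tw_total M H t \<eta>) m \<phi> (oper (tw_total M H t \<eta>) n \<theta> ps) =
      oper (tw_total M H t \<eta>) n (op_comp \<theta> \<phi>) ps"
    unfolding o[OF \<theta>] o[OF op_comp_ops[OF \<theta> \<phi>]]
    using wd_oper[OF u \<theta> \<phi>] M.oper_in[OF \<theta> w] M.oper_oper[OF \<theta> \<phi> w] by simp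
qed

lemma proj_wd: "b \<in> simplices H n \<Longrightarrow> \<xi> \<in> ops k n \<Longrightarrow> proj (tw_ext M H t \<eta>) k (wd n b \<xi> k w) = oper H n \<xi> b"
  by (simp add: tw_ext_def map_snd_wd H.oper_in)

lemma simplicial_map_proj: "simplicial_map (tw_total M H t \<eta>) H (proj (tw_ext M H t \<eta>))"
  unfolding simplicial_map_def
proof (intro conjI allI ballI)
  fix n ps assume "ps \<in> simplices (tw_total M H t \<eta>) n"
  then obtain u w where u: "u \<in> simplices H n" and w: "w \<in> simplices M n" and
    ps: "wd n u [0..<Suc n] n w = ps"
    using tw_simplexE by metis
  have pu: "proj (tw_ext M H t \<eta>) n ps = u"
    using proj_wd[OF u ops_id] H.oper_id[OF u] ps by metis
  then show "proj (tw_ext M H t \<eta>) n ps \<in> simplices H n"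
    using u by simp
  fix m \<theta> assume \<theta>: "\<theta> \<in> ops m n"
  have "oper (tw_total M H t \<eta>) n \<theta> ps = wd n u \<theta> m (oper M n \<theta> w)"
    unfolding ps[symmetric] using wd_oper[OF u ops_id \<theta> w] op_comp_id[OF \<theta>] by simp
  then show "proj (tw_ext M H t \<eta>) m (oper (tw_total M H t \<eta>) n \<theta> ps) =
      oper H n \<theta> (proj (tw_ext M H t \<eta>) n ps)"
    using proj_wd[OF u \<theta>] pu by simp
qed

text \<open>Together with \<open>wd_oper\<close> this is local triviality, one simplex \<xi> of
  \<Delta>[n] at a time.\<close>

lemma wd_bij:
  assumes "b \<in> simplices H n" "\<xi> \<in> ops k n"
  shows "bij_betw (wd n b \<xi> k) (simplices M k)
    {ps \<in> simplices (tw_total M H t \<eta>) k. proj (tw_ext M H t \<eta>) k ps = oper H n \<xi> b}"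
proof -
  have "\<exists>w\<in>simplices M k. wd n b \<xi> k w = ps"
    if ps: "ps \<in> simplices (tw_total M H t \<eta>) k" "proj (tw_ext M H t \<eta>) k ps = oper H n \<xi> b" for ps
  proof -
    obtain u where "u \<in> simplices H k" "map snd ps = spine H k u" "simplex H (map snd ps) = u"
      using ps tw_simplexE by metis
    then have "map snd ps = spine H k (oper H n \<xi> b)"
      using ps(2) by (simp add: tw_ext_def)
    then show ?thesis using wd_surj[OF assms ps(1)] by metis
  qed
  then show ?thesis
    unfolding bij_betw_def using wd_inj[OF assms] wd_in[OF assms] proj_wd[OF assms]
    by (auto simp: inj_on_def)
qed

end

section \<open>Equivalence of extensions and transport along it\<close>

lemma simplicial_iso_cong:
  assumes "simplicial_iso X Y f" "simplicial_set X" "\<And>n x. x \<in> simplices X n \<Longrightarrow> g n x = f n x"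
  shows "simplicial_iso X Y g"
proof (rule simplicial_isoI[OF assms(2)])
  show "simplicial_map X Y g"
    using simplicial_map_cong[OF simplicial_iso_map[OF assms(1)] assms(2)] assms(3) by metis
  show "bij_betw (g n) (simplices X n) (simplices Y n)" for n
    using simplicial_iso_bij[OF assms(1)] assms(3) bij_betw_cong by metis
qed

lemma simplices_sset_pullback [simp]: "(x, y) \<in> simplices (sset_pullback X Y f g) n \<longleftrightarrow>
    x \<in> simplices X n \<and> y \<in> simplices Y n \<and> f n x = g n y"
  by (simp add: sset_pullback_def)

lemma oper_sset_pullback [simp]: "oper (sset_pullback X Y f g) n \<theta> (x, y) = (oper X n \<theta> x, oper Y n \<theta> y)"
  by (simp add: sset_pullback_def)

lemma simplices_fibre_over [simp]: "e \<in> simplices (fibre_over E B \<tau> v) n \<longleftrightarrow>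
    e \<in> simplices E n \<and> \<tau> n e = oper B 0 (replicate (Suc n) 0) v"
  by (simp add: fibre_over_def)

lemma oper_fibre_over [simp]: "oper (fibre_over E B \<tau> v) = oper E"
  by (simp add: fibre_over_def)

lemma incl_in_total: "extension M H X \<Longrightarrow> x \<in> simplices M n \<Longrightarrow> incl X n x \<in> simplices (total X) n"
  using simplicial_mapD1[OF simplicial_iso_map] unfolding extension_def by fastforce

lemma extension_proj: "extension M H X \<Longrightarrow> simplicial_map (total X) H (proj X)"
  by (simp add: extension_def fibre_bundle_def)

lemma ext_equiv_sym:
  assumes "ext_equiv M H X Y" "extension M H X"
  shows "ext_equiv M H Y X"
proof -
  obtain \<psi> where \<psi>: "simplicial_iso (total X) (total Y) \<psi>"
    "\<forall>n. \<forall>x\<in>simplices M n. \<psi> n (incl X n x) = incl Y n x"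
    "\<forall>n. \<forall>e\<in>simplices (total X) n. proj Y n (\<psi> n e) = proj X n e"
    using assms(1) by (auto simp: ext_equiv_def)
  obtain \<chi> where \<chi>: "simplicial_iso (total Y) (total X) \<chi>"
    "\<And>n x. x \<in> simplices (total X) n \<Longrightarrow> \<chi> n (\<psi> n x) = x" "\<And>n y. y \<in> simplices (total Y) n \<Longrightarrow> \<psi> n (\<chi> n y) = y"
    using simplicial_iso_inverse[OF \<psi>(1)] by metis
  have "\<chi> n (incl Y n x) = incl X n x" if "x \<in> simplices M n" for n x
    using that \<psi>(2) \<chi>(2) incl_in_total[OF assms(2) that] by metis
  moreover have "proj X n (\<chi> n e) = proj Y n e" if "e \<in> simplices (total Y) n" for n e
    using that \<psi>(3) \<chi>(3) simplicial_mapD1[OF simplicial_iso_map[OF \<chi>(1)] that] by metis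
  ultimately show ?thesis
    unfolding ext_equiv_def using \<chi>(1) by blast
qed

lemma ext_equiv_trans:
  assumes "ext_equiv M H X Y" "ext_equiv M H Y Z"
  shows "ext_equiv M H X Z"
proof -
  obtain \<psi> where \<psi>: "simplicial_iso (total X) (total Y) \<psi>"
    "\<forall>n. \<forall>x\<in>simplices M n. \<psi> n (incl X n x) = incl Y n x"
    "\<forall>n. \<forall>e\<in>simplices (total X) n. proj Y n (\<psi> n e) = proj X n e"
    using assms(1) by (auto simp: ext_equiv_def)
  obtain \<chi> where \<chi>: "simplicial_iso (total Y) (total Z) \<chi>"
    "\<forall>n. \<forall>x\<in>simplices M n. \<chi> n (incl Y n x) = incl Z n x"
    "\<forall>n. \<forall>e\<in>simplices (total Y) n. proj Z n (\<chi> n e) = proj Y n e"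
    using assms(2) by (auto simp: ext_equiv_def)
  show ?thesis
    unfolding ext_equiv_def
    using simplicial_iso_compose[OF \<psi>(1) \<chi>(1)] \<psi>(2,3) \<chi>(2,3)
      simplicial_mapD1[OF simplicial_iso_map[OF \<psi>(1)]]
    by (intro exI[of _ "\<lambda>n x. \<chi> n (\<psi> n x)"]) simp
qed

text \<open>The trivializations and the identification of the fibre are composed with the
  equivalence. It serves to place twisted products on another type of simplices.\<close>

lemma extension_transfer:
  assumes X: "extension M H X" and XY: "ext_equiv M H X Y"
    and Y: "simplicial_set (total Y)" and M: "simplicial_set M"
  shows "extension M H Y"
proof -
  obtain \<psi> where \<psi>: "simplicial_iso (total X) (total Y) \<psi>"
    and \<psi>_incl: "\<And>n x. x \<in> simplices M n \<Longrightarrow> \<psi> n (incl X n x) = incl Y n x"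
    and \<psi>_proj: "\<And>n e. e \<in> simplices (total X) n \<Longrightarrow> proj Y n (\<psi> n e) = proj X n e"
    using XY by (auto simp: ext_equiv_def)
  obtain \<chi> where \<chi>: "simplicial_iso (total Y) (total X) \<chi>"
    and \<chi>\<psi>: "\<And>n x. x \<in> simplices (total X) n \<Longrightarrow> \<chi> n (\<psi> n x) = x"
    and \<psi>\<chi>: "\<And>n y. y \<in> simplices (total Y) n \<Longrightarrow> \<psi> n (\<chi> n y) = y"
    using simplicial_iso_inverse[OF \<psi>(1)] by metis
  note \<psi>m = simplicial_iso_map[OF \<psi>] and \<chi>m = simplicial_iso_map[OF \<chi>]
  note \<psi>in = simplicial_mapD1[OF \<psi>m] and \<chi>in = simplicial_mapD1[OF \<chi>m]
  have \<chi>_proj: "proj X n (\<chi> n e) = proj Y n e" if "e \<in> simplices (total Y) n" for n e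
    using that \<psi>_proj[of "\<chi> n e" n] \<psi>\<chi> \<chi>in by simp
  have "simplicial_map (total Y) H (proj Y)"
    using simplicial_map_cong[OF simplicial_map_compose[OF \<chi>m extension_proj[OF X]] Y] \<chi>_proj by blast
  moreover have "proj Y n ` simplices (total Y) n = simplices H n" for n
  proof -
    have "proj X n ` simplices (total X) n = simplices H n"
      using X by (simp add: extension_def fibre_bundle_def)
    moreover have "simplices (total Y) n = \<psi> n ` simplices (total X) n"
      using simplicial_iso_bij[OF \<psi>] by (simp add: bij_betw_def)
    ultimately show ?thesis using \<psi>_proj by (force simp: image_image)
  qed
  moreover have "\<exists>\<phi>. simplicial_iso (sset_pullback (total Y) (std_simplex n) (proj Y) \<sigma>) (sset_prod M (std_simplex n)) \<phi> \<and>
       (\<forall>k. \<forall>p\<in>simplices (sset_pullback (total Y) (std_simplex n) (proj Y) \<sigma>) k. snd (\<phi> k p) = snd p)"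
    if \<sigma>: "simplicial_map (std_simplex n) H \<sigma>" for n \<sigma>
  proof -
    let ?PX = "sset_pullback (total X) (std_simplex n) (proj X) \<sigma>"
    let ?PY = "sset_pullback (total Y) (std_simplex n) (proj Y) \<sigma>"
    obtain \<phi> where \<phi>: "simplicial_iso ?PX (sset_prod M (std_simplex n)) \<phi>"
      "\<forall>k. \<forall>p\<in>simplices ?PX k. snd (\<phi> k p) = snd p"
      using X \<sigma> unfolding extension_def fibre_bundle_def by blast
    have "simplicial_iso ?PY ?PX (\<lambda>k p. (\<chi> k (fst p), snd p))"
      unfolding simplicial_iso_def
    proof (intro conjI exI[of _ "\<lambda>k p. (\<psi> k (fst p), snd p)"])
      show "simplicial_map ?PY ?PX (\<lambda>k p. (\<chi> k (fst p), snd p))"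
        by (auto simp: simplicial_map_def \<chi>in \<chi>_proj simplicial_mapD2[OF \<chi>m])
      show "simplicial_map ?PX ?PY (\<lambda>k p. (\<psi> k (fst p), snd p))"
        by (auto simp: simplicial_map_def \<psi>in \<psi>_proj simplicial_mapD2[OF \<psi>m])
    qed (auto simp: \<chi>\<psi> \<psi>\<chi>)
    from simplicial_iso_compose[OF this \<phi>(1)] \<phi>(2) show ?thesis
      by (intro exI[of _ "\<lambda>k p. \<phi> k (\<chi> k (fst p), snd p)"]) (auto simp: \<chi>in \<chi>_proj)
  qed
  moreover have "simplicial_iso M (fibre_over (total Y) H (proj Y) (vertex H)) (incl Y)"
  proof -
    have "simplicial_iso (fibre_over (total X) H (proj X) (vertex H)) (fibre_over (total Y) H (proj Y) (vertex H)) \<psi>"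
      unfolding simplicial_iso_def
    proof (intro conjI exI[of _ \<chi>])
      show "simplicial_map (fibre_over (total X) H (proj X) (vertex H)) (fibre_over (total Y) H (proj Y) (vertex H)) \<psi>"
        by (auto simp: simplicial_map_def \<psi>in \<psi>_proj simplicial_mapD2[OF \<psi>m])
      show "simplicial_map (fibre_over (total Y) H (proj Y) (vertex H)) (fibre_over (total X) H (proj X) (vertex H)) \<chi>"
        by (auto simp: simplicial_map_def \<chi>in \<chi>_proj simplicial_mapD2[OF \<chi>m])
    qed (auto simp: \<chi>\<psi> \<psi>\<chi>)
    moreover have "simplicial_iso M (fibre_over (total X) H (proj X) (vertex H)) (incl X)"
      using X by (simp add: extension_def)
    ultimately show ?thesis
      using simplicial_iso_cong[OF simplicial_iso_compose M] \<psi>_incl by fastforce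
  qed
  ultimately show ?thesis
    using Y unfolding extension_def fibre_bundle_def by blast
qed

text \<open>Transport of structure along an injection of simplex types. \<open>ext_classes\<close>
  collects extensions over one fixed type, which need not be the type of words of pairs.\<close>

definition enc_ext :: "('e \<Rightarrow> 'f) \<Rightarrow> ('m, 'h, 'e) ext \<Rightarrow> ('m, 'h, 'f) ext" where
  "enc_ext enc X = \<lparr>total = \<lparr>simplices = (\<lambda>n. enc ` simplices (total X) n),
      oper = (\<lambda>n \<theta> e. enc (oper (total X) n \<theta> (inv_into UNIV enc e)))\<rparr>,
    incl = (\<lambda>n x. enc (incl X n x)), proj = (\<lambda>n e. proj X n (inv_into UNIV enc e))\<rparr>"

lemma enc_ext:
  assumes "inj enc" "extension M H X" "simplicial_set M"
  shows "extension M H (enc_ext enc X)" "ext_equiv M H (enc_ext enc X) X"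
proof -
  have X: "simplicial_set (total X)"
    using assms by (simp add: extension_def)
  interpret X: sset "total X" by unfold_locales (rule X)
  have Y: "simplicial_set (total (enc_ext enc X))"
    unfolding simplicial_set_def using assms(1)
    by (auto simp: enc_ext_def X.oper_in X.oper_id X.oper_oper simp del: upt_Suc)
  have "simplicial_iso (total X) (total (enc_ext enc X)) (\<lambda>n. enc)"
    unfolding simplicial_iso_def
    by (intro conjI exI[of _ "\<lambda>n. inv_into UNIV enc"]) (use assms(1) in \<open>auto simp: simplicial_map_def enc_ext_def X.oper_in\<close>)
  then have *: "ext_equiv M H X (enc_ext enc X)"
    unfolding ext_equiv_def using assms(1) by (intro exI[of _ "\<lambda>n. enc"]) (simp add: enc_ext_def)
  then show "ext_equiv M H (enc_ext enc X) X"
    by (rule ext_equiv_sym) (rule assms)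
  show "extension M H (enc_ext enc X)"
    by (rule extension_transfer[OF assms(2) * Y assms(3)])
qed

section \<open>The twisted product as a fibre bundle\<close>

context twisting
begin

lemma total_tw_ext [simp]: "total (tw_ext M H t \<eta>) = tw_total M H t \<eta>"
  by (simp add: tw_ext_def)

text \<open>At the vertex 0 of \<open>b\<close> both \<open>t\<close> and \<eta> are trivial, so
  coordinates there are plain coordinates of the fibre.\<close>

lemma wd_zero:
  assumes "b \<in> simplices H n" "w \<in> simplices M k"
  shows "wd n b (replicate (Suc k) 0) k w = incl (tw_ext M H t \<eta>) k w"
  using assms by (auto simp: wd_def pe_def xe_def tw_ext_def M.spine_edge simp del: replicate_Suc)

lemma extension_tw_ext: "extension M H (tw_ext M H t \<eta>)"
proof -
  let ?T = "tw_total M H t \<eta>" and ?p = "proj (tw_ext M H t \<eta>)"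
  have "?p n ` simplices ?T n = simplices H n" for n
  proof
    show "?p n ` simplices ?T n \<subseteq> simplices H n"
      using simplicial_mapD1[OF simplicial_map_proj] by blast
    show "simplices H n \<subseteq> ?p n ` simplices ?T n"
    proof
      fix b assume b: "b \<in> simplices H n"
      \<comment> \<open>Any \<open>n\<close>-simplex of \<open>M\<close> would do; the degenerate
        one at the vertex always exists.\<close>
      define w where "w = oper M 0 (replicate (Suc n) 0) (vertex M)"
      have w: "w \<in> simplices M n"
        unfolding w_def by (rule M.oper_in[OF _ M.vertex_in]) (simp del: replicate_Suc)
      have "b = ?p n (wd n b [0..<Suc n] n w)"
        using proj_wd[OF b ops_id] H.oper_id[OF b] by simp
      then show "b \<in> ?p n ` simplices ?T n"
        using wd_in[OF b ops_id w] by blast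
    qed
  qed
  moreover have "\<exists>\<psi>. simplicial_iso (sset_pullback ?T (std_simplex n) ?p \<sigma>) (sset_prod M (std_simplex n)) \<psi> \<and>
           (\<forall>k. \<forall>p\<in>simplices (sset_pullback ?T (std_simplex n) ?p \<sigma>) k. snd (\<psi> k p) = snd p)"
    if \<sigma>: "simplicial_map (std_simplex n) H \<sigma>" for n \<sigma>
  proof -
    let ?P = "sset_pullback ?T (std_simplex n) ?p \<sigma>" and ?MD = "sset_prod M (std_simplex n)"
    \<comment> \<open>Yoneda: \<sigma> is given by pulling back one simplex \<open>b\<close> of
      \<open>H\<close>, so the coordinates over \<open>b\<close> trivialize the pullback.\<close>
    define b where "b = \<sigma> n [0..<Suc n]"
    have b: "b \<in> simplices H n"
      unfolding b_def using simplicial_mapD1[OF \<sigma>] by (simp del: upt_Suc)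
    have \<sigma>_eq: "\<sigma> k \<xi> = oper H n \<xi> b" if "\<xi> \<in> ops k n" for k \<xi>
      using simplicial_mapD2[OF \<sigma> that, of "[0..<Suc n]"] op_comp_id[OF that]
      by (simp add: b_def del: upt_Suc)
    define \<chi> where "\<chi> k p = (wd n b (snd p) k (fst p), snd p)" for k p
    have "simplicial_iso ?MD ?P \<chi>"
    proof (rule simplicial_isoI[OF M.simplicial_set_prod])
      show "simplicial_map ?MD ?P \<chi>"
        by (auto simp: simplicial_map_def \<chi>_def wd_in[OF b] proj_wd[OF b] \<sigma>_eq wd_oper[OF b])
      fix k
      have bij: "bij_betw (wd n b \<xi> k) (simplices M k) {ps \<in> simplices ?T k. ?p k ps = \<sigma> k \<xi>}"
        if "\<xi> \<in> ops k n" for \<xi>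
        using wd_bij[OF b that] \<sigma>_eq[OF that] by simp
      show "bij_betw (\<chi> k) (simplices ?MD k) (simplices ?P k)"
        unfolding bij_betw_def
      proof
        show "inj_on (\<chi> k) (simplices ?MD k)"
          using wd_inj[OF b] by (auto simp: inj_on_def \<chi>_def)
        have "p \<in> \<chi> k ` simplices ?MD k" if p: "p \<in> simplices ?P k" for p
        proof -
          have "snd p \<in> ops k n" "fst p \<in> {ps \<in> simplices ?T k. ?p k ps = \<sigma> k (snd p)}"
            using p by (auto simp: sset_pullback_def)
          then obtain w where "w \<in> simplices M k" "fst p = wd n b (snd p) k w"
            using bij[of "snd p"] unfolding bij_betw_def by (metis (no_types, lifting) imageE)
          then have "p = \<chi> k (w, snd p)" "(w, snd p) \<in> simplices ?MD k"
            using \<open>snd p \<in> ops k n\<close> by (simp_all add: \<chi>_def prod_eq_iff)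
          then show ?thesis by blast
        qed
        then show "\<chi> k ` simplices ?MD k = simplices ?P k"
          using simplicial_mapD1[OF \<open>simplicial_map ?MD ?P \<chi>\<close>] by blast
      qed
    qed
    then obtain \<psi> where \<psi>: "simplicial_iso ?P ?MD \<psi>" "\<And>k p. p \<in> simplices ?P k \<Longrightarrow> \<chi> k (\<psi> k p) = p"
      using simplicial_iso_inverse by metis
    have "snd (\<psi> k p) = snd p" if "p \<in> simplices ?P k" for k p
      using \<psi>(2)[OF that] by (metis \<chi>_def snd_conv)
    with \<psi>(1) show ?thesis by blast
  qed
  moreover have "simplicial_iso M (fibre_over ?T H ?p (vertex H)) (incl (tw_ext M H t \<eta>))"
  proof (rule simplicial_isoI[OF M.simplicial_set])
    have v: "vertex H \<in> simplices H 0" by simp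
    have z: "incl (tw_ext M H t \<eta>) k w = wd 0 (vertex H) (replicate (Suc k) 0) k w"
      if "w \<in> simplices M k" for k w
      using wd_zero[OF v that] by simp
    have r: "op_comp (replicate (Suc k) 0) \<theta> = replicate (Suc m) 0" if "\<theta> \<in> ops m k" for m k \<theta>
      by (rule ops_to_0, rule op_comp_ops[OF _ that]) (simp del: replicate_Suc)
    show "simplicial_map M (fibre_over ?T H ?p (vertex H)) (incl (tw_ext M H t \<eta>))"
      using wd_in[OF v] proj_wd[OF v] wd_oper[OF v] r
      by (auto simp: simplicial_map_def z M.oper_in simp del: replicate_Suc)
    fix k
    have "bij_betw (wd 0 (vertex H) (replicate (Suc k) 0) k) (simplices M k) (simplices (fibre_over ?T H ?p (vertex H)) k)"
      using wd_bij[OF v, of "replicate (Suc k) 0" k] by (simp add: fibre_over_def del: replicate_Suc)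
    then show "bij_betw (incl (tw_ext M H t \<eta>) k) (simplices M k) (simplices (fibre_over ?T H ?p (vertex H)) k)"
      using bij_betw_cong[of "simplices M k" "incl (tw_ext M H t \<eta>) k" "wd 0 (vertex H) (replicate (Suc k) 0) k"] z
      by blast
  qed
  ultimately show ?thesis
    using simplicial_map_proj simplicial_set_tw_total
    unfolding extension_def fibre_bundle_def by simp
qed

end

section \<open>Equivalences of twisted products\<close>

text \<open>The relation between twisting pairs that makes \<open>(x, g) \<mapsto> (x \<rho>(g), g)\<close> multiplicative.\<close>

definition regauge :: "'m sset \<Rightarrow> 'h sset \<Rightarrow> ('h \<Rightarrow> nat \<Rightarrow> 'm \<Rightarrow> 'm) \<Rightarrow> ('h \<Rightarrow> 'm) \<Rightarrow>
    ('h \<Rightarrow> nat \<Rightarrow> 'm \<Rightarrow> 'm) \<Rightarrow> ('h \<Rightarrow> 'm) \<Rightarrow> ('h \<Rightarrow> 'm) \<Rightarrow> bool" where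
  "regauge M H t \<eta> t' \<eta>' \<rho> \<longleftrightarrow>
     (\<forall>g\<in>simplices H 1. \<rho> g \<in> carrier (NGroup M) \<and> t g = conj_aut M (\<rho> g) \<otimes>\<^bsub>AutGroup M\<^esub> t' g) \<and>
     \<rho> (pg_one H) = \<one>\<^bsub>NGroup M\<^esub> \<and>
     (\<forall>u\<in>simplices H 2. \<eta> u \<otimes>\<^bsub>NGroup M\<^esub> \<rho> (edge H 2 u 0 2) =
        \<rho> (edge H 2 u 0 1) \<otimes>\<^bsub>NGroup M\<^esub> t' (edge H 2 u 0 1) 1 (\<rho> (edge H 2 u 1 2)) \<otimes>\<^bsub>NGroup M\<^esub> \<eta>' u)"

locale twisting_two = T: twisting M H t \<eta> + T': twisting M H t' \<eta>'
  for M :: "'m sset" and H :: "'h sset" and t \<eta> t' \<eta>'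
begin

abbreviation "A \<equiv> AutGroup M"
abbreviation "N \<equiv> NGroup M"
abbreviation "c \<equiv> conj_aut M"

text \<open>In the coordinates over \<open>b\<close>, the map (x, g) -> (x \<rho>(g), g) is the
  gauge transformation by the inverses of \<rho>(b_0i). Hence it sends simplices to simplices and
  commutes with operators, and gauging by \<rho> shows that it is onto.\<close>

lemma regauge_ext_equiv:
  assumes "regauge M H t \<eta> t' \<eta>' \<rho>"
  shows "ext_equiv M H (tw_ext M H t \<eta>) (tw_ext M H t' \<eta>')"
proof -
  have \<rho> [simp]: "g \<in> simplices H 1 \<Longrightarrow> \<rho> g \<in> carrier N"
    and t: "g \<in> simplices H 1 \<Longrightarrow> t g = c (\<rho> g) \<otimes>\<^bsub>A\<^esub> t' g"
    and \<rho>1: "\<rho> (pg_one H) = \<one>\<^bsub>N\<^esub>"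
    and rel: "u \<in> simplices H 2 \<Longrightarrow> \<eta> u \<cdot> \<rho> (edge H 2 u 0 2) =
        \<rho> (edge H 2 u 0 1) \<cdot> t' (edge H 2 u 0 1) 1 (\<rho> (edge H 2 u 1 2)) \<cdot> \<eta>' u" for g u
    using assms by (auto simp: regauge_def)
  have rel_et: "T.et n b i j k \<cdot> \<rho> (edge H n b i k) =
      \<rho> (edge H n b i j) \<cdot> t' (edge H n b i j) 1 (\<rho> (edge H n b j k)) \<cdot> T'.et n b i j k"
    if "b \<in> simplices H n" "i \<le> j" "j \<le> k" "k \<le> n" for n b i j k
    using rel[of "oper H n [i, j, k] b"] T.H.edge_oper[of "[i, j, k]" 2 n b] T.H.oper_in[of "[i, j, k]" 2 n b] that
    by (simp add: T.et_def T'.et_def)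
  \<comment> \<open>\<open>gact\<close> inverts its right argument, so the first component is x
    \<rho>(g).\<close>
  define f where "f p = (T.M.gact \<one>\<^bsub>N\<^esub> (fst p) (inv\<^bsub>N\<^esub> \<rho> (snd p)), snd p)" for p
  have pe': "T'.pe n b \<xi> k w' i j = f (T.pe n b \<xi> k w i j)"
    if b: "b \<in> simplices H n" and \<xi>: "\<xi> \<in> ops k n" and w: "w \<in> simplices M k" and ij: "i \<le> j" "j \<le> k"
      and w': "edge M k w' i j = T.M.gact (inv\<^bsub>N\<^esub> \<rho> (edge H n b 0 (\<xi> ! i))) (edge M k w i j) (inv\<^bsub>N\<^esub> \<rho> (edge H n b 0 (\<xi> ! j)))"
    for n b \<xi> k w w' i j
  proof -
    have le: "\<xi> ! i \<le> \<xi> ! j" "\<xi> ! j \<le> n" "\<xi> ! i \<le> n"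
      using T.\<xi>_le[OF b \<xi>] ij by simp_all
    define ai aj g where "ai = edge H n b 0 (\<xi> ! i)" and "aj = edge H n b 0 (\<xi> ! j)"
      and "g = edge H n b (\<xi> ! i) (\<xi> ! j)"
    define e e' where "e = T.et n b 0 (\<xi> ! i) (\<xi> ! j)" and "e' = T'.et n b 0 (\<xi> ! i) (\<xi> ! j)"
    define x where "x = T.xe n b \<xi> k w i j"
    have [simp]: "ai \<in> simplices H 1" "aj \<in> simplices H 1" "g \<in> simplices H 1"
      "e \<in> carrier N" "e' \<in> carrier N" "x \<in> simplices M 1" "edge M k w i j \<in> simplices M 1"
      using b le w ij T.xe_in[OF b \<xi> w ij] by (simp_all add: ai_def aj_def g_def e_def e'_def x_def)
    have ee: "e \<cdot> \<rho> aj = \<rho> ai \<cdot> t' ai 1 (\<rho> g) \<cdot> e'"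
      using rel_et[OF b _ le(1,2), of 0] by (simp add: ai_def aj_def g_def e_def e'_def)
    have "t' ai 1 x = c (inv\<^bsub>N\<^esub> \<rho> ai) 1 (t ai 1 x)"
      by (simp add: t T.M.c_inv)
    also have "\<dots> = T.M.gact (inv\<^bsub>N\<^esub> \<rho> ai) (T.M.gact \<one>\<^bsub>N\<^esub> (edge M k w i j) e) (inv\<^bsub>N\<^esub> \<rho> ai)"
      using T.t_xe[OF b \<xi> w ij, folded ai_def e_def x_def] by (simp add: T.M.gact_same)
    finally have "t' ai 1 (T.M.gact \<one>\<^bsub>N\<^esub> x (inv\<^bsub>N\<^esub> \<rho> g)) =
        T.M.gact (inv\<^bsub>N\<^esub> \<rho> ai) (edge M k w i j) (inv\<^bsub>N\<^esub> t' ai 1 (\<rho> g) \<cdot> inv\<^bsub>N\<^esub> \<rho> ai \<cdot> e)"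
      by (simp add: T.M.gact_aut T.M.aut_N_inv T.M.gact_gact T.M.N.m_assoc)
    also have "inv\<^bsub>N\<^esub> t' ai 1 (\<rho> g) \<cdot> inv\<^bsub>N\<^esub> \<rho> ai \<cdot> e = e' \<cdot> inv\<^bsub>N\<^esub> \<rho> aj"
    proof -
      have "e = \<rho> ai \<cdot> t' ai 1 (\<rho> g) \<cdot> e' \<cdot> inv\<^bsub>N\<^esub> \<rho> aj"
        using ee by (simp add: T.M.N.inv_solve_right)
      then show ?thesis by (simp add: T.M.N_simps)
    qed
    finally have "T.M.gact \<one>\<^bsub>N\<^esub> x (inv\<^bsub>N\<^esub> \<rho> g) = (inv\<^bsub>A\<^esub> t' ai) 1
        (T.M.gact (inv\<^bsub>N\<^esub> \<rho> ai) (edge M k w i j) (e' \<cdot> inv\<^bsub>N\<^esub> \<rho> aj))"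
      by (metis T'.t_in T.M.aut_inv1 T.M.gact_in T.M.N.inv_closed T.M.N.one_closed \<rho>
          \<open>ai \<in> simplices H 1\<close> \<open>g \<in> simplices H 1\<close> \<open>x \<in> simplices M 1\<close>)
    also have "\<dots> = T'.xe n b \<xi> k w' i j"
      using w' by (simp add: T'.xe_def ai_def[symmetric] aj_def[symmetric] e'_def[symmetric] T.M.gact_gact)
    finally show ?thesis
      by (simp add: T.pe_def T'.pe_def f_def x_def g_def)
  qed
  have gauged: "\<exists>w'\<in>simplices M k. \<forall>i j. i \<le> j \<longrightarrow> j \<le> k \<longrightarrow> edge M k w' i j =
      T.M.gact (\<nu> (edge H n b 0 (\<xi> ! i))) (edge M k w i j) (\<nu> (edge H n b 0 (\<xi> ! j)))"
    if "b \<in> simplices H n" "\<xi> \<in> ops k n" "w \<in> simplices M k" "\<And>g. g \<in> simplices H 1 \<Longrightarrow> \<nu> g \<in> carrier N" for n b \<xi> k w \<nu>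
    using T.M.gauge[OF that(3), of "\<lambda>i. \<nu> (edge H n b 0 (\<xi> ! i))"] that T.\<xi>_le[OF that(1,2)] by simp
  let ?T = "tw_total M H t \<eta>" and ?T' = "tw_total M H t' \<eta>'"
  have \<psi>: "map f ps \<in> simplices ?T' n \<and>
      (\<forall>m. \<forall>\<theta>\<in>ops m n. map f (oper ?T n \<theta> ps) = oper ?T' n \<theta> (map f ps))"
    if ps: "ps \<in> simplices ?T n" for n ps
  proof -
    obtain u w where u: "u \<in> simplices H n" and w: "w \<in> simplices M n" and
      psw: "ps = T.wd n u [0..<Suc n] n w"
      using T.tw_simplexE[OF ps] by metis
    obtain w' where w': "w' \<in> simplices M n" "\<And>i j. i \<le> j \<Longrightarrow> j \<le> n \<Longrightarrow> edge M n w' i j =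
      T.M.gact (inv\<^bsub>N\<^esub> \<rho> (edge H n u 0 ([0..<Suc n] ! i))) (edge M n w i j) (inv\<^bsub>N\<^esub> \<rho> (edge H n u 0 ([0..<Suc n] ! j)))"
      using gauged[OF u ops_id w, of "\<lambda>g. inv\<^bsub>N\<^esub> \<rho> g"] by (auto simp del: upt_Suc)
    have pe_eq: "T'.pe n u [0..<Suc n] n w' i j = f (T.pe n u [0..<Suc n] n w i j)" if "i \<le> j" "j \<le> n" for i j
      using pe'[OF u ops_id w that w'(2)[OF that]] .
    have wd_eq: "map f ps = T'.wd n u [0..<Suc n] n w'"
      unfolding psw T.wd_def T'.wd_def by (simp add: pe_eq del: upt_Suc)
    have "map f (oper ?T n \<theta> ps) = oper ?T' n \<theta> (map f ps)" if \<theta>: "\<theta> \<in> ops m n" for m \<theta>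
      unfolding wd_eq unfolding psw
      by (simp add: T.wd_oper[OF u ops_id \<theta> w] T'.wd_oper[OF u ops_id \<theta> w'(1)] del: upt_Suc,
          simp add: T.wd_def T'.wd_def T.pe_natural[OF u ops_id \<theta> w] T'.pe_natural[OF u ops_id \<theta> w'(1)]
            pe_eq ops_nth[OF \<theta>] ops_nth_mono[OF \<theta>] del: upt_Suc)
    then show ?thesis
      using wd_eq T'.wd_in[OF u ops_id w'(1)] by simp
  qed
  have "simplicial_iso ?T ?T' (\<lambda>n. map f)"
  proof (rule simplicial_isoI[OF T.simplicial_set_tw_total])
    show "simplicial_map ?T ?T' (\<lambda>n. map f)"
      using \<psi> by (simp add: simplicial_map_def)
    fix n
    have finj: "inj_on f (simplices M 1 \<times> simplices H 1)"
    proof (rule inj_onI)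
      fix p q assume pq: "p \<in> simplices M 1 \<times> simplices H 1" "q \<in> simplices M 1 \<times> simplices H 1" "f p = f q"
      then have "snd p = snd q"
        by (simp add: f_def)
      moreover from this have "T.M.gact \<one>\<^bsub>N\<^esub> (fst p) (inv\<^bsub>N\<^esub> \<rho> (snd p)) = T.M.gact \<one>\<^bsub>N\<^esub> (fst q) (inv\<^bsub>N\<^esub> \<rho> (snd p))"
        using pq(3) unfolding f_def by (metis prod.inject)
      ultimately show "p = q"
        using pq T.M.gact_inv[of "\<one>\<^bsub>N\<^esub>" "inv\<^bsub>N\<^esub> \<rho> (snd p)" "fst p"] T.M.gact_inv[of "\<one>\<^bsub>N\<^esub>" "inv\<^bsub>N\<^esub> \<rho> (snd p)" "fst q"]
        by (auto simp: prod_eq_iff)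
    qed
    have "inj_on (map f) (simplices ?T n)"
    proof (rule inj_onI)
      fix ps qs assume *: "ps \<in> simplices ?T n" "qs \<in> simplices ?T n" "map f ps = map f qs"
      then have "set ps \<union> set qs \<subseteq> simplices M 1 \<times> simplices H 1"
        by (simp add: tw_total_def)
      then show "ps = qs"
        using *(3) map_inj_on inj_on_subset[OF finj] by blast
    qed
    moreover have "qs \<in> map f ` simplices ?T n" if qs: "qs \<in> simplices ?T' n" for qs
    proof -
      obtain u w' where u: "u \<in> simplices H n" and w': "w' \<in> simplices M n" and
        qsw: "qs = T'.wd n u [0..<Suc n] n w'"
        using T'.tw_simplexE[OF qs] by metis
      obtain w where w: "w \<in> simplices M n" "\<And>i j. i \<le> j \<Longrightarrow> j \<le> n \<Longrightarrow> edge M n w i j =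
        T.M.gact (\<rho> (edge H n u 0 ([0..<Suc n] ! i))) (edge M n w' i j) (\<rho> (edge H n u 0 ([0..<Suc n] ! j)))"
        using gauged[OF u ops_id w', of \<rho>] \<rho> by (auto simp del: upt_Suc)
      have "T'.pe n u [0..<Suc n] n w' i (Suc i) = f (T.pe n u [0..<Suc n] n w i (Suc i))" if "i < n" for i
        by (rule pe'[OF u ops_id w(1)]) (use that w' u in \<open>simp_all add: w(2) T.M.gact_inv nth_append del: upt_Suc\<close>)
      then have "qs = map f (T.wd n u [0..<Suc n] n w)"
        unfolding qsw T.wd_def T'.wd_def by (simp del: upt_Suc)
      then show ?thesis using T.wd_in[OF u ops_id w(1)] by blast
    qed
    ultimately show "bij_betw (map f) (simplices ?T n) (simplices ?T' n)"
      using \<psi> by (auto simp: bij_betw_def)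
  qed
  moreover have "map f (incl (tw_ext M H t \<eta>) n x) = incl (tw_ext M H t' \<eta>') n x" if "x \<in> simplices M n" for n x
    using that by (auto simp: tw_ext_def f_def \<rho>1 T.M.spine_edge)
  moreover have "proj (tw_ext M H t' \<eta>') n (map f ps) = proj (tw_ext M H t \<eta>) n ps" for n ps
  proof -
    have "snd \<circ> f = snd" by (auto simp: f_def)
    then show ?thesis by (simp add: tw_ext_def)
  qed
  ultimately show ?thesis
    unfolding ext_equiv_def by (intro exI[of _ "\<lambda>n. map f"]) simp
qed

text \<open>The homotopy over each edge gives \<rho>(g) and the relation between \<open>t\<close>
  and \<open>t'\<close>. The relation between \<eta> and \<eta>' comes from the image of one
  2-simplex over each \<open>u\<close>.\<close>

lemma ext_equiv_regauge:
  assumes "ext_equiv M H (tw_ext M H t \<eta>) (tw_ext M H t' \<eta>')"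
  obtains \<rho> where "regauge M H t \<eta> t' \<eta>' \<rho>"
proof -
  let ?T = "tw_total M H t \<eta>" and ?T' = "tw_total M H t' \<eta>'"
  obtain \<psi> where iso: "simplicial_iso ?T ?T' \<psi>"
    and \<psi>_incl: "\<And>n x. x \<in> simplices M n \<Longrightarrow> \<psi> n (incl (tw_ext M H t \<eta>) n x) = incl (tw_ext M H t' \<eta>') n x"
    and \<psi>_proj: "\<And>n ps. ps \<in> simplices ?T n \<Longrightarrow> proj (tw_ext M H t' \<eta>') n (\<psi> n ps) = proj (tw_ext M H t \<eta>) n ps"
    using assms by (auto simp: ext_equiv_def)
  note \<psi> = simplicial_iso_map[OF iso]
  have ex: "\<exists>w'\<in>simplices M k. T'.wd n b \<xi> k w' = \<psi> k (T.wd n b \<xi> k w)"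
    if b: "b \<in> simplices H n" and \<xi>: "\<xi> \<in> ops k n" and w: "w \<in> simplices M k" for n b \<xi> k w
  proof -
    have "\<psi> k (T.wd n b \<xi> k w) \<in> {ps \<in> simplices ?T' k. proj (tw_ext M H t' \<eta>') k ps = oper H n \<xi> b}"
      using \<psi>_proj[OF T.wd_in[OF b \<xi> w]] T.proj_wd[OF b \<xi>] simplicial_mapD1[OF \<psi> T.wd_in[OF b \<xi> w]] by simp
    then show ?thesis
      using T'.wd_bij[OF b \<xi>] unfolding bij_betw_def by (metis (no_types, lifting) imageE)
  qed
  \<comment> \<open>At the first vertex of \<open>g\<close> nothing is twisted, so the letter (x, g)
    has coordinate \<open>x\<close> over the edge \<open>g\<close>, for both twisting pairs.\<close>
  have wd_1: "T.wd 1 g [0, 1] 1 x = [(x, g)]" "T'.wd 1 g [0, 1] 1 x = [(x, g)]"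
    if "g \<in> simplices H 1" "x \<in> simplices M 1" for g x
    using that by (simp_all add: T.wd_def T'.wd_def T.pe_def T'.pe_def T.xe_def T'.xe_def)
      (simp_all add: One_nat_def T.M.edge_1[unfolded One_nat_def] T.H.edge_1[unfolded One_nat_def])
  define \<rho> where "\<rho> g = fst (hd (\<psi> 1 [(pg_one M, g)]))" for g
  have key: "\<rho> g \<in> carrier N \<and> t g = c (\<rho> g) \<otimes>\<^bsub>A\<^esub> t' g \<and>
      (\<forall>\<eta>\<in>carrier N. \<psi> 1 [(\<eta>, g)] = [(\<eta> \<cdot> \<rho> g, g)])" if g: "g \<in> simplices H 1" for g
  proof -
    \<comment> \<open>\<open>\<psi>\<close> in the coordinates over the edge \<open>g\<close>; operators \<open>[k] \<rightarrow> [1]\<close> are the simplices of \<open>\<Delta>[1]\<close>, so this is a homotopy.\<close>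
    define K where "K k p = (SOME w'. w' \<in> simplices M k \<and>
      T'.wd 1 g (snd p) k w' = \<psi> k (T.wd 1 g (snd p) k (fst p)))" for k p
    have K: "K k (w, \<xi>) \<in> simplices M k" "T'.wd 1 g \<xi> k (K k (w, \<xi>)) = \<psi> k (T.wd 1 g \<xi> k w)"
      if "w \<in> simplices M k" "\<xi> \<in> ops k 1" for k w \<xi>
      using someI_ex[OF ex[OF g that(2,1), unfolded Bex_def]] by (simp_all add: K_def)
    have Kmap: "simplicial_map (sset_prod M (std_simplex 1)) M K"
      unfolding simplicial_map_def
    proof (intro conjI allI ballI)
      fix n p assume p: "p \<in> simplices (sset_prod M (std_simplex 1)) n"
      then obtain w \<xi> where p: "p = (w, \<xi>)" and w: "w \<in> simplices M n" and \<xi>: "\<xi> \<in> ops n 1"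
        by auto
      show "K n p \<in> simplices M n"
        using K[OF w \<xi>] p by simp
      fix m \<theta> assume \<theta>: "\<theta> \<in> ops m n"
      have \<xi>\<theta>: "op_comp \<xi> \<theta> \<in> ops m 1" and w\<theta>: "oper M n \<theta> w \<in> simplices M m"
        using op_comp_ops[OF \<xi> \<theta>] T.M.oper_in[OF \<theta> w] by auto
      have "T'.wd 1 g (op_comp \<xi> \<theta>) m (oper M n \<theta> (K n (w, \<xi>))) = oper ?T' n \<theta> (\<psi> n (T.wd 1 g \<xi> n w))"
        using T'.wd_oper[OF g \<xi> \<theta> K(1)[OF w \<xi>]] K(2)[OF w \<xi>] by simp
      also have "\<dots> = \<psi> m (T.wd 1 g (op_comp \<xi> \<theta>) m (oper M n \<theta> w))"
        using simplicial_mapD2[OF \<psi> \<theta> T.wd_in[OF g \<xi> w]] T.wd_oper[OF g \<xi> \<theta> w] by simp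
      also have "\<dots> = T'.wd 1 g (op_comp \<xi> \<theta>) m (K m (oper M n \<theta> w, op_comp \<xi> \<theta>))"
        using K(2)[OF w\<theta> \<xi>\<theta>] by simp
      finally have "oper M n \<theta> (K n (w, \<xi>)) = K m (oper M n \<theta> w, op_comp \<xi> \<theta>)"
        by (rule T'.wd_inj[OF g \<xi>\<theta> T.M.oper_in[OF \<theta> K(1)[OF w \<xi>]] K(1)[OF w\<theta> \<xi>\<theta>]])
      then show "K m (oper (sset_prod M (std_simplex 1)) n \<theta> p) = oper M n \<theta> (K n p)"
        using p by simp
    qed
    have K0: "K k (w, replicate (Suc k) 0) = w" if w: "w \<in> simplices M k" for k w
    proof (rule T'.wd_inj[OF g _ K(1)[OF w] w])
      show r: "replicate (Suc k) 0 \<in> ops k 1" "replicate (Suc k) 0 \<in> ops k 1"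
        by (simp_all del: replicate_Suc)
      show "T'.wd 1 g (replicate (Suc k) 0) k (K k (w, replicate (Suc k) 0)) = T'.wd 1 g (replicate (Suc k) 0) k w"
        unfolding K(2)[OF w r(1)] T.wd_zero[OF g w] T'.wd_zero[OF g w] by (rule \<psi>_incl[OF w])
    qed
    \<comment> \<open>Over the last vertex of \<open>g\<close>, coordinates are t(g) or t'(g) of the
      fibre coordinates. The equivalence fixes the fibre, so it translates \<open>w\<close> into
      t'(g)(t(g)^-1(w)).\<close>
    have K1: "K k (w, replicate (Suc k) 1) = (t' g \<otimes>\<^bsub>A\<^esub> inv\<^bsub>A\<^esub> t g) k w" if w: "w \<in> simplices M k" for k w
    proof (rule T'.wd_inj[OF g _ K(1)[OF w]])
      show r: "replicate (Suc k) 1 \<in> ops k 1" "replicate (Suc k) 1 \<in> ops k 1"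
        by (simp_all del: replicate_Suc)
      show "(t' g \<otimes>\<^bsub>A\<^esub> inv\<^bsub>A\<^esub> t g) k w \<in> simplices M k"
        using g w by simp
      have 1: "T.wd 1 g (replicate (Suc k) 1) k w = incl (tw_ext M H t \<eta>) k ((inv\<^bsub>A\<^esub> t g) k w)"
        using g w by (auto simp: T.wd_def T.pe_def T.xe_def tw_ext_def T.M.spine_edge T.M.aut_edge simp del: replicate_Suc)
      have 2: "T'.wd 1 g (replicate (Suc k) 1) k ((t' g \<otimes>\<^bsub>A\<^esub> inv\<^bsub>A\<^esub> t g) k w) =
          incl (tw_ext M H t' \<eta>') k ((inv\<^bsub>A\<^esub> t g) k w)"
        using g w by (auto simp: T'.wd_def T'.pe_def T'.xe_def tw_ext_def T.M.spine_edge T.M.aut_edge simp del: replicate_Suc)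
      show "T'.wd 1 g (replicate (Suc k) 1) k (K k (w, replicate (Suc k) 1)) =
          T'.wd 1 g (replicate (Suc k) 1) k ((t' g \<otimes>\<^bsub>A\<^esub> inv\<^bsub>A\<^esub> t g) k w)"
        unfolding K(2)[OF w r(1)] 1 2 by (rule \<psi>_incl) (use g w in simp)
    qed
    have K01: "\<psi> 1 [(x, g)] = [(K 1 (x, [0, 1]), g)]" if x: "x \<in> simplices M 1" for x
      using K[OF x, of "[0, 1]"] wd_1[OF g x] wd_1[OF g, of "K 1 (x, [0, 1])"] by simp
    have hom: "T.M.homotopy K \<one>\<^bsub>A\<^esub> (\<rho> g) (t' g \<otimes>\<^bsub>A\<^esub> inv\<^bsub>A\<^esub> t g)"
      unfolding T.M.homotopy_def using Kmap K0 K1 K01[of "pg_one M"]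
      by (simp add: \<rho>_def del: replicate_Suc)
    then have "homotopic_via M M \<one>\<^bsub>A\<^esub> (\<rho> g) (t' g \<otimes>\<^bsub>A\<^esub> inv\<^bsub>A\<^esub> t g)"
      using T.M.homotopic_via_iff by blast
    then have *: "\<rho> g \<in> carrier N" "\<one>\<^bsub>A\<^esub> = c (\<rho> g) \<otimes>\<^bsub>A\<^esub> (t' g \<otimes>\<^bsub>A\<^esub> inv\<^bsub>A\<^esub> t g)"
      using T.M.homotopic_via_aut_iff[of "\<one>\<^bsub>A\<^esub>" "t' g \<otimes>\<^bsub>A\<^esub> inv\<^bsub>A\<^esub> t g"] g by (simp_all add: T.M.carrier_N)
    have "t g = c (\<rho> g) \<otimes>\<^bsub>A\<^esub> t' g"
      using *(2) *(1) g by (simp add: T.M.A.m_assoc[symmetric] T.M.A.inv_solve_right)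
    \<comment> \<open>The homotopy gives \<rho>(g) times its start value at \<open>x\<close>, which
      equals x \<rho>(g) because its end is the identity.\<close>
    moreover have "\<psi> 1 [(x, g)] = [(x \<cdot> \<rho> g, g)]" if "x \<in> carrier N" for x
      using T.M.homotopyD(2,4,5)[OF hom, of x] K01[of x] that by (simp add: T.M.mult_N)
    ultimately show ?thesis using *(1) by blast
  qed
  have "\<rho> (pg_one H) = \<one>\<^bsub>N\<^esub>"
  proof -
    have "incl (tw_ext M H t \<eta>) 1 (pg_one M) = [(pg_one M, pg_one H)]"
      "incl (tw_ext M H t' \<eta>') 1 (pg_one M) = [(pg_one M, pg_one H)]"
      by (simp_all add: tw_ext_def T.M.spine_edge) (simp_all add: One_nat_def T.M.edge_1[unfolded One_nat_def] T.M.one_in[unfolded One_nat_def])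
    then show ?thesis
      using \<psi>_incl[of "pg_one M" 1] by (simp add: \<rho>_def T.M.one_N)
  qed
  moreover have "\<eta> u \<cdot> \<rho> (edge H 2 u 0 2) =
        \<rho> (edge H 2 u 0 1) \<cdot> t' (edge H 2 u 0 1) 1 (\<rho> (edge H 2 u 1 2)) \<cdot> \<eta>' u"
    if u: "u \<in> simplices H 2" for u
  proof -
    define \<iota> where "\<iota> = [0..<Suc 2]"
    have \<iota>: "\<iota> \<in> ops 2 2"
      unfolding \<iota>_def by (rule ops_id)
    have et: "T.et 2 u 0 1 2 = \<eta> u" "T'.et 2 u 0 1 2 = \<eta>' u"
      using T.H.oper_id[OF u] by (simp_all add: T.et_def T'.et_def upt_rec numeral_2_eq_2 One_nat_def)
    have \<eta>u: "\<eta> u \<in> carrier N" "\<eta>' u \<in> carrier N"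
      using T.et_in[OF u, of 0 1 2] T'.et_in[OF u, of 0 1 2] et by simp_all
    have idn: "\<iota> ! 0 = 0" "\<iota> ! 1 = 1" "\<iota> ! 2 = 2"
      by (simp_all add: \<iota>_def nth_append)
    \<comment> \<open>With spine 1, \<eta>(u), these are the coordinates of the word
      [(1, g)|(1, h)], whose product is (\<eta>(u), gh). Comparing the image coordinates of these
      three edges gives the relation.\<close>
    define w where "w = oper M 1 [0, 0, 1] (\<eta> u)"
    have w: "w \<in> simplices M 2" "edge M 2 w 0 1 = \<one>\<^bsub>N\<^esub>" "edge M 2 w 1 2 = \<eta> u" "edge M 2 w 0 2 = \<eta> u"
      using \<eta>u by (simp_all add: w_def T.M.edge_s0 T.M.one_N)
    have 1: "T.pe 2 u \<iota> 2 w 0 1 = (\<one>\<^bsub>N\<^esub>, edge H 2 u 0 1)" "T.pe 2 u \<iota> 2 w 1 2 = (\<one>\<^bsub>N\<^esub>, edge H 2 u 1 2)"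
      "T.pe 2 u \<iota> 2 w 0 2 = (\<eta> u, edge H 2 u 0 2)"
      using u \<eta>u by (simp_all add: T.pe_def T.xe_def w idn et T.M.gact_N del: upt_Suc)
    obtain w' where w': "w' \<in> simplices M 2" "T'.wd 2 u \<iota> 2 w' = \<psi> 2 (T.wd 2 u \<iota> 2 w)"
      using ex[OF u \<iota> w(1)] by blast
    have "[T'.pe 2 u \<iota> 2 w' i j] = \<psi> 1 [T.pe 2 u \<iota> 2 w i j]" if ij: "i \<le> j" "j \<le> 2" for i j
    proof -
      have op: "[i, j] \<in> ops 1 2" using ij by simp
      have wd1: "T.wd n b \<xi> 1 v = [T.pe n b \<xi> 1 v 0 1]" "T'.wd n b \<xi> 1 v = [T'.pe n b \<xi> 1 v 0 1]" for n b \<xi> v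
        by (simp_all add: T.wd_def T'.wd_def One_nat_def)
      have "oper ?T 2 [i, j] (T.wd 2 u \<iota> 2 w) = [T.pe 2 u \<iota> 2 w i j]"
        "oper ?T' 2 [i, j] (T'.wd 2 u \<iota> 2 w') = [T'.pe 2 u \<iota> 2 w' i j]"
        using T.wd_oper[OF u \<iota> op w(1)] T.pe_natural[OF u \<iota> op w(1), of 0 1]
          T'.wd_oper[OF u \<iota> op w'(1)] T'.pe_natural[OF u \<iota> op w'(1), of 0 1]
        by (simp_all add: wd1)
      then show ?thesis
        using simplicial_mapD2[OF \<psi> op T.wd_in[OF u \<iota> w(1)]] w'(2) by (simp del: upt_Suc)
    qed
    note step = this
    have \<psi>1: "\<psi> 1 [(\<theta>, g)] = [(\<theta> \<cdot> \<rho> g, g)]" if "g \<in> simplices H 1" "\<theta> \<in> carrier N" for \<theta> g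
      using key[OF that(1)] that(2) by blast
    have 2: "T'.xe 2 u \<iota> 2 w' 0 1 = \<rho> (edge H 2 u 0 1)" "T'.xe 2 u \<iota> 2 w' 1 2 = \<rho> (edge H 2 u 1 2)"
      "T'.xe 2 u \<iota> 2 w' 0 2 = \<eta> u \<cdot> \<rho> (edge H 2 u 0 2)"
      using step[of 0 1] step[of 1 2] step[of 0 2] u \<eta>u key[of "edge H 2 u 0 1"] key[of "edge H 2 u 1 2"]
      by (simp_all add: T'.pe_def 1 \<psi>1)
    have e01: "edge M 2 w' 0 1 = \<rho> (edge H 2 u 0 1)"
      using T'.t_xe[OF u \<iota> w'(1), of 0 1] u w'(1) key[of "edge H 2 u 0 1"] by (simp add: 2 idn del: upt_Suc)
    have e02: "edge M 2 w' 0 2 = \<eta> u \<cdot> \<rho> (edge H 2 u 0 2)"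
      using T'.t_xe[OF u \<iota> w'(1), of 0 2] u w'(1) key[of "edge H 2 u 0 2"] \<eta>u by (simp add: 2 idn del: upt_Suc)
    have "T.M.gact \<one>\<^bsub>N\<^esub> (edge M 2 w' 1 2) (\<eta>' u) = t' (edge H 2 u 0 1) 1 (\<rho> (edge H 2 u 1 2))"
      using T'.t_xe[OF u \<iota> w'(1), of 1 2] by (simp add: 2 idn et del: upt_Suc)
    then have "edge M 2 w' 1 2 = T.M.gact \<one>\<^bsub>N\<^esub> (t' (edge H 2 u 0 1) 1 (\<rho> (edge H 2 u 1 2))) (inv\<^bsub>N\<^esub> \<eta>' u)"
      using T.M.gact_inv[of "\<one>\<^bsub>N\<^esub>" "\<eta>' u" "edge M 2 w' 1 2"] \<eta>u w'(1) by simp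
    also have "\<dots> = t' (edge H 2 u 0 1) 1 (\<rho> (edge H 2 u 1 2)) \<cdot> \<eta>' u"
      using u \<eta>u key[of "edge H 2 u 1 2"] by (simp add: T.M.gact_N)
    finally show ?thesis
      using T.M.mult_edge[OF w'(1), of 0 1 2] e01 e02 u key \<eta>u by (simp add: T.M.mult_N[symmetric] T.M.N.m_assoc)
  qed
  ultimately have "regauge M H t \<eta> t' \<eta>' \<rho>"
    unfolding regauge_def using key by blast
  then show thesis using that by blast
qed

end

section \<open>Outer actions and cochains\<close>

context partial_grp
begin

section \<open>The centre Z(M) and the group Out(M)\<close>

abbreviation "Z \<equiv> ZGroup M"

lemma ZSet_kernel: "ZSet M = kernel N A c"
  by (auto simp: ZSet_def kernel_def carrier_N)

lemma Z_subgroup: "subgroup (ZSet M) N"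
  unfolding ZSet_kernel by (rule group_hom.subgroup_kernel[OF c_hom])

lemma Z_iff: "z \<in> ZSet M \<longleftrightarrow> z \<in> carrier N \<and> c z = \<one>\<^bsub>A\<^esub>"
  by (simp add: ZSet_kernel kernel_def)

lemma Z_in [simp]: "z \<in> ZSet M \<Longrightarrow> z \<in> carrier N"
  using Z_iff by blast

lemma c_Z: "z \<in> ZSet M \<Longrightarrow> c z = \<one>\<^bsub>A\<^esub>"
  using Z_iff by blast

lemma ZI: "z \<in> carrier N \<Longrightarrow> c z = \<one>\<^bsub>A\<^esub> \<Longrightarrow> z \<in> ZSet M"
  using Z_iff by blast

lemma Z_closed [simp]:
  "z \<in> ZSet M \<Longrightarrow> w \<in> ZSet M \<Longrightarrow> z \<cdot> w \<in> ZSet M" "z \<in> ZSet M \<Longrightarrow> inv\<^bsub>N\<^esub> z \<in> ZSet M" "\<one>\<^bsub>N\<^esub> \<in> ZSet M"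
  using Z_subgroup by (simp_all add: subgroup.m_closed subgroup.m_inv_closed subgroup.one_closed)

lemma Z_central: "z \<in> ZSet M \<Longrightarrow> n \<in> carrier N \<Longrightarrow> n \<cdot> z = z \<cdot> n"
  using c_conj[of z n] by (simp add: c_Z N.inv_solve_right)

lemma carrier_Z [simp]: "carrier Z = ZSet M"
  and mult_Z [simp]: "mult Z = mult N"
  and one_Z [simp]: "one Z = one N"
  by (simp_all add: ZGroup_def)

lemma Z_comm_group: "comm_group Z"
proof (rule group.group_comm_groupI)
  show "group Z"
    using subgroup.subgroup_is_group[OF Z_subgroup N.is_group] by (simp add: ZGroup_def)
qed (simp add: Z_central)

lemma inv_Z [simp]: "z \<in> ZSet M \<Longrightarrow> inv\<^bsub>Z\<^esub> z = inv\<^bsub>N\<^esub> z"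
  using N.m_inv_consistent[OF Z_subgroup] by (simp add: ZGroup_def)

lemma aut_Z [simp]: "f \<in> carrier A \<Longrightarrow> z \<in> ZSet M \<Longrightarrow> f 1 z \<in> ZSet M"
  by (rule ZI) (simp_all add: c_aut c_Z)

text \<open>The centre is the kernel of \<open>c\<close> and commutes with all of
  \<open>N(M)\<close>, so conjugations fix it; hence \<open>Out(M)\<close> acts on it.\<close>

lemma c_act_Z: "n \<in> carrier N \<Longrightarrow> z \<in> ZSet M \<Longrightarrow> c n 1 z = z"
  using Z_central[of z n] by (simp add: c_conj) (simp add: N.m_assoc)

lemma Z_mult_mult:
  assumes "v \<in> ZSet M" "w \<in> ZSet M" "x \<in> carrier N" "y \<in> carrier N"
  shows "(v \<cdot> x) \<cdot> (w \<cdot> y) = (v \<cdot> w) \<cdot> (x \<cdot> y)"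
proof -
  have "x \<cdot> (w \<cdot> y) = w \<cdot> (x \<cdot> y)"
    using assms by (simp add: N.m_assoc[symmetric] Z_central)
  then show ?thesis using assms by (simp add: N.m_assoc)
qed

lemma InnSet_image: "InnSet M = c ` carrier N"
  by (simp add: InnSet_def carrier_N)

lemma InnSet_normal: "InnSet M \<lhd> A"
  unfolding A.normal_inv_iff
proof
  show "subgroup (InnSet M) A"
    unfolding InnSet_image by (rule group_hom.img_is_subgroup[OF c_hom])
  show "\<forall>f\<in>carrier A. \<forall>h\<in>InnSet M. f \<otimes>\<^bsub>A\<^esub> h \<otimes>\<^bsub>A\<^esub> inv\<^bsub>A\<^esub> f \<in> InnSet M"
    unfolding InnSet_image by (auto simp: c_aut[symmetric])
qed

lemma out_class_eq_iff:
  assumes "f \<in> carrier A" "g \<in> carrier A"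
  shows "out_class M f = out_class M g \<longleftrightarrow> (\<exists>n\<in>carrier N. f = c n \<otimes>\<^bsub>A\<^esub> g)"
proof -
  have sub: "subgroup (InnSet M) A"
    using InnSet_normal normal_imp_subgroup by blast
  have "out_class M f = out_class M g \<longleftrightarrow> f \<in> out_class M g"
    using A.repr_independence[of f "InnSet M" g] A.rcos_self[of f "InnSet M"] sub assms
    unfolding out_class_def by auto
  then show ?thesis
    unfolding out_class_def r_coset_def InnSet_image by auto
qed

lemma out_class_mult:
  "f \<in> carrier A \<Longrightarrow> g \<in> carrier A \<Longrightarrow> out_class M f \<otimes>\<^bsub>OutGroup M\<^esub> out_class M g = out_class M (f \<otimes>\<^bsub>A\<^esub> g)"
  unfolding OutGroup_def out_class_def by (simp add: normal.rcos_sum[OF InnSet_normal])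

lemma carrier_Out: "carrier (OutGroup M) = out_class M ` carrier A"
  unfolding OutGroup_def out_class_def[abs_def] by (rule carrier_FactGroup)

lemma one_Out: "\<one>\<^bsub>OutGroup M\<^esub> = out_class M \<one>\<^bsub>A\<^esub>"
proof -
  have "InnSet M \<subseteq> carrier A"
    using InnSet_image by auto
  then show ?thesis by (simp add: OutGroup_def out_class_def)
qed

lemma Out_group: "group (OutGroup M)"
  unfolding OutGroup_def by (rule normal.factorgroup_is_group[OF InnSet_normal])

text \<open>All members of a coset agree on the centre, so the set of values in
  \<open>out_act\<close> is a singleton.\<close>

lemma out_act: "f \<in> carrier A \<Longrightarrow> z \<in> ZSet M \<Longrightarrow> out_act (out_class M f) z = f 1 z"
proof -
  assume f: "f \<in> carrier A" and z: "z \<in> ZSet M"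
  have "f \<in> out_class M f"
    using A.rcos_self[OF f] InnSet_normal normal_imp_subgroup unfolding out_class_def by blast
  moreover have "g 1 z = f 1 z" if "g \<in> out_class M f" for g
    using that f z by (auto simp: out_class_def r_coset_def InnSet_image c_act_Z)
  ultimately have "(\<lambda>g. g 1 z) ` out_class M f = {f 1 z}" by blast
  then show ?thesis by (simp add: out_act_def)
qed

end

section \<open>Outer actions and automorphisms representing them\<close>

lemma edge_bar: "i \<le> j \<Longrightarrow> edge (bar G) n w i j = [foldl (mult G) (one G) (take (j - i) (drop i w))]"
  by (simp add: edge_def bar_def word_oper_def)

locale outer_act = pg_pair M H
  for M :: "'m sset" and H :: "'h sset" +
  fixes \<alpha> :: "nat \<Rightarrow> 'h \<Rightarrow> (nat \<Rightarrow> 'm \<Rightarrow> 'm) set list"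
  assumes outer_action: "outer_action M H \<alpha>"
begin

text \<open>Stated on edges only; \<open>inducing_spine\<close> shows that this is the condition on
  all simplices that occurs in \<open>induces_outer_action\<close>.\<close>

definition inducing :: "('h \<Rightarrow> nat \<Rightarrow> 'm \<Rightarrow> 'm) \<Rightarrow> bool" where
  "inducing t \<longleftrightarrow> (\<forall>g\<in>simplices H 1. \<alpha> 1 g = [out_class M (t g)])"

lemma \<alpha>_map: "simplicial_map H (bar (OutGroup M)) \<alpha>"
  using outer_action by (simp add: outer_action_def)

lemma \<alpha>_in: "u \<in> simplices H n \<Longrightarrow> length (\<alpha> n u) = n \<and> set (\<alpha> n u) \<subseteq> carrier (OutGroup M)"
  using simplicial_mapD1[OF \<alpha>_map] by (fastforce simp: bar_def)

text \<open>In the bar construction the edge from \<open>i\<close> to \<open>i + 1\<close> is the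
  single letter at position \<open>i\<close>, so a simplicial map into it is determined by its
  values on edges.\<close>

lemma \<alpha>_spine: 
  assumes u: "u \<in> simplices H n"
  shows "\<alpha> n u = map (\<lambda>g. hd (\<alpha> 1 g)) (spine H n u)"
proof (rule nth_equalityI)
  fix i assume "i < length (\<alpha> n u)"
  then have i: "i < n" "\<alpha> n u ! i \<in> carrier (OutGroup M)"
    using \<alpha>_in[OF u] nth_mem by auto
  have "take 1 (drop i (\<alpha> n u)) = [\<alpha> n u ! i]"
    using i \<alpha>_in[OF u] by (simp add: take_Suc_conv_app_nth One_nat_def)
  then have "\<alpha> 1 (edge H n u i (Suc i)) = [\<alpha> n u ! i]"
    using simplicial_map_edge[OF \<alpha>_map u, of i "Suc i"] i group.is_monoid[OF M.Out_group]
    by (simp add: edge_bar monoid.l_one One_nat_def)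
  then show "\<alpha> n u ! i = map (\<lambda>g. hd (\<alpha> 1 g)) (spine H n u) ! i"
    using i by simp
qed (use \<alpha>_in[OF u] in simp)

lemma \<alpha>_mult: "u \<in> simplices H 2 \<Longrightarrow>
    \<alpha> 1 (edge H 2 u 0 2) = [hd (\<alpha> 1 (edge H 2 u 0 1)) \<otimes>\<^bsub>OutGroup M\<^esub> hd (\<alpha> 1 (edge H 2 u 1 2))]"
proof -
  assume u: "u \<in> simplices H 2"
  let ?a = "hd (\<alpha> 1 (edge H 2 u 0 1))" and ?b = "hd (\<alpha> 1 (edge H 2 u 1 2))"
  have ab: "\<alpha> 2 u = [?a, ?b]"
    using \<alpha>_spine[OF u] by (simp add: H.spine_2)
  then have "?a \<in> carrier (OutGroup M)"
    using \<alpha>_in[OF u] by (metis list.set_intros(1) subsetD)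
  then show ?thesis
    using simplicial_map_edge[OF \<alpha>_map u, of 0 2] ab group.is_monoid[OF M.Out_group]
    by (simp add: edge_bar monoid.l_one)
qed

lemma \<alpha>_one: "\<alpha> 1 (pg_one H) = [\<one>\<^bsub>OutGroup M\<^esub>]"
  using simplicial_mapD2[OF \<alpha>_map, of "[0, 0]" 1 0 "vertex H"]
  by (simp add: pg_one_def bar_def word_oper_def)

lemma \<alpha>_ex: "g \<in> simplices H 1 \<Longrightarrow> \<exists>f\<in>carrier A. \<alpha> 1 g = [out_class M f]"
proof -
  assume "g \<in> simplices H 1"
  then have "length (\<alpha> 1 g) = 1" "set (\<alpha> 1 g) \<subseteq> carrier (OutGroup M)"
    using \<alpha>_in by blast+
  then show ?thesis
    unfolding M.carrier_Out One_nat_def length_Suc_conv by auto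
qed

lemma inducing_spine: "inducing t \<longleftrightarrow> (\<forall>n. \<forall>u\<in>simplices H n. \<alpha> n u = map (\<lambda>g. out_class M (t g)) (spine H n u))"
proof
  assume t: "inducing t"
  show "\<forall>n. \<forall>u\<in>simplices H n. \<alpha> n u = map (\<lambda>g. out_class M (t g)) (spine H n u)"
    using t by (auto simp: \<alpha>_spine inducing_def H.spine_edge)
next
  assume R: "\<forall>n. \<forall>u\<in>simplices H n. \<alpha> n u = map (\<lambda>g. out_class M (t g)) (spine H n u)"
  have "spine H 1 g = [g]" if "g \<in> simplices H 1" for g
    using that by (simp add: H.spine_edge) (simp add: One_nat_def H.edge_1[unfolded One_nat_def])
  then show "inducing t"
    using R by (simp add: inducing_def)
qed

text \<open>Since \<alpha> is multiplicative, t(g) t(h) and t(gh) have the same outer class; a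
  choice of conjugating elements gives \<eta>.\<close>

lemma ex_pre_twisting_pair: "\<exists>t \<eta>. pre_twisting_pair M H t \<eta> \<and> inducing t"
proof -
  define t where "t g = (if g = pg_one H then \<one>\<^bsub>A\<^esub> else (SOME f. f \<in> carrier A \<and> \<alpha> 1 g = [out_class M f]))" for g
  have t: "t g \<in> carrier A \<and> \<alpha> 1 g = [out_class M (t g)]" if "g \<in> simplices H 1" for g
    using someI_ex[OF \<alpha>_ex[OF that, unfolded Bex_def]] \<alpha>_one M.one_Out by (simp add: t_def)
  have "\<exists>n\<in>carrier N. t (edge H 2 u 0 1) \<otimes>\<^bsub>A\<^esub> t (edge H 2 u 1 2) = c n \<otimes>\<^bsub>A\<^esub> t (edge H 2 u 0 2)"
    if u: "u \<in> simplices H 2" for u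
  proof -
    have "out_class M (t (edge H 2 u 0 1) \<otimes>\<^bsub>A\<^esub> t (edge H 2 u 1 2)) = out_class M (t (edge H 2 u 0 2))"
      using \<alpha>_mult[OF u] t[of "edge H 2 u 0 1"] t[of "edge H 2 u 1 2"] t[of "edge H 2 u 0 2"] u
      by (simp add: M.out_class_mult)
    then show ?thesis
      using t u by (simp add: M.out_class_eq_iff)
  qed
  then obtain n where n: "\<And>u. u \<in> simplices H 2 \<Longrightarrow> n u \<in> carrier N \<and>
      t (edge H 2 u 0 1) \<otimes>\<^bsub>A\<^esub> t (edge H 2 u 1 2) = c (n u) \<otimes>\<^bsub>A\<^esub> t (edge H 2 u 0 2)"
    by metis
  \<comment> \<open>On degenerate 2-simplices the chosen element is overridden by 1, which is
    compatible with the twisting relation because t(1) is the identity.\<close>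
  define \<eta> where "\<eta> u = (if \<exists>g\<in>simplices H 1. u = oper H 1 [0, 0, 1] g \<or> u = oper H 1 [0, 1, 1] g
      then \<one>\<^bsub>N\<^esub> else n u)" for u
  have "pre_twisting_pair M H t \<eta>"
    unfolding pre_twisting_pair_iff
  proof (intro conjI ballI)
    fix u assume u: "u \<in> simplices H 2"
    show "\<eta> u \<in> carrier N"
      using n[OF u] by (auto simp: \<eta>_def)
    show "t (edge H 2 u 0 1) \<otimes>\<^bsub>A\<^esub> t (edge H 2 u 1 2) = c (\<eta> u) \<otimes>\<^bsub>A\<^esub> t (edge H 2 u 0 2)"
    proof (cases "\<exists>g\<in>simplices H 1. u = oper H 1 [0, 0, 1] g \<or> u = oper H 1 [0, 1, 1] g")
      case True
      then obtain g where g: "g \<in> simplices H 1" "u = oper H 1 [0, 0, 1] g \<or> u = oper H 1 [0, 1, 1] g"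
        by blast
      have "t (pg_one H) = \<one>\<^bsub>A\<^esub>"
        by (simp add: t_def)
      then show ?thesis
        using g True t by (auto simp: \<eta>_def H.edge_s0 H.edge_s1)
    next
      case False
      then have "\<eta> u = n u" unfolding \<eta>_def by (rule if_not_P)
      then show ?thesis using n[OF u] by simp
    qed
  next
    show "t (pg_one H) = \<one>\<^bsub>A\<^esub>"
      by (simp add: t_def)
  qed (use t in \<open>auto simp: \<eta>_def\<close>)
  then show ?thesis using t inducing_def by blast
qed

definition act where "act g z = out_act (hd (\<alpha> 1 g)) z"

lemma act_eq: "inducing t \<Longrightarrow> g \<in> simplices H 1 \<Longrightarrow> t g \<in> carrier A \<Longrightarrow> z \<in> ZSet M \<Longrightarrow> act g z = t g 1 z"
  by (simp add: act_def inducing_def M.out_act)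

lemma act_aut: "g \<in> simplices H 1 \<Longrightarrow> \<exists>f\<in>carrier A. \<forall>z\<in>ZSet M. act g z = f 1 z"
  using \<alpha>_ex M.out_act by (fastforce simp: act_def)

lemma act_in [simp]: "g \<in> simplices H 1 \<Longrightarrow> z \<in> ZSet M \<Longrightarrow> act g z \<in> ZSet M"
  using act_aut M.aut_Z by metis

lemma act_mult: "g \<in> simplices H 1 \<Longrightarrow> z \<in> ZSet M \<Longrightarrow> w \<in> ZSet M \<Longrightarrow> act g (z \<cdot> w) = act g z \<cdot> act g w"
  using act_aut[of g] M.aut_N_mult M.Z_closed M.Z_in by metis

lemma act_inv: "g \<in> simplices H 1 \<Longrightarrow> z \<in> ZSet M \<Longrightarrow> act g (inv\<^bsub>N\<^esub> z) = inv\<^bsub>N\<^esub> act g z"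
  using act_aut[of g] M.aut_N_inv M.Z_closed M.Z_in by metis

lemma act_one [simp]: "g \<in> simplices H 1 \<Longrightarrow> act g \<one>\<^bsub>N\<^esub> = \<one>\<^bsub>N\<^esub>"
  using act_aut[of g] M.aut_N_one M.Z_closed(3) by metis

text \<open>For representing automorphisms t(g) t(h) and t(gh) differ by a conjugation, which is
  invisible on the centre.\<close>

lemma act_act:
  assumes u: "u \<in> simplices H n" and ij: "i \<le> j" "j \<le> k" "k \<le> n" and z: "z \<in> ZSet M"
  shows "act (edge H n u i j) (act (edge H n u j k) z) = act (edge H n u i k) z"
proof -
  obtain t \<eta> where t: "pre_twisting_pair M H t \<eta>" "inducing t"
    using ex_pre_twisting_pair by blast
  have t_in: "t g \<in> carrier A" if "g \<in> simplices H 1" for g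
    using that t by (simp add: pre_twisting_pair_iff)
  define v where "v = oper H n [i, j, k] u"
  have v: "v \<in> simplices H 2" "edge H 2 v 0 1 = edge H n u i j" "edge H 2 v 1 2 = edge H n u j k"
     "edge H 2 v 0 2 = edge H n u i k"
    using u ij by (simp_all add: v_def H.oper_in H.edge_oper)
  have eq: "t (edge H n u i j) \<otimes>\<^bsub>A\<^esub> t (edge H n u j k) = c (\<eta> v) \<otimes>\<^bsub>A\<^esub> t (edge H n u i k)" and "\<eta> v \<in> carrier N"
    using t v unfolding pre_twisting_pair_iff by metis+
  show ?thesis
    using fun_cong[OF fun_cong[OF eq], of 1 z] \<open>\<eta> v \<in> carrier N\<close> u ij z
    by (simp add: act_eq[OF t(2)] t_in M.c_act_Z)
qed

section \<open>Cochains with values in Z(M) and the differential in degrees 1 and 2\<close>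

lemma cochain_carrier: "carrier (cochain_group M H n) = simplices H n \<rightarrow>\<^sub>E ZSet M"
  and cochain_mult: "x \<otimes>\<^bsub>cochain_group M H n\<^esub> y = (\<lambda>u\<in>simplices H n. x u \<cdot> y u)"
  and cochain_one: "\<one>\<^bsub>cochain_group M H n\<^esub> = (\<lambda>u\<in>simplices H n. \<one>\<^bsub>N\<^esub>)"
  by (simp_all add: cochain_group_def)

lemma cochain_in: "x \<in> carrier (cochain_group M H n) \<Longrightarrow> u \<in> simplices H n \<Longrightarrow> x u \<in> ZSet M"
  by (auto simp: cochain_carrier)

lemma cochain_eqI: "x \<in> carrier (cochain_group M H n) \<Longrightarrow> y \<in> carrier (cochain_group M H n) \<Longrightarrow>
    (\<And>u. u \<in> simplices H n \<Longrightarrow> x u = y u) \<Longrightarrow> x = y"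
  by (auto simp: cochain_carrier intro: PiE_ext)

lemma cochain_comm_group: "comm_group (cochain_group M H n)"
proof (rule comm_groupI)
  let ?C = "cochain_group M H n"
  show cl: "x \<otimes>\<^bsub>?C\<^esub> y \<in> carrier ?C" if "x \<in> carrier ?C" "y \<in> carrier ?C" for x y
    using that by (auto simp: cochain_carrier cochain_mult PiE_iff)
  show one: "\<one>\<^bsub>?C\<^esub> \<in> carrier ?C"
    by (auto simp: cochain_carrier cochain_one)
  show "x \<otimes>\<^bsub>?C\<^esub> y \<otimes>\<^bsub>?C\<^esub> z = x \<otimes>\<^bsub>?C\<^esub> (y \<otimes>\<^bsub>?C\<^esub> z)"
    if "x \<in> carrier ?C" "y \<in> carrier ?C" "z \<in> carrier ?C" for x y z
    using that by (auto simp: cochain_mult cochain_in M.N.m_assoc)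
  show "x \<otimes>\<^bsub>?C\<^esub> y = y \<otimes>\<^bsub>?C\<^esub> x" if "x \<in> carrier ?C" "y \<in> carrier ?C" for x y
    using that by (auto simp: cochain_mult cochain_in M.Z_central)
  show "\<one>\<^bsub>?C\<^esub> \<otimes>\<^bsub>?C\<^esub> x = x" if x: "x \<in> carrier ?C" for x
    by (rule cochain_eqI[OF cl[OF one x] x]) (use x in \<open>simp add: cochain_mult cochain_one cochain_in\<close>)
  show "\<exists>y\<in>carrier ?C. y \<otimes>\<^bsub>?C\<^esub> x = \<one>\<^bsub>?C\<^esub>" if x: "x \<in> carrier ?C" for x
    by (rule bexI[of _ "\<lambda>u\<in>simplices H n. inv\<^bsub>N\<^esub> x u"])
      (use x in \<open>auto simp: cochain_mult cochain_one cochain_carrier PiE_iff\<close>)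
qed

lemma face_2: "face H 2 0 u = oper H 2 [1, 2] u" "face H 2 1 u = oper H 2 [0, 2] u"
    "face H 2 2 u = oper H 2 [0, 1] u"
  by (simp_all add: face_def numeral_2_eq_2 One_nat_def)

lemma face_3: "face H 3 0 u = oper H 3 [1, 2, 3] u" "face H 3 1 u = oper H 3 [0, 2, 3] u"
    "face H 3 2 u = oper H 3 [0, 1, 3] u" "face H 3 3 u = oper H 3 [0, 1, 2] u"
  by (simp_all add: face_def numeral_3_eq_3 numeral_2_eq_2 One_nat_def)

lemma codiff_1:
  assumes x: "x \<in> carrier (cochain_group M H 1)" and u: "u \<in> simplices H 2"
  shows "codiff M H \<alpha> 1 x u =
    act (edge H 2 u 0 1) (x (edge H 2 u 1 2)) \<cdot> (inv\<^bsub>N\<^esub> x (edge H 2 u 0 2) \<cdot> x (edge H 2 u 0 1))"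
proof -
  interpret Z: comm_group "ZGroup M" by (rule M.Z_comm_group)
  have S: "Suc 1 = 2" "{1..2::nat} = {1, 2}" by auto
  have xin: "x (face H 2 1 u) \<in> ZSet M" "x (face H 2 2 u) \<in> ZSet M"
    using x u by (auto intro!: cochain_in[OF x] simp: face_2 H.oper_in)
  have "(\<Otimes>\<^bsub>ZGroup M\<^esub>i\<in>{1..2}. x (face H 2 i u) [^]\<^bsub>ZGroup M\<^esub> ((-1::int) ^ i)) =
      inv\<^bsub>N\<^esub> x (face H 2 1 u) \<cdot> x (face H 2 2 u)"
    unfolding S(2) using xin by (simp add: Z.int_pow_neg Pi_def)
  then show ?thesis
    unfolding codiff_def S(1) using u by (simp add: act_def face_2 edge_def)
qed

lemma codiff_2:
  assumes x: "x \<in> carrier (cochain_group M H 2)" and u: "u \<in> simplices H 3"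
  shows "codiff M H \<alpha> 2 x u = act (edge H 3 u 0 1) (x (oper H 3 [1, 2, 3] u)) \<cdot>
    (inv\<^bsub>N\<^esub> x (oper H 3 [0, 2, 3] u) \<cdot> (x (oper H 3 [0, 1, 3] u) \<cdot> inv\<^bsub>N\<^esub> x (oper H 3 [0, 1, 2] u)))"
proof -
  interpret Z: comm_group "ZGroup M" by (rule M.Z_comm_group)
  have S: "Suc 2 = 3" "{1..3::nat} = {1, 2, 3}" by auto
  have xin: "x (face H 3 1 u) \<in> ZSet M" "x (face H 3 2 u) \<in> ZSet M" "x (face H 3 3 u) \<in> ZSet M"
    using x u by (auto intro!: cochain_in[OF x] simp: face_3 H.oper_in)
  have "(\<Otimes>\<^bsub>ZGroup M\<^esub>i\<in>{1..3}. x (face H 3 i u) [^]\<^bsub>ZGroup M\<^esub> ((-1::int) ^ i)) =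
      inv\<^bsub>N\<^esub> x (face H 3 1 u) \<cdot> (x (face H 3 2 u) \<cdot> inv\<^bsub>N\<^esub> x (face H 3 3 u))"
    unfolding S(2) using xin by (simp add: Z.int_pow_neg Pi_def)
  then show ?thesis
    unfolding codiff_def S(1) using u by (simp add: act_def face_3 edge_def)
qed

lemma codiff_1_in:
  assumes x: "x \<in> carrier (cochain_group M H 1)"
  shows "codiff M H \<alpha> 1 x \<in> carrier (cochain_group M H 2)"
proof -
  have "codiff M H \<alpha> 1 x u \<in> ZSet M" if u: "u \<in> simplices H 2" for u
    unfolding codiff_1[OF x u] using u cochain_in[OF x] by simp
  moreover have "codiff M H \<alpha> 1 x \<in> extensional (simplices H (Suc 1))"
    by (simp add: codiff_def)
  ultimately show ?thesis
    by (auto simp: cochain_carrier PiE_def)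
qed

lemma codiff_2_in:
  assumes x: "x \<in> carrier (cochain_group M H 2)"
  shows "codiff M H \<alpha> 2 x \<in> carrier (cochain_group M H 3)"
proof -
  have "codiff M H \<alpha> 2 x u \<in> ZSet M" if u: "u \<in> simplices H 3" for u
    unfolding codiff_2[OF x u] using u cochain_in[OF x] by (simp add: H.oper_in)
  moreover have "codiff M H \<alpha> 2 x \<in> extensional (simplices H (Suc 2))"
    by (simp add: codiff_def)
  ultimately show ?thesis
    by (auto simp: cochain_carrier PiE_def)
qed

lemma codiff_1_hom: "group_hom (cochain_group M H 1) (cochain_group M H 2) (codiff M H \<alpha> 1)"
proof (intro group_hom.intro group_hom_axioms.intro homI)
  show "group (cochain_group M H 1)" "group (cochain_group M H 2)"
    using cochain_comm_group by (simp_all add: comm_group_def)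
  interpret Z: comm_group "ZGroup M" by (rule M.Z_comm_group)
  interpret C: comm_group "cochain_group M H 1" by (rule cochain_comm_group)
  interpret D: comm_group "cochain_group M H 2" by (rule cochain_comm_group)
  fix x y assume x: "x \<in> carrier (cochain_group M H 1)" and y: "y \<in> carrier (cochain_group M H 1)"
  show "codiff M H \<alpha> 1 (x \<otimes>\<^bsub>cochain_group M H 1\<^esub> y) = codiff M H \<alpha> 1 x \<otimes>\<^bsub>cochain_group M H 2\<^esub> codiff M H \<alpha> 1 y"
  proof (rule cochain_eqI[OF codiff_1_in D.m_closed[OF codiff_1_in codiff_1_in]])
    fix u assume u: "u \<in> simplices H 2"
    show "codiff M H \<alpha> 1 (x \<otimes>\<^bsub>cochain_group M H 1\<^esub> y) u = (codiff M H \<alpha> 1 x \<otimes>\<^bsub>cochain_group M H 2\<^esub> codiff M H \<alpha> 1 y) u"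
      using u x y codiff_1[OF C.m_closed[OF x y] u] Z.m_ac Z.inv_mult
      by (simp add: codiff_1 cochain_mult[of 2] cochain_in act_mult) (simp add: cochain_mult cochain_in act_mult)
  qed (use x y in simp_all)
qed (rule codiff_1_in)

lemma codiff_2_hom: "group_hom (cochain_group M H 2) (cochain_group M H 3) (codiff M H \<alpha> 2)"
proof (intro group_hom.intro group_hom_axioms.intro homI)
  show "group (cochain_group M H 2)" "group (cochain_group M H 3)"
    using cochain_comm_group by (simp_all add: comm_group_def)
  interpret Z: comm_group "ZGroup M" by (rule M.Z_comm_group)
  interpret C: comm_group "cochain_group M H 2" by (rule cochain_comm_group)
  interpret D: comm_group "cochain_group M H 3" by (rule cochain_comm_group)
  fix x y assume x: "x \<in> carrier (cochain_group M H 2)" and y: "y \<in> carrier (cochain_group M H 2)"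
  show "codiff M H \<alpha> 2 (x \<otimes>\<^bsub>cochain_group M H 2\<^esub> y) = codiff M H \<alpha> 2 x \<otimes>\<^bsub>cochain_group M H 3\<^esub> codiff M H \<alpha> 2 y"
  proof (rule cochain_eqI[OF codiff_2_in D.m_closed[OF codiff_2_in codiff_2_in]])
    fix u assume u: "u \<in> simplices H 3"
    show "codiff M H \<alpha> 2 (x \<otimes>\<^bsub>cochain_group M H 2\<^esub> y) u = (codiff M H \<alpha> 2 x \<otimes>\<^bsub>cochain_group M H 3\<^esub> codiff M H \<alpha> 2 y) u"
      using u x y codiff_2[OF C.m_closed[OF x y] u] Z.m_ac Z.inv_mult
      by (simp add: codiff_2 cochain_mult[of 3] cochain_in act_mult H.oper_in)
        (simp add: cochain_mult cochain_in act_mult H.oper_in)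
  qed (use x y in simp_all)
qed (rule codiff_2_in)

text \<open>After expansion with \<open>act_act\<close>, only the six central elements named in the
  proof occur, each once with its inverse.\<close>

lemma codiff_codiff:
  assumes x: "x \<in> carrier (cochain_group M H 1)"
  shows "codiff M H \<alpha> 2 (codiff M H \<alpha> 1 x) = \<one>\<^bsub>cochain_group M H 3\<^esub>"
proof (rule cochain_eqI[OF codiff_2_in[OF codiff_1_in[OF x]]])
  interpret Z: comm_group "ZGroup M" by (rule M.Z_comm_group)
  interpret D: comm_group "cochain_group M H 3" by (rule cochain_comm_group)
  show "\<one>\<^bsub>cochain_group M H 3\<^esub> \<in> carrier (cochain_group M H 3)" by simp
  fix u assume u: "u \<in> simplices H 3"
  have f: "codiff M H \<alpha> 1 x (oper H 3 [i, j, k] u) = act (edge H 3 u i j) (x (edge H 3 u j k)) \<cdot>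
      (inv\<^bsub>N\<^esub> x (edge H 3 u i k) \<cdot> x (edge H 3 u i j))" if "i \<le> j" "j \<le> k" "k \<le> 3" for i j k
    using codiff_1[OF x, of "oper H 3 [i, j, k] u"] u that by (simp add: H.oper_in H.edge_oper)
  have xin: "x (edge H 3 u i j) \<in> ZSet M" if "i \<le> j" "j \<le> 3" for i j
    using cochain_in[OF x] u that by simp
  define P Q R d e f where defs: "P = act (edge H 3 u 0 2) (x (edge H 3 u 2 3))"
    "Q = act (edge H 3 u 0 1) (x (edge H 3 u 1 3))" "R = act (edge H 3 u 0 1) (x (edge H 3 u 1 2))"
    "d = x (edge H 3 u 0 3)" "e = x (edge H 3 u 0 2)" "f = x (edge H 3 u 0 1)"
  have in_Z [simp]: "P \<in> ZSet M" "Q \<in> ZSet M" "R \<in> ZSet M" "d \<in> ZSet M" "e \<in> ZSet M" "f \<in> ZSet M"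
    using u xin by (simp_all add: defs)
  have "codiff M H \<alpha> 2 (codiff M H \<alpha> 1 x) u =
     (P \<cdot> (inv\<^bsub>N\<^esub> Q \<cdot> R)) \<cdot> (inv\<^bsub>N\<^esub> (P \<cdot> (inv\<^bsub>N\<^esub> d \<cdot> e)) \<cdot>
     ((Q \<cdot> (inv\<^bsub>N\<^esub> d \<cdot> f)) \<cdot> inv\<^bsub>N\<^esub> (R \<cdot> (inv\<^bsub>N\<^esub> e \<cdot> f))))"
    using u xin act_act[OF u, of 0 1 2 "x (edge H 3 u 2 3)"]
    by (simp add: codiff_2[OF codiff_1_in[OF x] u] f act_mult act_inv defs)
  \<comment> \<open>The inverse laws are withheld so that reordering pairs every factor with its
    inverse before anything cancels.\<close>
  also have "\<dots> = (P \<cdot> inv\<^bsub>N\<^esub> P) \<cdot> (Q \<cdot> inv\<^bsub>N\<^esub> Q) \<cdot> (R \<cdot> inv\<^bsub>N\<^esub> R) \<cdot>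
      (d \<cdot> inv\<^bsub>N\<^esub> d) \<cdot> (e \<cdot> inv\<^bsub>N\<^esub> e) \<cdot> (f \<cdot> inv\<^bsub>N\<^esub> f)"
    using Z.m_ac Z.inv_mult by (simp del: M.N.r_inv M.N.l_inv M.N.Units_r_inv M.N.Units_l_inv Z.r_inv Z.l_inv Z.Units_r_inv Z.Units_l_inv)
  also have "\<dots> = \<one>\<^bsub>N\<^esub>" 
    by simp
  finally show "codiff M H \<alpha> 2 (codiff M H \<alpha> 1 x) u = \<one>\<^bsub>cochain_group M H 3\<^esub> u"
    using u by (simp add: cochain_one)
qed

end

section \<open>Change of twisting pairs\<close>

text \<open>The calculation inside \<open>gauge_change\<close>. There a, f, g are \<rho> on the
  edges 01, 03, 02; b, d, h, e are translates of \<rho> under t'; p, q, s are \<eta>' on the faces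
  012, 023, 013, and r is the translate of \<eta>' on 123. The premise \<open>pe\<close> is the
  twisting relation and \<open>pq\<close> the equation defining \<open>k\<close>.\<close>

lemma (in partial_grp) gauge_identity:
  assumes "a \<in> carrier N" "b \<in> carrier N" "d \<in> carrier N" "e \<in> carrier N" "f \<in> carrier N" "g \<in> carrier N"
    "h \<in> carrier N" "p \<in> carrier N" "q \<in> carrier N" "r \<in> carrier N" "s \<in> carrier N" "k \<in> ZSet M"
    and pe: "p \<cdot> e = d \<cdot> p" and pq: "p \<cdot> q = k \<cdot> (r \<cdot> s)"
  shows "(a \<cdot> b \<cdot> p \<cdot> inv\<^bsub>N\<^esub> g) \<cdot> (g \<cdot> e \<cdot> q \<cdot> inv\<^bsub>N\<^esub> f) =
    k \<cdot> ((a \<cdot> (b \<cdot> d \<cdot> r \<cdot> inv\<^bsub>N\<^esub> h) \<cdot> inv\<^bsub>N\<^esub> a) \<cdot> (a \<cdot> h \<cdot> s \<cdot> inv\<^bsub>N\<^esub> f))"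
proof -
  have "(a \<cdot> b \<cdot> p \<cdot> inv\<^bsub>N\<^esub> g) \<cdot> (g \<cdot> e \<cdot> q \<cdot> inv\<^bsub>N\<^esub> f) =
      a \<cdot> b \<cdot> (p \<cdot> e) \<cdot> q \<cdot> inv\<^bsub>N\<^esub> f"
    using assms(1-12) by (simp add: N_simps)
  also have "\<dots> = (a \<cdot> b \<cdot> d) \<cdot> (p \<cdot> q) \<cdot> inv\<^bsub>N\<^esub> f"
    unfolding pe using assms(1-12) by (simp add: N_simps)
  also have "\<dots> = ((a \<cdot> b \<cdot> d) \<cdot> k) \<cdot> (r \<cdot> s \<cdot> inv\<^bsub>N\<^esub> f)"
    unfolding pq using assms(1-12) by (simp add: N_simps)
  also have "(a \<cdot> b \<cdot> d) \<cdot> k = k \<cdot> (a \<cdot> b \<cdot> d)"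
    using assms(1-12) by (simp add: Z_central)
  finally show ?thesis
    using assms(1-12) by (simp add: N_simps)
qed

lemma (in partial_grp) Z_cancel:
  assumes "w \<in> ZSet M" "k \<in> ZSet M" "d \<in> carrier N" "w \<cdot> d = \<one>\<^bsub>N\<^esub>"
  shows "w \<cdot> k \<cdot> d = k"
  using assms Z_central[of k w] by (simp add: N.m_assoc)

context pg_pair
begin

section \<open>The obstruction cochain of a pre-twisting pair\<close>

lemma pre_twisting_pairD:
  assumes "pre_twisting_pair M H t \<eta>"
  shows "g \<in> simplices H 1 \<Longrightarrow> t g \<in> carrier A" "u \<in> simplices H 2 \<Longrightarrow> \<eta> u \<in> carrier N"
    "t (pg_one H) = \<one>\<^bsub>A\<^esub>"
    "u \<in> simplices H 2 \<Longrightarrow> t (edge H 2 u 0 1) \<otimes>\<^bsub>A\<^esub> t (edge H 2 u 1 2) = c (\<eta> u) \<otimes>\<^bsub>A\<^esub> t (edge H 2 u 0 2)"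
  using assms by (auto simp: pre_twisting_pair_iff)

lemma pre_twisting_pair_3:
  assumes "pre_twisting_pair M H t \<eta>" "u \<in> simplices H 3" "i \<le> j" "j \<le> k" "k \<le> 3"
  shows "\<eta> (oper H 3 [i, j, k] u) \<in> carrier N"
    "t (edge H 3 u i j) \<otimes>\<^bsub>A\<^esub> t (edge H 3 u j k) = c (\<eta> (oper H 3 [i, j, k] u)) \<otimes>\<^bsub>A\<^esub> t (edge H 3 u i k)"
  using pre_twisting_pairD(2,4)[OF assms(1), of "oper H 3 [i, j, k] u"] assms H.oper_in[of "[i, j, k]" 2 3 u]
  by (simp_all add: H.edge_oper)

lemma obstruction_eq:
  assumes "u \<in> simplices H 3"
  shows "obstruction_cochain M H t \<eta> u =
    \<eta> (oper H 3 [0, 1, 2] u) \<cdot> \<eta> (oper H 3 [0, 2, 3] u) \<cdot> inv\<^bsub>N\<^esub> \<eta> (oper H 3 [0, 1, 3] u) \<cdot>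
    inv\<^bsub>N\<^esub> (t (edge H 3 u 0 1) 1 (\<eta> (oper H 3 [1, 2, 3] u)))"
  using assms H.simplex_2[OF assms] H.mult_edge[OF assms]
  by (simp add: obstruction_cochain_def Let_def H.spine_3)

text \<open>The inverses in \<kappa> are moved to the other side, so \<kappa> becomes the factor by
  which the cocycle condition fails.\<close>

lemma obstruction_unique:
  assumes "pre_twisting_pair M H t \<eta>" "u \<in> simplices H 3" "k \<in> carrier N"
  shows "obstruction_cochain M H t \<eta> u = k \<longleftrightarrow>
    \<eta> (oper H 3 [0, 1, 2] u) \<cdot> \<eta> (oper H 3 [0, 2, 3] u) =
    k \<cdot> (t (edge H 3 u 0 1) 1 (\<eta> (oper H 3 [1, 2, 3] u)) \<cdot> \<eta> (oper H 3 [0, 1, 3] u))"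
  using pre_twisting_pair_3[OF assms(1,2)] pre_twisting_pairD(1)[OF assms(1)] assms(2,3)
  by (simp add: obstruction_eq M.N.inv_solve_right') (simp add: M.N.m_assoc)

text \<open>Both sides of the cocycle condition have conjugations that, composed with
  \<open>t\<close> on the edge 03, equal t(g) t(h) t(k). These conjugations coincide, so the factor
  \<kappa> lies in the kernel of \<open>c\<close>.\<close>

lemma obstruction_Z:
  assumes pre: "pre_twisting_pair M H t \<eta>" and u: "u \<in> simplices H 3"
  shows "obstruction_cochain M H t \<eta> u \<in> ZSet M"
proof -
  note \<eta> = pre_twisting_pair_3(1)[OF pre u]
  have e: "edge H 3 u i j \<in> simplices H 1" if "i \<le> j" "j \<le> 3" for i j
    using u that by simp
  have t: "t (edge H 3 u i j) \<in> carrier A" if "i \<le> j" "j \<le> 3" for i j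
    using pre_twisting_pairD(1)[OF pre e[OF that]] .
  define k where "k = obstruction_cochain M H t \<eta> u"
  have k: "k \<in> carrier N"
    using \<eta> t by (simp add: k_def obstruction_eq u)
  let ?t = "\<lambda>i j. t (edge H 3 u i j)" and ?\<eta> = "\<lambda>i j k. \<eta> (oper H 3 [i, j, k] u)"
  have "c (?\<eta> 0 1 2 \<cdot> ?\<eta> 0 2 3) \<otimes>\<^bsub>A\<^esub> ?t 0 3 = c (?\<eta> 0 1 2) \<otimes>\<^bsub>A\<^esub> (?t 0 2 \<otimes>\<^bsub>A\<^esub> ?t 2 3)"
    using pre_twisting_pair_3(2)[OF pre u, of 0 2 3] \<eta> t by (simp add: M.c_mult M.A.m_assoc)
  also have "\<dots> = ?t 0 1 \<otimes>\<^bsub>A\<^esub> ?t 1 2 \<otimes>\<^bsub>A\<^esub> ?t 2 3"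
    using pre_twisting_pair_3(2)[OF pre u, of 0 1 2] \<eta> t by (simp add: M.A.m_assoc[symmetric])
  finally have 1: "c (?\<eta> 0 1 2 \<cdot> ?\<eta> 0 2 3) \<otimes>\<^bsub>A\<^esub> ?t 0 3 = ?t 0 1 \<otimes>\<^bsub>A\<^esub> ?t 1 2 \<otimes>\<^bsub>A\<^esub> ?t 2 3" .
  have "c (?t 0 1 1 (?\<eta> 1 2 3) \<cdot> ?\<eta> 0 1 3) \<otimes>\<^bsub>A\<^esub> ?t 0 3 =
      ?t 0 1 \<otimes>\<^bsub>A\<^esub> c (?\<eta> 1 2 3) \<otimes>\<^bsub>A\<^esub> inv\<^bsub>A\<^esub> ?t 0 1 \<otimes>\<^bsub>A\<^esub> (?t 0 1 \<otimes>\<^bsub>A\<^esub> ?t 1 3)"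
    using pre_twisting_pair_3(2)[OF pre u, of 0 1 3] \<eta> t by (simp add: M.c_mult M.c_aut M.A.m_assoc)
  also have "\<dots> = ?t 0 1 \<otimes>\<^bsub>A\<^esub> (c (?\<eta> 1 2 3) \<otimes>\<^bsub>A\<^esub> ?t 1 3)"
    using \<eta> t by (simp add: M.A.m_assoc M.A.inv_solve_left')
  also have "\<dots> = ?t 0 1 \<otimes>\<^bsub>A\<^esub> ?t 1 2 \<otimes>\<^bsub>A\<^esub> ?t 2 3"
    using pre_twisting_pair_3(2)[OF pre u, of 1 2 3] \<eta> t by (simp add: M.A.m_assoc)
  finally have 2: "c (?t 0 1 1 (?\<eta> 1 2 3) \<cdot> ?\<eta> 0 1 3) \<otimes>\<^bsub>A\<^esub> ?t 0 3 = ?t 0 1 \<otimes>\<^bsub>A\<^esub> ?t 1 2 \<otimes>\<^bsub>A\<^esub> ?t 2 3" .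
  have 3: "?\<eta> 0 1 2 \<cdot> ?\<eta> 0 2 3 = k \<cdot> (?t 0 1 1 (?\<eta> 1 2 3) \<cdot> ?\<eta> 0 1 3)"
    using obstruction_unique[OF pre u k] k_def by simp
  have B: "?t 0 1 1 (?\<eta> 1 2 3) \<cdot> ?\<eta> 0 1 3 \<in> carrier N"
    using \<eta> t by simp
  have "c (?\<eta> 0 1 2 \<cdot> ?\<eta> 0 2 3) = c (?t 0 1 1 (?\<eta> 1 2 3) \<cdot> ?\<eta> 0 1 3)"
    using M.A.right_cancel[of "?t 0 3" "c (?\<eta> 0 1 2 \<cdot> ?\<eta> 0 2 3)" "c (?t 0 1 1 (?\<eta> 1 2 3) \<cdot> ?\<eta> 0 1 3)"]
      1 2 \<eta> t B by simp
  then have "c k \<otimes>\<^bsub>A\<^esub> c (?t 0 1 1 (?\<eta> 1 2 3) \<cdot> ?\<eta> 0 1 3) = c (?t 0 1 1 (?\<eta> 1 2 3) \<cdot> ?\<eta> 0 1 3)"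
    unfolding 3 using M.c_mult[OF k B] by simp
  then have "c k = \<one>\<^bsub>A\<^esub>"
    using k B M.A.r_cancel_one M.c_in by metis
  then show ?thesis using M.ZI k k_def by simp
qed

lemma obstruction_one_iff:
  "twisting_pair M H t \<eta> \<longleftrightarrow> pre_twisting_pair M H t \<eta> \<and>
    (\<forall>u\<in>simplices H 3. obstruction_cochain M H t \<eta> u = \<one>\<^bsub>N\<^esub>)"
proof -
  have "obstruction_cochain M H t \<eta> u = \<one>\<^bsub>N\<^esub> \<longleftrightarrow>
    t (edge H 3 u 0 1) 1 (\<eta> (oper H 3 [1, 2, 3] u)) \<cdot> \<eta> (oper H 3 [0, 1, 3] u) =
        \<eta> (oper H 3 [0, 1, 2] u) \<cdot> \<eta> (oper H 3 [0, 2, 3] u)"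
    if "pre_twisting_pair M H t \<eta>" "u \<in> simplices H 3" for u
    using obstruction_unique[OF that, of "\<one>\<^bsub>N\<^esub>"] pre_twisting_pair_3[OF that] pre_twisting_pairD(1)[OF that(1)] that(2) by auto
  then show ?thesis unfolding twisting_pair_iff by blast
qed

text \<open>The formula for \<eta> is the relation in \<open>regauge\<close> solved for it. The
  value of \<kappa> stays literally the same, not only up to a coboundary.\<close>

lemma gauge_change:
  assumes pre: "pre_twisting_pair M H t' \<eta>'"
    and \<rho>: "\<And>g. g \<in> simplices H 1 \<Longrightarrow> \<rho> g \<in> carrier N" "\<rho> (pg_one H) = \<one>\<^bsub>N\<^esub>"
    and t: "\<And>g. g \<in> simplices H 1 \<Longrightarrow> t g = c (\<rho> g) \<otimes>\<^bsub>A\<^esub> t' g"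
    and \<eta>: "\<And>u. u \<in> simplices H 2 \<Longrightarrow> \<eta> u =
        \<rho> (edge H 2 u 0 1) \<cdot> t' (edge H 2 u 0 1) 1 (\<rho> (edge H 2 u 1 2)) \<cdot> \<eta>' u \<cdot> inv\<^bsub>N\<^esub> \<rho> (edge H 2 u 0 2)"
  shows "pre_twisting_pair M H t \<eta>" "regauge M H t \<eta> t' \<eta>' \<rho>"
    "u \<in> simplices H 3 \<Longrightarrow> obstruction_cochain M H t \<eta> u = obstruction_cochain M H t' \<eta>' u"
proof -
  note t' = pre_twisting_pairD(1)[OF pre] and \<eta>' = pre_twisting_pairD(2)[OF pre]
  have \<eta>in: "\<eta> u \<in> carrier N" if "u \<in> simplices H 2" for u
    using that \<rho> t' \<eta>' by (simp add: \<eta>)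
  show pre': "pre_twisting_pair M H t \<eta>"
    unfolding pre_twisting_pair_iff
  proof (intro conjI ballI)
    fix u assume u: "u \<in> simplices H 2"
    let ?t' = "\<lambda>i j. t' (edge H 2 u i j)" and ?\<rho> = "\<lambda>i j. \<rho> (edge H 2 u i j)"
    have in_A: "?t' 0 1 \<in> carrier A" "?t' 1 2 \<in> carrier A" "?t' 0 2 \<in> carrier A"
      and in_N: "?\<rho> 0 1 \<in> carrier N" "?\<rho> 1 2 \<in> carrier N" "?\<rho> 0 2 \<in> carrier N" "\<eta>' u \<in> carrier N"
      using u t' \<rho> \<eta>' by simp_all
    have "c (\<eta> u) \<otimes>\<^bsub>A\<^esub> t (edge H 2 u 0 2) =
        c (?\<rho> 0 1) \<otimes>\<^bsub>A\<^esub> (?t' 0 1 \<otimes>\<^bsub>A\<^esub> c (?\<rho> 1 2) \<otimes>\<^bsub>A\<^esub> inv\<^bsub>A\<^esub> ?t' 0 1) \<otimes>\<^bsub>A\<^esub> (c (\<eta>' u) \<otimes>\<^bsub>A\<^esub> ?t' 0 2)"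
      using u in_A in_N by (simp add: \<eta> t M.c_mult M.c_inv M.c_aut M.A.m_assoc M.A.inv_solve_left')
    also have "\<dots> = t (edge H 2 u 0 1) \<otimes>\<^bsub>A\<^esub> t (edge H 2 u 1 2)"
      using u in_A in_N by (simp add: pre_twisting_pairD(4)[OF pre u, symmetric] t M.A.m_assoc M.A.inv_solve_left')
    finally show "t (edge H 2 u 0 1) \<otimes>\<^bsub>A\<^esub> t (edge H 2 u 1 2) = c (\<eta> u) \<otimes>\<^bsub>A\<^esub> t (edge H 2 u 0 2)" ..
  next
    show "t (pg_one H) = \<one>\<^bsub>A\<^esub>"
      using pre_twisting_pairD(3)[OF pre] by (simp add: t \<rho>)
    fix g assume g: "g \<in> simplices H 1"
    have "\<eta>' (oper H 1 [0, 0, 1] g) = \<one>\<^bsub>N\<^esub>" "\<eta>' (oper H 1 [0, 1, 1] g) = \<one>\<^bsub>N\<^esub>"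
      using pre g by (simp_all add: pre_twisting_pair_iff)
    then show "\<eta> (oper H 1 [0, 0, 1] g) = \<one>\<^bsub>N\<^esub>" "\<eta> (oper H 1 [0, 1, 1] g) = \<one>\<^bsub>N\<^esub>"
      using g \<rho> t' pre_twisting_pairD(3)[OF pre] by (simp_all add: \<eta> H.edge_s0 H.edge_s1)
  qed (use \<eta>in t \<rho> t' in simp_all)
  show "regauge M H t \<eta> t' \<eta>' \<rho>"
    using \<rho> t \<eta>in t' \<eta>' by (simp add: regauge_def \<eta> M.N.inv_solve_right M.N.m_assoc)
  assume u: "u \<in> simplices H 3"
  let ?t' = "\<lambda>i j. t' (edge H 3 u i j)" and ?\<rho> = "\<lambda>i j. \<rho> (edge H 3 u i j)"
    and ?\<eta>' = "\<lambda>i j k. \<eta>' (oper H 3 [i, j, k] u)" and ?k = "obstruction_cochain M H t' \<eta>' u"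
  have e: "edge H 3 u i j \<in> simplices H 1" if "i \<le> j" "j \<le> 3" for i j
    using u that by simp
  have in_A: "?t' i j \<in> carrier A" if "i \<le> j" "j \<le> 3" for i j
    using t'[OF e[OF that]] .
  have in_N: "?\<rho> i j \<in> carrier N" if "i \<le> j" "j \<le> 3" for i j
    using \<rho>(1)[OF e[OF that]] .
  note \<eta>'3 = pre_twisting_pair_3(1)[OF pre u]
  have k: "?k \<in> ZSet M"
    by (rule obstruction_Z[OF pre u])
  have \<eta>3: "\<eta> (oper H 3 [i, j, l] u) = ?\<rho> i j \<cdot> ?t' i j 1 (?\<rho> j l) \<cdot> ?\<eta>' i j l \<cdot> inv\<^bsub>N\<^esub> ?\<rho> i l"
    if "i \<le> j" "j \<le> l" "l \<le> 3" for i j l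
    using \<eta>[of "oper H 3 [i, j, l] u"] u that by (simp add: H.oper_in H.edge_oper)
  have pq: "?\<eta>' 0 1 2 \<cdot> ?\<eta>' 0 2 3 = ?k \<cdot> (?t' 0 1 1 (?\<eta>' 1 2 3) \<cdot> ?\<eta>' 0 1 3)"
    using obstruction_unique[OF pre u, of ?k] k by simp
  have "?t' 0 1 1 (?t' 1 2 1 (?\<rho> 2 3)) = c (?\<eta>' 0 1 2) 1 (?t' 0 2 1 (?\<rho> 2 3))"
    using fun_cong[OF fun_cong[OF pre_twisting_pair_3(2)[OF pre u, of 0 1 2]], of 1 "?\<rho> 2 3"] in_N in_A by simp
  then have pe: "?\<eta>' 0 1 2 \<cdot> ?t' 0 2 1 (?\<rho> 2 3) = ?t' 0 1 1 (?t' 1 2 1 (?\<rho> 2 3)) \<cdot> ?\<eta>' 0 1 2"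
    using in_N in_A \<eta>'3 by (simp add: M.c_conj M.N_simps)
  have "t (edge H 3 u 0 1) 1 (\<eta> (oper H 3 [1, 2, 3] u)) = c (?\<rho> 0 1) 1 (?t' 0 1 1 (\<eta> (oper H 3 [1, 2, 3] u)))"
    using u \<eta>in by (simp add: t H.oper_in)
  also have "\<dots> = ?\<rho> 0 1 \<cdot> ?t' 0 1 1 (\<eta> (oper H 3 [1, 2, 3] u)) \<cdot> inv\<^bsub>N\<^esub> ?\<rho> 0 1"
    using u \<eta>in in_N in_A by (intro M.c_conj) (simp_all add: H.oper_in)
  also have "?t' 0 1 1 (\<eta> (oper H 3 [1, 2, 3] u)) =
      ?t' 0 1 1 (?\<rho> 1 2) \<cdot> ?t' 0 1 1 (?t' 1 2 1 (?\<rho> 2 3)) \<cdot> ?t' 0 1 1 (?\<eta>' 1 2 3) \<cdot>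
        inv\<^bsub>N\<^esub> (?t' 0 1 1 (?\<rho> 1 3))"
    using in_N in_A \<eta>'3 by (simp add: \<eta>3 M.aut_N_mult M.aut_N_inv)
  finally have "t (edge H 3 u 0 1) 1 (\<eta> (oper H 3 [1, 2, 3] u)) =
      ?\<rho> 0 1 \<cdot> (?t' 0 1 1 (?\<rho> 1 2) \<cdot> ?t' 0 1 1 (?t' 1 2 1 (?\<rho> 2 3)) \<cdot> ?t' 0 1 1 (?\<eta>' 1 2 3) \<cdot>
        inv\<^bsub>N\<^esub> (?t' 0 1 1 (?\<rho> 1 3))) \<cdot> inv\<^bsub>N\<^esub> ?\<rho> 0 1" .
  then have "\<eta> (oper H 3 [0, 1, 2] u) \<cdot> \<eta> (oper H 3 [0, 2, 3] u) =
      ?k \<cdot> (t (edge H 3 u 0 1) 1 (\<eta> (oper H 3 [1, 2, 3] u)) \<cdot> \<eta> (oper H 3 [0, 1, 3] u))"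
    using in_N in_A \<eta>'3 k pe pq
      M.gauge_identity[of "?\<rho> 0 1" "?t' 0 1 1 (?\<rho> 1 2)" "?t' 0 1 1 (?t' 1 2 1 (?\<rho> 2 3))" "?t' 0 2 1 (?\<rho> 2 3)"
        "?\<rho> 0 3" "?\<rho> 0 2" "?t' 0 1 1 (?\<rho> 1 3)" "?\<eta>' 0 1 2" "?\<eta>' 0 2 3" "?t' 0 1 1 (?\<eta>' 1 2 3)" "?\<eta>' 0 1 3" ?k]
    by (simp add: \<eta>3)
  then show "obstruction_cochain M H t \<eta> u = ?k"
    using obstruction_unique[OF pre' u, of ?k] k by simp
qed

end

section \<open>Comparison of pre-twisting pairs with the same outer action\<close>

context outer_act
begin

lemma obstruction_in: "pre_twisting_pair M H t \<eta> \<Longrightarrow> obstruction_cochain M H t \<eta> \<in> carrier (cochain_group M H 3)"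
  using obstruction_Z[of t \<eta>] unfolding cochain_carrier
  by (auto simp: PiE_iff obstruction_cochain_def extensional_def)

text \<open>Central factors can be collected in front of both sides of the cocycle condition, and
  their quotient is the inverse of \<delta>v.\<close>

lemma central_change:
  assumes pre: "pre_twisting_pair M H t \<eta>" and ind: "inducing t"
    and v: "v \<in> carrier (cochain_group M H 2)" "normalized M H v"
    and \<eta>': "\<And>u. u \<in> simplices H 2 \<Longrightarrow> \<eta>' u = v u \<cdot> \<eta> u"
  shows "pre_twisting_pair M H t \<eta>'"
    "u \<in> simplices H 3 \<Longrightarrow>
      obstruction_cochain M H t \<eta>' u \<cdot> codiff M H \<alpha> 2 v u = obstruction_cochain M H t \<eta> u"
proof -
  have vin: "v u \<in> ZSet M" if "u \<in> simplices H 2" for u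
    using v(1) that by (rule cochain_in)
  show pre': "pre_twisting_pair M H t \<eta>'"
    unfolding pre_twisting_pair_iff
    using pre v(2) vin by (auto simp: pre_twisting_pair_iff normalized_iff \<eta>' M.c_mult M.c_Z)
  assume u: "u \<in> simplices H 3"
  let ?t = "t (edge H 3 u 0 1)" and ?\<eta> = "\<lambda>i j k. \<eta> (oper H 3 [i, j, k] u)"
    and ?v = "\<lambda>i j k. v (oper H 3 [i, j, k] u)" and ?k = "obstruction_cochain M H t \<eta> u"
  let ?a = "act (edge H 3 u 0 1) (?v 1 2 3)"
  have t: "?t \<in> carrier A"
    using pre_twisting_pairD(1)[OF pre] u by simp
  have v3: "?v i j k \<in> ZSet M" if "i \<le> j" "j \<le> k" "k \<le> 3" for i j k
    using vin u that by (simp add: H.oper_in)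
  have \<eta>3: "\<eta>' (oper H 3 [i, j, k] u) = ?v i j k \<cdot> ?\<eta> i j k" if "i \<le> j" "j \<le> k" "k \<le> 3" for i j k
    using \<eta>' u that by (simp add: H.oper_in)
  note \<eta>in = pre_twisting_pair_3(1)[OF pre u]
  have k: "?k \<in> ZSet M"
    by (rule obstruction_Z[OF pre u])
  have a: "?a = ?t 1 (?v 1 2 3)" "?a \<in> ZSet M"
    using act_eq[OF ind, of "edge H 3 u 0 1" "?v 1 2 3"] u t v3 by simp_all
  \<comment> \<open>The values of \<open>v\<close> are arranged as those of \<eta> in \<kappa>; this
    is the inverse of \<delta>v.\<close>
  let ?w = "?v 0 1 2 \<cdot> ?v 0 2 3 \<cdot> inv\<^bsub>N\<^esub> ?v 0 1 3 \<cdot> inv\<^bsub>N\<^esub> ?a"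
  interpret Z: comm_group "ZGroup M" by (rule M.Z_comm_group)
  have w: "?w \<in> ZSet M" "?w \<cdot> (?a \<cdot> ?v 0 1 3) = ?v 0 1 2 \<cdot> ?v 0 2 3"
    "?w \<cdot> codiff M H \<alpha> 2 v u = \<one>\<^bsub>N\<^esub>"
  proof -
    show "?w \<in> ZSet M"
      using v3 a by simp
    show "?w \<cdot> (?a \<cdot> ?v 0 1 3) = ?v 0 1 2 \<cdot> ?v 0 2 3"
      using v3 a(2) by (simp add: M.N_simps)
    have "codiff M H \<alpha> 2 v u = ?a \<cdot> (?v 0 1 3 \<cdot> (inv\<^bsub>N\<^esub> ?v 0 2 3 \<cdot> inv\<^bsub>N\<^esub> ?v 0 1 2))"
      unfolding codiff_2[OF v(1) u] using v3 a(2) Z.m_lcomm[of "inv\<^bsub>N\<^esub> ?v 0 2 3" "?v 0 1 3" "inv\<^bsub>N\<^esub> ?v 0 1 2"] by simp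
    then show "?w \<cdot> codiff M H \<alpha> 2 v u = \<one>\<^bsub>N\<^esub>"
      using v3 a(2) by (simp add: M.N_simps)
  qed
  have "\<eta>' (oper H 3 [0, 1, 2] u) \<cdot> \<eta>' (oper H 3 [0, 2, 3] u) =
      (?v 0 1 2 \<cdot> ?v 0 2 3) \<cdot> (?\<eta> 0 1 2 \<cdot> ?\<eta> 0 2 3)"
    using v3 \<eta>in M.Z_mult_mult[of "?v 0 1 2" "?v 0 2 3" "?\<eta> 0 1 2" "?\<eta> 0 2 3"] by (simp add: \<eta>3)
  also have "?\<eta> 0 1 2 \<cdot> ?\<eta> 0 2 3 = ?k \<cdot> (?t 1 (?\<eta> 1 2 3) \<cdot> ?\<eta> 0 1 3)"
    using obstruction_unique[OF pre u, of ?k] k by simp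
  also have "(?v 0 1 2 \<cdot> ?v 0 2 3) \<cdot> (?k \<cdot> (?t 1 (?\<eta> 1 2 3) \<cdot> ?\<eta> 0 1 3)) =
      (?w \<cdot> ?k) \<cdot> ((?a \<cdot> ?v 0 1 3) \<cdot> (?t 1 (?\<eta> 1 2 3) \<cdot> ?\<eta> 0 1 3))"
  proof -
    have "(?w \<cdot> (?a \<cdot> ?v 0 1 3)) \<cdot> (?k \<cdot> (?t 1 (?\<eta> 1 2 3) \<cdot> ?\<eta> 0 1 3)) =
      (?w \<cdot> ?k) \<cdot> ((?a \<cdot> ?v 0 1 3) \<cdot> (?t 1 (?\<eta> 1 2 3) \<cdot> ?\<eta> 0 1 3))"
      by (rule M.Z_mult_mult) (use w(1) a(2) v3 k t \<eta>in in simp_all)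
    then show ?thesis unfolding w(2) .
  qed
  also have "\<dots> = (?w \<cdot> ?k) \<cdot> (?t 1 (\<eta>' (oper H 3 [1, 2, 3] u)) \<cdot> \<eta>' (oper H 3 [0, 1, 3] u))"
    using v3 \<eta>in t a(2) M.Z_mult_mult[of ?a "?v 0 1 3" "?t 1 (?\<eta> 1 2 3)" "?\<eta> 0 1 3"]
    by (simp add: \<eta>3 M.aut_N_mult a(1)[symmetric])
  finally have "obstruction_cochain M H t \<eta>' u = ?w \<cdot> ?k"
    using obstruction_unique[OF pre' u, of "?w \<cdot> ?k"] w(1) k by simp
  then show "obstruction_cochain M H t \<eta>' u \<cdot> codiff M H \<alpha> 2 v u = ?k"
    using M.Z_cancel[OF w(1) k M.Z_in[OF cochain_in[OF codiff_2_in[OF v(1)] u]] w(3)] by simp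
qed

text \<open>With the same \<open>t\<close>, the twisting relation determines c(\<eta>), so two
  choices of \<eta> differ by elements of the kernel.\<close>

lemma pre_twisting_pair_central_diff:
  assumes pre: "pre_twisting_pair M H t \<eta>" and pre': "pre_twisting_pair M H t \<eta>'"
  obtains v where "v \<in> carrier (cochain_group M H 2)" "normalized M H v"
    "\<And>u. u \<in> simplices H 2 \<Longrightarrow> \<eta> u = v u \<cdot> \<eta>' u"
proof
  define v where "v = (\<lambda>u\<in>simplices H 2. \<eta> u \<cdot> inv\<^bsub>N\<^esub> \<eta>' u)"
  have "\<eta> u \<cdot> inv\<^bsub>N\<^esub> \<eta>' u \<in> ZSet M" if u: "u \<in> simplices H 2" for u
  proof (rule M.ZI)
    have "c (\<eta> u) \<otimes>\<^bsub>A\<^esub> t (edge H 2 u 0 2) = c (\<eta>' u) \<otimes>\<^bsub>A\<^esub> t (edge H 2 u 0 2)"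
      using pre_twisting_pairD(4)[OF pre u] pre_twisting_pairD(4)[OF pre' u] by simp
    then have "c (\<eta> u) = c (\<eta>' u)"
      using pre_twisting_pairD(1)[OF pre] pre_twisting_pairD(2)[OF pre u] pre_twisting_pairD(2)[OF pre' u] u by simp
    then show "c (\<eta> u \<cdot> inv\<^bsub>N\<^esub> \<eta>' u) = \<one>\<^bsub>A\<^esub>"
      using pre_twisting_pairD(2)[OF pre u] pre_twisting_pairD(2)[OF pre' u] by (simp add: M.c_mult M.c_inv)
    show "\<eta> u \<cdot> inv\<^bsub>N\<^esub> \<eta>' u \<in> carrier N"
      using pre_twisting_pairD(2)[OF pre u] pre_twisting_pairD(2)[OF pre' u] by simp
  qed
  then show "v \<in> carrier (cochain_group M H 2)"
    by (auto simp: cochain_carrier v_def)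
  show "normalized M H v"
    using pre pre' by (simp add: normalized_iff v_def pre_twisting_pair_iff)
  show "\<eta> u = v u \<cdot> \<eta>' u" if u: "u \<in> simplices H 2" for u
    using pre_twisting_pairD(2)[OF pre u] pre_twisting_pairD(2)[OF pre' u] u by (simp add: v_def M.N.m_assoc)
qed

lemma inducing_differ_inner:
  assumes "pre_twisting_pair M H t \<eta>" "inducing t" "pre_twisting_pair M H t' \<eta>'" "inducing t'"
  obtains \<rho> where "\<And>g. g \<in> simplices H 1 \<Longrightarrow> \<rho> g \<in> carrier N \<and> t g = c (\<rho> g) \<otimes>\<^bsub>A\<^esub> t' g" "\<rho> (pg_one H) = \<one>\<^bsub>N\<^esub>"
proof -
  have "\<exists>n\<in>carrier N. t g = c n \<otimes>\<^bsub>A\<^esub> t' g" if g: "g \<in> simplices H 1" for g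
    using assms g by (simp add: M.out_class_eq_iff[symmetric] pre_twisting_pairD inducing_def)
  then obtain n where n: "\<And>g. g \<in> simplices H 1 \<Longrightarrow> n g \<in> carrier N \<and> t g = c (n g) \<otimes>\<^bsub>A\<^esub> t' g"
    by metis
  show thesis
    \<comment> \<open>Both \<open>t\<close> and \<open>t'\<close> are the identity at 1, so the
      chosen element can be replaced by 1 there.\<close>
    by (rule that[of "\<lambda>g. if g = pg_one H then \<one>\<^bsub>N\<^esub> else n g"])
      (use n pre_twisting_pairD(3)[OF assms(1)] pre_twisting_pairD(3)[OF assms(3)] in auto)
qed

text \<open>Any two choices are joined by a change along \<rho> followed by a central change. For
  arbitrary pairs this gives independence of the obstruction class; for twisting pairs
  \<open>v\<close> is a cocycle, which gives transitivity.\<close>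

lemma compare_pre_twisting_pairs:
  assumes "pre_twisting_pair M H t \<eta>" "inducing t" "pre_twisting_pair M H t' \<eta>'" "inducing t'"
  obtains \<rho> \<eta>'' v where "pre_twisting_pair M H t \<eta>''" "regauge M H t \<eta>'' t' \<eta>' \<rho>"
    "\<And>u. u \<in> simplices H 3 \<Longrightarrow> obstruction_cochain M H t \<eta>'' u = obstruction_cochain M H t' \<eta>' u"
    "v \<in> carrier (cochain_group M H 2)" "normalized M H v"
    "\<And>u. u \<in> simplices H 2 \<Longrightarrow> \<eta> u = v u \<cdot> \<eta>'' u"
    "\<And>u. u \<in> simplices H 3 \<Longrightarrow>
      obstruction_cochain M H t \<eta> u \<cdot> codiff M H \<alpha> 2 v u = obstruction_cochain M H t' \<eta>' u"
proof -
  obtain \<rho> where \<rho>: "\<And>g. g \<in> simplices H 1 \<Longrightarrow> \<rho> g \<in> carrier N \<and> t g = c (\<rho> g) \<otimes>\<^bsub>A\<^esub> t' g" "\<rho> (pg_one H) = \<one>\<^bsub>N\<^esub>"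
    using inducing_differ_inner[OF assms] by blast
  define \<eta>'' where "\<eta>'' u = \<rho> (edge H 2 u 0 1) \<cdot> t' (edge H 2 u 0 1) 1 (\<rho> (edge H 2 u 1 2)) \<cdot>
      \<eta>' u \<cdot> inv\<^bsub>N\<^esub> \<rho> (edge H 2 u 0 2)" for u
  note g = gauge_change[OF assms(3), of \<rho> t \<eta>'']
  have pre: "pre_twisting_pair M H t \<eta>''" and rg: "regauge M H t \<eta>'' t' \<eta>' \<rho>"
    and ob: "\<And>u. u \<in> simplices H 3 \<Longrightarrow> obstruction_cochain M H t \<eta>'' u = obstruction_cochain M H t' \<eta>' u"
    using g \<rho> \<eta>''_def by blast+
  obtain v where v: "v \<in> carrier (cochain_group M H 2)" "normalized M H v"
    "\<And>u. u \<in> simplices H 2 \<Longrightarrow> \<eta> u = v u \<cdot> \<eta>'' u"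
    using pre_twisting_pair_central_diff[OF assms(1) pre] by blast
  then show thesis
    using that[OF pre rg ob v] central_change(2)[OF pre assms(2) v] ob by simp
qed

lemma act_pg_one: "z \<in> ZSet M \<Longrightarrow> act (pg_one H) z = z"
  by (simp add: act_def \<alpha>_one M.one_Out M.out_act)

lemma oper_constant_2:
  assumes "g \<in> simplices H 1"
  shows "oper H 1 [1, 1, 1] g = oper H 1 [0, 0, 1] (pg_one H)" "oper H 1 [0, 0, 0] g = oper H 1 [0, 0, 1] (pg_one H)"
proof -
  have "pg_one H = oper H 1 [0, 0] g" "pg_one H = oper H 1 [1, 1] g"
    using H.edge_refl[OF assms, of 0] H.edge_refl[OF assms, of 1] by (simp_all add: edge_def)
  then show "oper H 1 [1, 1, 1] g = oper H 1 [0, 0, 1] (pg_one H)" "oper H 1 [0, 0, 0] g = oper H 1 [0, 0, 1] (pg_one H)"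
    using assms H.oper_oper[of "[0, 0]" 1 1 "[0, 0, 1]" 2 g] H.oper_oper[of "[1, 1]" 1 1 "[0, 0, 1]" 2 g]
    by (simp_all add: op_comp_def)
qed

lemma oper_3_degenerate:
  assumes "g \<in> simplices H 1" "\<theta> \<in> ops 3 1" "i \<le> j" "j \<le> k" "k \<le> 3"
  shows "oper H 3 [i, j, k] (oper H 1 \<theta> g) = oper H 1 [\<theta> ! i, \<theta> ! j, \<theta> ! k] g"
  using assms H.oper_oper[of \<theta> 3 1 "[i, j, k]" 2 g] by (simp add: op_comp_def)

text \<open>Only the values of \<delta>x on [g|1|1] and [1|1|g] enter. They are trivial when
  \<open>x\<close> is a cocycle and also when \<delta>x is an obstruction cochain, so one lemma
  serves both halves of the theorem.\<close>

lemma ex_normalized: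
  assumes x: "x \<in> carrier (cochain_group M H 2)"
    and deg: "\<And>g. g \<in> simplices H 1 \<Longrightarrow> codiff M H \<alpha> 2 x (oper H 1 [0, 1, 1, 1] g) = \<one>\<^bsub>N\<^esub>"
      "\<And>g. g \<in> simplices H 1 \<Longrightarrow> codiff M H \<alpha> 2 x (oper H 1 [0, 0, 0, 1] g) = \<one>\<^bsub>N\<^esub>"
  obtains y where "y \<in> carrier (cochain_group M H 1)"
    "normalized M H (codiff M H \<alpha> 1 y \<otimes>\<^bsub>cochain_group M H 2\<^esub> x)"
proof
  define e where "e = x (oper H 1 [0, 0, 1] (pg_one H))"
  \<comment> \<open>The condition on \<open>[g|1|1]\<close> and \<open>[1|1|g]\<close> forces \<open>x(g,1) = g e\<close> and \<open>x(1,g) = e\<close>: the coboundary of the constant \<open>e\<close>.\<close>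
  define y where "y = (\<lambda>g\<in>simplices H 1. inv\<^bsub>N\<^esub> e)"
  have e: "e \<in> ZSet M"
    using cochain_in[OF x] by (simp add: e_def)
  show y: "y \<in> carrier (cochain_group M H 1)"
    using e by (auto simp: cochain_carrier y_def)
  have y_eq: "y g = inv\<^bsub>N\<^esub> e" if "g \<in> simplices H 1" for g
    using that by (simp add: y_def)
  have dy: "codiff M H \<alpha> 1 y u = inv\<^bsub>N\<^esub> act (edge H 2 u 0 1) e" if u: "u \<in> simplices H 2" for u
    using e u by (simp add: codiff_1[OF y u] y_eq act_inv)
  have "x (oper H 1 [0, 1, 1] g) = act g e" if g: "g \<in> simplices H 1" for g
  proof -
    have xs: "x (oper H 1 [0, 1, 1] g) \<in> ZSet M"
      using cochain_in[OF x] g by simp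
    have u: "oper H 1 [0, 1, 1, 1] g \<in> simplices H 3"
      using g by (simp add: H.oper_in)
    have "act g e \<cdot> inv\<^bsub>N\<^esub> x (oper H 1 [0, 1, 1] g) = \<one>\<^bsub>N\<^esub>"
      using deg(1)[OF g] xs e g codiff_2[OF x u] oper_constant_2[OF g]
      by (simp add: e_def M.N_simps oper_3_degenerate H.edge_oper)
    then show ?thesis
      using xs e g by (simp add: M.N.inv_solve_right')
  qed
  moreover have "x (oper H 1 [0, 0, 1] g) = e" if g: "g \<in> simplices H 1" for g
  proof -
    have xs: "x (oper H 1 [0, 0, 1] g) \<in> ZSet M"
      using cochain_in[OF x] g by simp
    have u: "oper H 1 [0, 0, 0, 1] g \<in> simplices H 3"
      using g by (simp add: H.oper_in)
    have "x (oper H 1 [0, 0, 1] g) \<cdot> inv\<^bsub>N\<^esub> e = \<one>\<^bsub>N\<^esub>"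
      using deg(2)[OF g] xs e g codiff_2[OF x u] oper_constant_2[OF g]
      by (simp add: e_def M.N_simps act_pg_one oper_3_degenerate H.edge_oper)
    then show ?thesis
      using xs e g by (simp add: M.N.inv_solve_right')
  qed
  ultimately show "normalized M H (codiff M H \<alpha> 1 y \<otimes>\<^bsub>cochain_group M H 2\<^esub> x)"
    using e by (simp add: normalized_iff cochain_mult dy H.edge_s0 H.edge_s1 act_pg_one)
qed

lemma obstruction_degenerate:
  assumes "pre_twisting_pair M H t \<eta>" "g \<in> simplices H 1"
  shows "obstruction_cochain M H t \<eta> (oper H 1 [0, 1, 1, 1] g) = \<one>\<^bsub>N\<^esub>"
    "obstruction_cochain M H t \<eta> (oper H 1 [0, 0, 0, 1] g) = \<one>\<^bsub>N\<^esub>"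
proof -
  have "\<eta> (oper H 1 [0, 0, 1] h) = \<one>\<^bsub>N\<^esub>" "\<eta> (oper H 1 [0, 1, 1] h) = \<one>\<^bsub>N\<^esub>" if "h \<in> simplices H 1" for h
    using assms(1) that by (simp_all add: pre_twisting_pair_iff)
  then show "obstruction_cochain M H t \<eta> (oper H 1 [0, 1, 1, 1] g) = \<one>\<^bsub>N\<^esub>"
    "obstruction_cochain M H t \<eta> (oper H 1 [0, 0, 0, 1] g) = \<one>\<^bsub>N\<^esub>"
    using assms pre_twisting_pairD(1,3)[OF assms(1)]
    by (simp_all add: obstruction_eq H.oper_in H.edge_oper oper_3_degenerate oper_constant_2)
qed

end

section \<open>Classification of extensions\<close>

text \<open>Each map is bijective because the inverse group element acts as its inverse;
  extensionality then places it in the group of bijections.\<close>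

lemma group_actionI:
  fixes G (structure)
  assumes G: "group G"
    and ext: "\<And>g. g \<in> carrier G \<Longrightarrow> \<phi> g \<in> extensional E"
    and closed: "\<And>g x. g \<in> carrier G \<Longrightarrow> x \<in> E \<Longrightarrow> \<phi> g x \<in> E"
    and mult: "\<And>g h x. g \<in> carrier G \<Longrightarrow> h \<in> carrier G \<Longrightarrow> x \<in> E \<Longrightarrow> \<phi> (g \<otimes> h) x = \<phi> g (\<phi> h x)"
    and one: "\<And>x. x \<in> E \<Longrightarrow> \<phi> \<one> x = x"
  shows "group_action G E \<phi>"
proof -
  interpret group G by (rule G)
  have inv: "\<phi> g (\<phi> (inv g) x) = x" "\<phi> (inv g) (\<phi> g x) = x" if "g \<in> carrier G" "x \<in> E" for g x
    using mult[of g "inv g" x] mult[of "inv g" g x] one that by simp_all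
  have bij: "\<phi> g \<in> Bij E" if g: "g \<in> carrier G" for g
  proof -
    have "bij_betw (\<phi> g) E E"
      by (rule bij_betw_byWitness[where f' = "\<phi> (inv g)"]) (use inv closed g in auto)
    then show ?thesis using ext g by (simp add: Bij_def)
  qed
  have "\<phi> (g \<otimes> h) = compose E (\<phi> g) (\<phi> h)" if "g \<in> carrier G" "h \<in> carrier G" for g h
    by (rule extensionalityI[of _ E]) (use that ext mult in \<open>auto simp: compose_def\<close>)
  then show ?thesis
    unfolding group_action_def group_hom_def group_hom_axioms_def hom_def
    using G group_BijGroup bij by (auto simp: BijGroup_def)
qed

context outer_act
begin

section \<open>Cohomology classes in degrees 2 and 3\<close>

lemma coboundaries_2: "coboundaries M H \<alpha> 2 = codiff M H \<alpha> 1 ` carrier (cochain_group M H 1)"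
  by (simp add: coboundaries_def numeral_2_eq_2 One_nat_def)

lemma coboundaries_3: "coboundaries M H \<alpha> 3 = codiff M H \<alpha> 2 ` carrier (cochain_group M H 2)"
  by (simp add: coboundaries_def numeral_3_eq_3 numeral_2_eq_2)

lemma coboundaries_2_subgroup: "subgroup (coboundaries M H \<alpha> 2) (cochain_group M H 2)"
  unfolding coboundaries_2 by (rule group_hom.img_is_subgroup[OF codiff_1_hom])

lemma coboundaries_3_subgroup: "subgroup (coboundaries M H \<alpha> 3) (cochain_group M H 3)"
  unfolding coboundaries_3 by (rule group_hom.img_is_subgroup[OF codiff_2_hom])

text \<open>Restricting the carrier to cocycles does not change the multiplication, so the cosets
  can be formed in the ambient cochain group.\<close>

lemma cohomology_class_eq: "cohomology_class M H \<alpha> n x = coboundaries M H \<alpha> n #>\<^bsub>cochain_group M H n\<^esub> x"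
  by (simp add: cohomology_class_def cocycle_group_def)

lemma obstruction_class_eq:
  assumes pre: "pre_twisting_pair M H t \<eta>" and ind: "inducing t"
  shows "obstruction_class M H \<alpha> = coboundaries M H \<alpha> 3 #>\<^bsub>cochain_group M H 3\<^esub> obstruction_cochain M H t \<eta>"
  unfolding obstruction_class_def
proof (rule the_equality)
  let ?C = "cochain_group M H 3" and ?B = "coboundaries M H \<alpha> 3" and ?k = "obstruction_cochain M H t \<eta>"
  show "\<exists>t' \<eta>'. pre_twisting_pair M H t' \<eta>' \<and> (\<forall>g\<in>simplices H 1. \<alpha> 1 g = [out_class M (t' g)]) \<and>
      ?B #>\<^bsub>?C\<^esub> ?k = cohomology_class M H \<alpha> 3 (obstruction_cochain M H t' \<eta>')"
    using pre ind unfolding cohomology_class_eq inducing_def by blast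
  fix K assume "\<exists>t' \<eta>'. pre_twisting_pair M H t' \<eta>' \<and> (\<forall>g\<in>simplices H 1. \<alpha> 1 g = [out_class M (t' g)]) \<and>
      K = cohomology_class M H \<alpha> 3 (obstruction_cochain M H t' \<eta>')"
  then obtain t' \<eta>' where pre': "pre_twisting_pair M H t' \<eta>'" and ind': "inducing t'"
    and K: "K = ?B #>\<^bsub>?C\<^esub> obstruction_cochain M H t' \<eta>'"
    unfolding cohomology_class_eq inducing_def by blast
  let ?k' = "obstruction_cochain M H t' \<eta>'"
  interpret C: comm_group ?C by (rule cochain_comm_group)
  obtain v where v: "v \<in> carrier (cochain_group M H 2)"
    "\<And>u. u \<in> simplices H 3 \<Longrightarrow> ?k u \<cdot> codiff M H \<alpha> 2 v u = ?k' u"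
    using compare_pre_twisting_pairs[OF pre ind pre' ind'] by metis
  have k: "?k \<in> carrier ?C" "?k' \<in> carrier ?C"
    using obstruction_in pre pre' by blast+
  note dv = codiff_2_in[OF v(1)]
  have "?k' = codiff M H \<alpha> 2 v \<otimes>\<^bsub>?C\<^esub> ?k"
  proof (rule cochain_eqI[OF k(2) C.m_closed[OF dv k(1)]])
    fix u assume u: "u \<in> simplices H 3"
    show "?k' u = (codiff M H \<alpha> 2 v \<otimes>\<^bsub>?C\<^esub> ?k) u"
      using v(2)[OF u] u M.Z_central[of "?k u" "codiff M H \<alpha> 2 v u"] cochain_in[OF k(1) u] cochain_in[OF dv u]
      by (simp add: cochain_mult)
  qed
  then have "?k' \<in> ?B #>\<^bsub>?C\<^esub> ?k"
    using C.rcosI[of "codiff M H \<alpha> 2 v" ?B ?k] subgroup.subset[OF coboundaries_3_subgroup] v(1) k(1)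
    by (simp add: coboundaries_3)
  then show "K = ?B #>\<^bsub>?C\<^esub> ?k"
    using C.repr_independence[OF _ k(1) coboundaries_3_subgroup] K by simp
qed

text \<open>If \<kappa> = \<delta>v with \<open>v\<close> normalized, multiplying \<eta> by
  \<open>v\<close> divides \<kappa> by \<delta>v and leaves 1. Conversely, a twisting pair is itself
  an admissible choice, and its \<kappa> is trivial.\<close>

lemma obstruction_class_one_iff:
  "obstruction_class M H \<alpha> = \<one>\<^bsub>cohomology M H \<alpha> 3\<^esub> \<longleftrightarrow> (\<exists>t \<eta>. twisting_pair M H t \<eta> \<and> inducing t)"
proof -
  let ?C = "cochain_group M H 3" and ?B = "coboundaries M H \<alpha> 3"
  interpret C: comm_group ?C by (rule cochain_comm_group)
  have one: "\<one>\<^bsub>cohomology M H \<alpha> 3\<^esub> = ?B"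
    by (simp add: cohomology_def)
  show ?thesis
  proof
    assume "obstruction_class M H \<alpha> = \<one>\<^bsub>cohomology M H \<alpha> 3\<^esub>"
    obtain t \<eta> where pre: "pre_twisting_pair M H t \<eta>" and ind: "inducing t"
      using ex_pre_twisting_pair by blast
    have "obstruction_cochain M H t \<eta> \<in> ?B"
      using C.rcos_self[OF obstruction_in[OF pre] coboundaries_3_subgroup] obstruction_class_eq[OF pre ind]
        \<open>obstruction_class M H \<alpha> = _\<close> one by simp
    then obtain x where x: "x \<in> carrier (cochain_group M H 2)" "obstruction_cochain M H t \<eta> = codiff M H \<alpha> 2 x"
      by (auto simp: coboundaries_3)
    obtain y where y: "y \<in> carrier (cochain_group M H 1)"
      "normalized M H (codiff M H \<alpha> 1 y \<otimes>\<^bsub>cochain_group M H 2\<^esub> x)"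
      using ex_normalized[OF x(1)] obstruction_degenerate[OF pre] unfolding x(2) by blast
    \<comment> \<open>Adding a coboundary normalizes \<open>x\<close> without changing its
      differential, because \<delta>\<delta> is trivial.\<close>
    define v where "v = codiff M H \<alpha> 1 y \<otimes>\<^bsub>cochain_group M H 2\<^esub> x"
    interpret D: comm_group "cochain_group M H 2" by (rule cochain_comm_group)
    have v: "v \<in> carrier (cochain_group M H 2)" "codiff M H \<alpha> 2 v = codiff M H \<alpha> 2 x"
      using codiff_1_in[OF y(1)] x(1) codiff_2_in[OF x(1)] codiff_codiff[OF y(1)]
      by (simp_all add: v_def group_hom.hom_mult[OF codiff_2_hom])
    define \<eta>' where "\<eta>' u = v u \<cdot> \<eta> u" for u
    note cc = central_change[OF pre ind v(1) y(2)[folded v_def], of \<eta>']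
    have pre': "pre_twisting_pair M H t \<eta>'"
      by (rule cc(1)) (simp add: \<eta>'_def)
    have "obstruction_cochain M H t \<eta>' u = \<one>\<^bsub>N\<^esub>" if u: "u \<in> simplices H 3" for u
    proof -
      have "obstruction_cochain M H t \<eta>' u \<cdot> codiff M H \<alpha> 2 v u = codiff M H \<alpha> 2 v u"
        using cc(2)[OF _ u] x(2) v(2) by (simp add: \<eta>'_def)
      then show ?thesis
        using M.N.r_cancel_one cochain_in[OF codiff_2_in[OF v(1)] u] obstruction_Z[OF pre' u] M.Z_in by metis
    qed
    then show "\<exists>t \<eta>. twisting_pair M H t \<eta> \<and> inducing t"
      using pre' ind obstruction_one_iff by blast
  next
    assume "\<exists>t \<eta>. twisting_pair M H t \<eta> \<and> inducing t"
    then obtain t \<eta> where tw: "twisting_pair M H t \<eta>" and ind: "inducing t" by blast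
    then have pre: "pre_twisting_pair M H t \<eta>"
      using obstruction_one_iff by blast
    have "obstruction_cochain M H t \<eta> = \<one>\<^bsub>?C\<^esub>"
      by (rule cochain_eqI[OF obstruction_in[OF pre] C.one_closed]) (use tw in \<open>simp_all add: obstruction_one_iff cochain_one\<close>)
    then show "obstruction_class M H \<alpha> = \<one>\<^bsub>cohomology M H \<alpha> 3\<^esub>"
      unfolding obstruction_class_eq[OF pre ind] one
      using C.coset_mult_one subgroup.subset[OF coboundaries_3_subgroup] by simp
  qed
qed

lemma cocycles_2: "cocycles M H \<alpha> 2 = kernel (cochain_group M H 2) (cochain_group M H 3) (codiff M H \<alpha> 2)"
proof -
  have "Suc 2 = (3 :: nat)" by simp
  then show ?thesis by (simp only: cocycles_def kernel_def)
qed

lemma cocycles_2_subgroup: "subgroup (cocycles M H \<alpha> 2) (cochain_group M H 2)"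
  unfolding cocycles_2 by (rule group_hom.subgroup_kernel[OF codiff_2_hom])

lemma cocyclesD: "v \<in> cocycles M H \<alpha> 2 \<Longrightarrow> v \<in> carrier (cochain_group M H 2)"
    "v \<in> cocycles M H \<alpha> 2 \<Longrightarrow> u \<in> simplices H 3 \<Longrightarrow> codiff M H \<alpha> 2 v u = \<one>\<^bsub>N\<^esub>"
  by (simp_all add: cocycles_2 kernel_def cochain_one)

lemma carrier_cocycle_group: "carrier (cocycle_group M H \<alpha> 2) = cocycles M H \<alpha> 2"
  and mult_cocycle_group: "mult (cocycle_group M H \<alpha> 2) = mult (cochain_group M H 2)"
  by (simp_all add: cocycle_group_def)

lemma cocycle_comm_group: "comm_group (cocycle_group M H \<alpha> 2)"
proof (rule group.group_comm_groupI)
  interpret D: comm_group "cochain_group M H 2" by (rule cochain_comm_group)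
  show "group (cocycle_group M H \<alpha> 2)"
    using subgroup.subgroup_is_group[OF cocycles_2_subgroup D.is_group] by (simp add: cocycle_group_def)
  show "x \<otimes>\<^bsub>cocycle_group M H \<alpha> 2\<^esub> y = y \<otimes>\<^bsub>cocycle_group M H \<alpha> 2\<^esub> x"
    if "x \<in> carrier (cocycle_group M H \<alpha> 2)" "y \<in> carrier (cocycle_group M H \<alpha> 2)" for x y
    using that D.m_comm cocyclesD(1) by (simp add: carrier_cocycle_group mult_cocycle_group)
qed

lemma coboundaries_subgroup_cocycle: "subgroup (coboundaries M H \<alpha> 2) (cocycle_group M H \<alpha> 2)"
proof -
  interpret D: comm_group "cochain_group M H 2" by (rule cochain_comm_group)
  have "coboundaries M H \<alpha> 2 \<subseteq> cocycles M H \<alpha> 2"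
    using codiff_1_in codiff_codiff by (auto simp: coboundaries_2 cocycles_2 kernel_def)
  then show ?thesis
    unfolding cocycle_group_def by (rule D.subgroup_incl[OF coboundaries_2_subgroup cocycles_2_subgroup])
qed

lemma coboundaries_normal: "coboundaries M H \<alpha> 2 \<lhd> cocycle_group M H \<alpha> 2"
  by (rule comm_group.subgroup_imp_normal[OF cocycle_comm_group coboundaries_subgroup_cocycle])

lemma cohomology_group: "group (cohomology M H \<alpha> 2)"
  unfolding cohomology_def by (rule normal.factorgroup_is_group[OF coboundaries_normal])

lemma cohomology_one: "\<one>\<^bsub>cohomology M H \<alpha> 2\<^esub> = coboundaries M H \<alpha> 2"
  by (simp add: cohomology_def)

lemma cohomologyE:
  assumes "V \<in> carrier (cohomology M H \<alpha> 2)"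
  obtains v where "v \<in> cocycles M H \<alpha> 2" "V = coboundaries M H \<alpha> 2 #>\<^bsub>cocycle_group M H \<alpha> 2\<^esub> v"
  using assms by (auto simp: cohomology_def carrier_FactGroup carrier_cocycle_group)

lemma cohomologyI: "v \<in> cocycles M H \<alpha> 2 \<Longrightarrow>
    coboundaries M H \<alpha> 2 #>\<^bsub>cocycle_group M H \<alpha> 2\<^esub> v \<in> carrier (cohomology M H \<alpha> 2)"
  by (auto simp: cohomology_def carrier_FactGroup carrier_cocycle_group)

lemma cohomology_coset:
  assumes V: "V \<in> carrier (cohomology M H \<alpha> 2)" and v: "v \<in> V"
  shows "V = coboundaries M H \<alpha> 2 #>\<^bsub>cocycle_group M H \<alpha> 2\<^esub> v" "v \<in> cocycles M H \<alpha> 2"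
proof -
  interpret G: comm_group "cocycle_group M H \<alpha> 2" by (rule cocycle_comm_group)
  obtain w where w: "w \<in> cocycles M H \<alpha> 2" "V = coboundaries M H \<alpha> 2 #>\<^bsub>cocycle_group M H \<alpha> 2\<^esub> w"
    using cohomologyE[OF V] .
  show "V = coboundaries M H \<alpha> 2 #>\<^bsub>cocycle_group M H \<alpha> 2\<^esub> v"
    using G.repr_independence[of v _ w] coboundaries_subgroup_cocycle w v by (simp add: carrier_cocycle_group)
  show "v \<in> cocycles M H \<alpha> 2"
    using G.r_coset_subset_G[OF subgroup.subset[OF coboundaries_subgroup_cocycle], of w] w v
    by (auto simp: carrier_cocycle_group)
qed

lemma cohomology_diff:
  assumes "V \<in> carrier (cohomology M H \<alpha> 2)" "v \<in> V" "w \<in> V"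
  obtains x where "x \<in> carrier (cochain_group M H 1)"
    "\<And>u. u \<in> simplices H 2 \<Longrightarrow> v u = codiff M H \<alpha> 1 x u \<cdot> w u"
proof -
  have "v \<in> coboundaries M H \<alpha> 2 #>\<^bsub>cocycle_group M H \<alpha> 2\<^esub> w"
    using cohomology_coset(1)[OF assms(1,3)] assms(2) by simp
  then obtain x where "x \<in> carrier (cochain_group M H 1)" "v = codiff M H \<alpha> 1 x \<otimes>\<^bsub>cochain_group M H 2\<^esub> w"
    by (auto simp: r_coset_def coboundaries_2 mult_cocycle_group)
  then show thesis using that by (simp add: cochain_mult)
qed

lemma cohomology_normalized:
  assumes V: "V \<in> carrier (cohomology M H \<alpha> 2)"
  obtains v where "v \<in> V" "normalized M H v"
proof -
  obtain w where w: "w \<in> cocycles M H \<alpha> 2" "V = coboundaries M H \<alpha> 2 #>\<^bsub>cocycle_group M H \<alpha> 2\<^esub> w"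
    using cohomologyE[OF V] .
  have "codiff M H \<alpha> 2 w (oper H 1 [0, 1, 1, 1] g) = \<one>\<^bsub>N\<^esub>" "codiff M H \<alpha> 2 w (oper H 1 [0, 0, 0, 1] g) = \<one>\<^bsub>N\<^esub>"
    if "g \<in> simplices H 1" for g
    using cocyclesD(2)[OF w(1)] that by (simp_all add: H.oper_in)
  then obtain y where y: "y \<in> carrier (cochain_group M H 1)"
      "normalized M H (codiff M H \<alpha> 1 y \<otimes>\<^bsub>cochain_group M H 2\<^esub> w)"
    using ex_normalized[OF cocyclesD(1)[OF w(1)]] by blast
  have "codiff M H \<alpha> 1 y \<otimes>\<^bsub>cochain_group M H 2\<^esub> w \<in> V"
    unfolding w(2) r_coset_def mult_cocycle_group coboundaries_2 using y(1) by blast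
  then show thesis using that y(2) by blast
qed

lemma twisting_change:
  assumes tw: "twisting_pair M H t \<eta>" and ind: "inducing t"
    and v: "v \<in> cocycles M H \<alpha> 2" "normalized M H v"
    and \<eta>': "\<And>u. u \<in> simplices H 2 \<Longrightarrow> \<eta>' u = v u \<cdot> \<eta> u"
  shows "twisting_pair M H t \<eta>'"
proof -
  have pre: "pre_twisting_pair M H t \<eta>"
    using tw obstruction_one_iff by blast
  note cc = central_change[OF pre ind cocyclesD(1)[OF v(1)] v(2) \<eta>']
  have "obstruction_cochain M H t \<eta>' u = \<one>\<^bsub>N\<^esub>" if u: "u \<in> simplices H 3" for u
    using cc(2)[OF _ u] tw cocyclesD(2)[OF v(1) u] obstruction_Z[OF cc(1) u] u
    by (simp add: obstruction_one_iff)
  then show ?thesis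
    using cc(1) obstruction_one_iff by blast
qed

end

section \<open>Equivalence classes of extensions and the action on them\<close>

locale outer_act_enc = outer_act M H \<alpha>
  for M :: "'m sset" and H :: "'h sset" and \<alpha> +
  fixes enc :: "('m \<times> 'h) list \<Rightarrow> 'e"
  assumes inj_enc: "inj enc"
begin

abbreviation cls :: "('h \<Rightarrow> nat \<Rightarrow> 'm \<Rightarrow> 'm) \<Rightarrow> ('h \<Rightarrow> 'm) \<Rightarrow> ('m, 'h, 'e) ext set" where
  "cls \<equiv> tw_class M H"

abbreviation E :: "('m, 'h, 'e) ext set set" where
  "E \<equiv> ext_classes M H \<alpha>"

lemma twistingI: "twisting_pair M H t \<eta> \<Longrightarrow> twisting M H t \<eta>"
  by (intro twisting.intro twisting_axioms.intro pg_pair_axioms)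

lemma ex_extension:
  assumes "twisting_pair M H t \<eta>"
  obtains X :: "('m, 'h, 'e) ext" where "extension M H X" "ext_equiv M H X (tw_ext M H t \<eta>)"
  using enc_ext[OF inj_enc twisting.extension_tw_ext[OF twistingI[OF assms]] M.simplicial_set] by blast

text \<open>From left to right a member of the class is required, since equality of two empty
  classes would say nothing; the encoded copy of the twisted product is one.\<close>

lemma tw_class_eq_iff:
  assumes tw: "twisting_pair M H t \<eta>" and tw': "twisting_pair M H t' \<eta>'"
  shows "cls t \<eta> = cls t' \<eta>' \<longleftrightarrow> (\<exists>\<rho>. regauge M H t \<eta> t' \<eta>' \<rho>)"
proof -
  interpret two: twisting_two M H t \<eta> t' \<eta>'
    by (intro twisting_two.intro twistingI tw tw')
  show ?thesis
  proof
    assume eq: "cls t \<eta> = cls t' \<eta>'"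
    obtain X :: "('m, 'h, 'e) ext" where X: "extension M H X" "ext_equiv M H X (tw_ext M H t \<eta>)"
      using ex_extension[OF tw] .
    then have "X \<in> cls t' \<eta>'"
      using eq by (auto simp: tw_class_def)
    then have "ext_equiv M H X (tw_ext M H t' \<eta>')"
      by (simp add: tw_class_def)
    then have "ext_equiv M H (tw_ext M H t \<eta>) (tw_ext M H t' \<eta>')"
      using ext_equiv_trans[OF ext_equiv_sym[OF X(2,1)]] by blast
    then show "\<exists>\<rho>. regauge M H t \<eta> t' \<eta>' \<rho>"
      using two.ext_equiv_regauge by blast
  next
    assume "\<exists>\<rho>. regauge M H t \<eta> t' \<eta>' \<rho>"
    then have *: "ext_equiv M H (tw_ext M H t \<eta>) (tw_ext M H t' \<eta>')"
      using two.regauge_ext_equiv by blast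
    show "cls t \<eta> = cls t' \<eta>'"
      using ext_equiv_trans[OF _ *] ext_equiv_trans[OF _ ext_equiv_sym[OF * two.T.extension_tw_ext]]
      by (auto simp: tw_class_def)
  qed
qed

text \<open>Twisting pairs are total functions on the type of simplices, so pointwise equality on
  the 2-simplices of \<open>H\<close> is weaker than equality. The trivial \<rho> relates the two
  pairs.\<close>

lemma tw_class_cong:
  assumes tw: "twisting_pair M H t \<eta>" and tw': "twisting_pair M H t \<eta>'"
    and eq: "\<And>u. u \<in> simplices H 2 \<Longrightarrow> \<eta> u = \<eta>' u"
  shows "cls t \<eta> = cls t \<eta>'"
proof -
  have pre: "pre_twisting_pair M H t \<eta>'"
    using tw' by (simp add: twisting_pair_def)
  have "regauge M H t \<eta> t \<eta>' (\<lambda>_. \<one>\<^bsub>N\<^esub>)"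
    using pre_twisting_pairD(1,2)[OF pre] eq by (simp add: regauge_def)
  then show ?thesis
    using tw_class_eq_iff[OF tw tw'] by blast
qed

lemma ext_classes_eq: "E = {cls t \<eta> | t \<eta>. twisting_pair M H t \<eta> \<and> inducing t}"
proof -
  let ?r = "{(X, Y). extension M H X \<and> extension M H Y \<and> ext_equiv M H X Y} :: (('m, 'h, 'e) ext \<times> _) set"
  have *: "?r `` {X} = cls t \<eta>"
    if X: "extension M H X" "ext_equiv M H X (tw_ext M H t \<eta>)" for X :: "('m, 'h, 'e) ext" and t \<eta>
    using X ext_equiv_trans[OF ext_equiv_sym[OF _ X(1)] X(2)] ext_equiv_trans[OF X(2) ext_equiv_sym]
    by (auto simp: tw_class_def)
  have ind: "induces_outer_action M H X \<alpha> \<longleftrightarrow>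
      (\<exists>t \<eta>. twisting_pair M H t \<eta> \<and> ext_equiv M H X (tw_ext M H t \<eta>) \<and> inducing t)" for X :: "('m, 'h, 'e) ext"
    by (simp add: induces_outer_action_def inducing_spine)
  show ?thesis
  proof (intro Set.set_eqI iffI)
    fix C assume "C \<in> E"
    then obtain X where X: "extension M H X" "induces_outer_action M H X \<alpha>" "C = ?r `` {X}"
      unfolding ext_classes_def by (auto elim: quotientE)
    then show "C \<in> {cls t \<eta> | t \<eta>. twisting_pair M H t \<eta> \<and> inducing t}"
      using ind * by blast
  next
    fix C assume "C \<in> {cls t \<eta> | t \<eta>. twisting_pair M H t \<eta> \<and> inducing t}"
    then obtain t \<eta> where t: "C = cls t \<eta>" "twisting_pair M H t \<eta>" "inducing t" by blast
    obtain X :: "('m, 'h, 'e) ext" where X: "extension M H X" "ext_equiv M H X (tw_ext M H t \<eta>)"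
      using ex_extension[OF t(2)] .
    have "X \<in> {X. extension M H X \<and> induces_outer_action M H X \<alpha>}"
      using X t ind by blast
    then have "?r `` {X} \<in> E"
      unfolding ext_classes_def by (rule quotientI)
    then show "C \<in> E"
      using *[OF X] t(1) by simp
  qed
qed

text \<open>The description in \<open>ext_action\<close> has a unique value. If \<rho> relates the
  two twisting pairs and \<open>v\<close>, \<open>v1\<close> differ by \<delta>x, then the modified
  pairs are related by the product of \<open>x\<close> and \<rho>.\<close>

lemma ext_action_cls:
  assumes tw: "twisting_pair M H t \<eta>" and ind: "inducing t"
    and V: "V \<in> carrier (cohomology M H \<alpha> 2)" and v: "v \<in> V" "normalized M H v"
  shows "ext_action M H \<alpha> V (cls t \<eta>) = cls t (\<lambda>u. v u \<cdot> \<eta> u)"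
proof -
  have C: "cls t \<eta> \<in> E"
    using tw ind ext_classes_eq by blast
  have "(THE D. \<exists>t1 \<eta>1 v1. twisting_pair M H t1 \<eta>1 \<and> cls t \<eta> = cls t1 \<eta>1 \<and>
        v1 \<in> V \<and> normalized M H v1 \<and> D = cls t1 (\<lambda>u. v1 u \<cdot> \<eta>1 u)) = cls t (\<lambda>u. v u \<cdot> \<eta> u)"
  proof (rule the_equality)
    show "\<exists>t1 \<eta>1 v1. twisting_pair M H t1 \<eta>1 \<and> cls t \<eta> = cls t1 \<eta>1 \<and>
        v1 \<in> V \<and> normalized M H v1 \<and> cls t (\<lambda>u. v u \<cdot> \<eta> u) = cls t1 (\<lambda>u. v1 u \<cdot> \<eta>1 u)"
      using tw v by blast
    fix D assume "\<exists>t1 \<eta>1 v1. twisting_pair M H t1 \<eta>1 \<and> cls t \<eta> = cls t1 \<eta>1 \<and>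
        v1 \<in> V \<and> normalized M H v1 \<and> D = cls t1 (\<lambda>u. v1 u \<cdot> \<eta>1 u)"
    then obtain t1 \<eta>1 v1 where 1: "twisting_pair M H t1 \<eta>1" "cls t \<eta> = cls t1 \<eta>1"
        "v1 \<in> V" "normalized M H v1" "D = cls t1 (\<lambda>u. v1 u \<cdot> \<eta>1 u)" by blast
    obtain \<rho> where rg: "regauge M H t \<eta> t1 \<eta>1 \<rho>"
      using 1(2) tw_class_eq_iff[OF tw 1(1)] by blast
    have pre: "pre_twisting_pair M H t \<eta>" and pre1: "pre_twisting_pair M H t1 \<eta>1"
      using tw 1(1) by (simp_all add: twisting_pair_def)
    have \<rho>: "\<rho> g \<in> carrier N" "t g = c (\<rho> g) \<otimes>\<^bsub>A\<^esub> t1 g" if "g \<in> simplices H 1" for g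
      using rg that by (auto simp: regauge_def)
    have ind1: "inducing t1"
    proof -
      have "out_class M (t g) = out_class M (t1 g)" if "g \<in> simplices H 1" for g
        using M.out_class_eq_iff[of "t g" "t1 g"] pre_twisting_pairD(1)[OF pre that] pre_twisting_pairD(1)[OF pre1 that] \<rho>[OF that] by blast
      then show ?thesis using ind by (simp add: inducing_def)
    qed
    obtain x where x: "x \<in> carrier (cochain_group M H 1)"
      "\<And>u. u \<in> simplices H 2 \<Longrightarrow> v u = codiff M H \<alpha> 1 x u \<cdot> v1 u"
      using cohomology_diff[OF V v(1) 1(3)] by blast
    have vc: "v \<in> cocycles M H \<alpha> 2" and v1c: "v1 \<in> cocycles M H \<alpha> 2"
      using cohomology_coset(2)[OF V] v 1(3) by blast+
    note vin = cochain_in[OF cocyclesD(1)[OF vc]] and v1in = cochain_in[OF cocyclesD(1)[OF v1c]]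
      and xin = cochain_in[OF x(1)]
    \<comment> \<open>At [1|1] the coboundary of \<open>x\<close> equals x(1), and both
      \<open>v\<close> and \<open>v1\<close> are normalized there. \<open>regauge\<close> demands
      this value at the unit.\<close>
    have x1: "x (pg_one H) = \<one>\<^bsub>N\<^esub>"
    proof -
      let ?e = "oper H 1 [0, 0, 1] (pg_one H)"
      have e: "?e \<in> simplices H 2" by simp
      have "v ?e = \<one>\<^bsub>N\<^esub>" "v1 ?e = \<one>\<^bsub>N\<^esub>"
        using v(2) 1(4) by (simp_all add: normalized_iff)
      then show ?thesis
        using x(2)[OF e] codiff_1[OF x(1) e] xin[of "pg_one H"]
        by (simp add: H.edge_s0 act_pg_one)
    qed
    have tw_v: "twisting_pair M H t (\<lambda>u. v u \<cdot> \<eta> u)"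
      by (rule twisting_change[OF tw ind vc v(2)]) simp
    have tw_v1: "twisting_pair M H t1 (\<lambda>u. v1 u \<cdot> \<eta>1 u)"
      by (rule twisting_change[OF 1(1) ind1 v1c 1(4)]) simp
    have "regauge M H t (\<lambda>u. v u \<cdot> \<eta> u) t1 (\<lambda>u. v1 u \<cdot> \<eta>1 u) (\<lambda>g. x g \<cdot> \<rho> g)"
      unfolding regauge_def
    proof (intro conjI ballI)
      fix g assume g: "g \<in> simplices H 1"
      show "x g \<cdot> \<rho> g \<in> carrier N"
        using \<rho>(1)[OF g] xin[OF g] by simp
      show "t g = c (x g \<cdot> \<rho> g) \<otimes>\<^bsub>A\<^esub> t1 g"
        using \<rho>[OF g] xin[OF g] by (simp add: M.c_mult M.c_Z)
    next
      show "x (pg_one H) \<cdot> \<rho> (pg_one H) = \<one>\<^bsub>N\<^esub>"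
        using x1 rg by (simp add: regauge_def)
    next
      fix u assume u: "u \<in> simplices H 2"
      let ?e = "edge H 2 u"
      let ?a = "act (?e 0 1) (x (?e 1 2))"
      have e: "?e 0 1 \<in> simplices H 1" "?e 1 2 \<in> simplices H 1" "?e 0 2 \<in> simplices H 1"
        using u by simp_all
      have t1: "t1 (?e 0 1) \<in> carrier A"
        using pre_twisting_pairD(1)[OF pre1 e(1)] .
      have a: "?a = t1 (?e 0 1) 1 (x (?e 1 2))" "?a \<in> ZSet M"
        by (rule act_eq[OF ind1 e(1) t1 xin[OF e(2)]]) (rule act_in[OF e(1) xin[OF e(2)]])
      note Z = xin[OF e(1)] xin[OF e(2)] xin[OF e(3)] v1in[OF u] vin[OF u] a(2)
      note Nin = \<rho>(1)[OF e(1)] \<rho>(1)[OF e(2)] \<rho>(1)[OF e(3)] pre_twisting_pairD(2)[OF pre u] pre_twisting_pairD(2)[OF pre1 u]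
      interpret Z: comm_group "ZGroup M" by (rule M.Z_comm_group)
      have vx: "v u \<cdot> x (?e 0 2) = (x (?e 0 1) \<cdot> ?a) \<cdot> v1 u"
      proof -
        have "v u \<cdot> x (?e 0 2) = (x (?e 0 1) \<cdot> ?a) \<cdot> v1 u \<cdot> (x (?e 0 2) \<cdot> inv\<^bsub>N\<^esub> x (?e 0 2))"
          unfolding x(2)[OF u] codiff_1[OF x(1) u] using Z Z.m_ac
          by (simp del: M.N.r_inv M.N.l_inv M.N.Units_r_inv M.N.Units_l_inv Z.r_inv Z.l_inv Z.Units_r_inv Z.Units_l_inv)
        then show ?thesis using Z by simp
      qed
      have "(v u \<cdot> \<eta> u) \<cdot> (x (?e 0 2) \<cdot> \<rho> (?e 0 2)) =
          (v u \<cdot> x (?e 0 2)) \<cdot> (\<eta> u \<cdot> \<rho> (?e 0 2))"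
        using Z Nin by (intro M.Z_mult_mult) simp_all
      also have "\<eta> u \<cdot> \<rho> (?e 0 2) = (\<rho> (?e 0 1) \<cdot> t1 (?e 0 1) 1 (\<rho> (?e 1 2))) \<cdot> \<eta>1 u"
        using rg u by (simp add: regauge_def)
      also have "(v u \<cdot> x (?e 0 2)) \<cdot> ((\<rho> (?e 0 1) \<cdot> t1 (?e 0 1) 1 (\<rho> (?e 1 2))) \<cdot> \<eta>1 u) =
          ((x (?e 0 1) \<cdot> ?a) \<cdot> (\<rho> (?e 0 1) \<cdot> t1 (?e 0 1) 1 (\<rho> (?e 1 2)))) \<cdot> (v1 u \<cdot> \<eta>1 u)"
        unfolding vx by (rule M.Z_mult_mult[symmetric]) (use Z Nin t1 in simp_all)
      also have "(x (?e 0 1) \<cdot> ?a) \<cdot> (\<rho> (?e 0 1) \<cdot> t1 (?e 0 1) 1 (\<rho> (?e 1 2))) =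
          (x (?e 0 1) \<cdot> \<rho> (?e 0 1)) \<cdot> (?a \<cdot> t1 (?e 0 1) 1 (\<rho> (?e 1 2)))"
        by (rule M.Z_mult_mult[symmetric]) (use Z Nin t1 in simp_all)
      also have "?a \<cdot> t1 (?e 0 1) 1 (\<rho> (?e 1 2)) = t1 (?e 0 1) 1 (x (?e 1 2) \<cdot> \<rho> (?e 1 2))"
        unfolding a(1) using Z Nin t1 by (simp add: M.aut_N_mult)
      finally show "(v u \<cdot> \<eta> u) \<cdot> (x (?e 0 2) \<cdot> \<rho> (?e 0 2)) =
          (x (?e 0 1) \<cdot> \<rho> (?e 0 1)) \<cdot> t1 (?e 0 1) 1 (x (?e 1 2) \<cdot> \<rho> (?e 1 2)) \<cdot> (v1 u \<cdot> \<eta>1 u)" .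
    qed
    then show "D = cls t (\<lambda>u. v u \<cdot> \<eta> u)"
      using tw_class_eq_iff[OF tw_v tw_v1] 1(5) by blast
  qed
  then show ?thesis
    using C by (simp add: ext_action_def M.mult_N)
qed

lemma group_action: "group_action (cohomology M H \<alpha> 2) E (ext_action M H \<alpha>)"
proof (rule group_actionI[OF cohomology_group])
  fix V assume V: "V \<in> carrier (cohomology M H \<alpha> 2)"
  show "ext_action M H \<alpha> V \<in> extensional E"
    by (simp add: ext_action_def)
  obtain v where v: "v \<in> V" "normalized M H v"
    using cohomology_normalized[OF V] .
  have vc: "v \<in> cocycles M H \<alpha> 2"
    using cohomology_coset(2)[OF V v(1)] .
  fix C assume "C \<in> E"
  then obtain t \<eta> where C: "C = cls t \<eta>" and tw: "twisting_pair M H t \<eta>" and ind: "inducing t"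
    using ext_classes_eq by blast
  have tw_v: "twisting_pair M H t (\<lambda>u. v u \<cdot> \<eta> u)"
    by (rule twisting_change[OF tw ind vc v(2)]) simp
  show "ext_action M H \<alpha> V C \<in> E"
    unfolding C ext_action_cls[OF tw ind V v] using tw_v ind ext_classes_eq by blast
  fix W assume W: "W \<in> carrier (cohomology M H \<alpha> 2)"
  obtain w where w: "w \<in> W" "normalized M H w"
    using cohomology_normalized[OF W] .
  have wc: "w \<in> cocycles M H \<alpha> 2"
    using cohomology_coset(2)[OF W w(1)] .
  let ?wv = "w \<otimes>\<^bsub>cochain_group M H 2\<^esub> v"
  have WV: "W \<otimes>\<^bsub>cohomology M H \<alpha> 2\<^esub> V \<in> carrier (cohomology M H \<alpha> 2)"
    using cohomology_group V W by (simp add: group.is_monoid monoid.m_closed)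
  have wv: "?wv \<in> W \<otimes>\<^bsub>cohomology M H \<alpha> 2\<^esub> V" "normalized M H ?wv"
    using v w by (auto simp: cohomology_def set_mult_def mult_cocycle_group normalized_iff cochain_mult)
  have wvc: "?wv \<in> cocycles M H \<alpha> 2"
    using cohomology_coset(2)[OF WV wv(1)] .
  have tw_wv: "twisting_pair M H t (\<lambda>u. ?wv u \<cdot> \<eta> u)"
    by (rule twisting_change[OF tw ind wvc wv(2)]) simp
  have tw_w_v: "twisting_pair M H t (\<lambda>u. w u \<cdot> (v u \<cdot> \<eta> u))"
    by (rule twisting_change[OF tw_v ind wc w(2)]) simp
  have "cls t (\<lambda>u. ?wv u \<cdot> \<eta> u) = cls t (\<lambda>u. w u \<cdot> (v u \<cdot> \<eta> u))"
  proof (rule tw_class_cong[OF tw_wv tw_w_v])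
    fix u assume u: "u \<in> simplices H 2"
    have "pre_twisting_pair M H t \<eta>"
      using tw by (simp add: twisting_pair_def)
    then show "?wv u \<cdot> \<eta> u = w u \<cdot> (v u \<cdot> \<eta> u)"
      using u pre_twisting_pairD(2) cochain_in[OF cocyclesD(1)[OF vc] u] cochain_in[OF cocyclesD(1)[OF wc] u]
      by (simp add: cochain_mult M.N.m_assoc)
  qed
  then show "ext_action M H \<alpha> (W \<otimes>\<^bsub>cohomology M H \<alpha> 2\<^esub> V) C = ext_action M H \<alpha> W (ext_action M H \<alpha> V C)"
    unfolding C ext_action_cls[OF tw ind V v] ext_action_cls[OF tw_v ind W w] ext_action_cls[OF tw ind WV wv] .
next
  fix C assume "C \<in> E"
  then obtain t \<eta> where C: "C = cls t \<eta>" and tw: "twisting_pair M H t \<eta>" and ind: "inducing t"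
    using ext_classes_eq by blast
  have pre: "pre_twisting_pair M H t \<eta>"
    using tw by (simp add: twisting_pair_def)
  let ?one = "\<one>\<^bsub>cochain_group M H 2\<^esub>"
  have 1: "\<one>\<^bsub>cohomology M H \<alpha> 2\<^esub> \<in> carrier (cohomology M H \<alpha> 2)"
    using cohomology_group by (simp add: group.is_monoid monoid.one_closed)
  have e: "?one \<in> \<one>\<^bsub>cohomology M H \<alpha> 2\<^esub>" "normalized M H ?one"
    using subgroup.one_closed[OF coboundaries_2_subgroup] by (simp_all add: cohomology_one normalized_iff cochain_one)
  have tw1: "twisting_pair M H t (\<lambda>u. ?one u \<cdot> \<eta> u)"
    by (rule twisting_change[OF tw ind cohomology_coset(2)[OF 1 e(1)] e(2)]) simp
  show "ext_action M H \<alpha> \<one>\<^bsub>cohomology M H \<alpha> 2\<^esub> C = C"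
    unfolding C ext_action_cls[OF tw ind 1 e]
    by (rule tw_class_cong[OF tw1 tw]) (use pre_twisting_pairD(2)[OF pre] in \<open>simp add: cochain_one\<close>)
qed

text \<open>A fixed class yields a \<rho> from (t, v \<eta>) to (t, \<eta>). As \<open>t\<close> is
  unchanged, c(\<rho>(g)) is trivial and \<rho> is a central 1-cochain; the relation between the two
  cochains then reads v = \<delta>\<rho>.\<close>

lemma free_action: "free_action (cohomology M H \<alpha> 2) E (ext_action M H \<alpha>)"
proof -
  let ?G = "cohomology M H \<alpha> 2"
  have "V = \<one>\<^bsub>?G\<^esub>" if V: "V \<in> carrier ?G" and C: "C \<in> E" and fix': "ext_action M H \<alpha> V C = C" for V C
  proof -
    obtain v where v: "v \<in> V" "normalized M H v"
      using cohomology_normalized[OF V] .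
    have vc: "v \<in> cocycles M H \<alpha> 2"
      using cohomology_coset(2)[OF V v(1)] .
    obtain t \<eta> where Ct: "C = cls t \<eta>" and tw: "twisting_pair M H t \<eta>" and ind: "inducing t"
      using ext_classes_eq C by blast
    have pre: "pre_twisting_pair M H t \<eta>"
      using tw by (simp add: twisting_pair_def)
    have tw_v: "twisting_pair M H t (\<lambda>u. v u \<cdot> \<eta> u)"
      by (rule twisting_change[OF tw ind vc v(2)]) simp
    obtain \<rho> where rg: "regauge M H t (\<lambda>u. v u \<cdot> \<eta> u) t \<eta> \<rho>"
      using fix' tw_class_eq_iff[OF tw_v tw] unfolding Ct ext_action_cls[OF tw ind V v] by blast
    define x where "x = restrict \<rho> (simplices H 1)"
    have xin: "x g \<in> ZSet M" if g: "g \<in> simplices H 1" for g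
    proof (rule M.ZI)
      have \<rho>: "\<rho> g \<in> carrier N" "t g = c (\<rho> g) \<otimes>\<^bsub>A\<^esub> t g"
        using rg g by (auto simp: regauge_def)
      show "x g \<in> carrier N"
        using \<rho> g by (simp add: x_def)
      have "c (\<rho> g) = \<one>\<^bsub>A\<^esub>"
        using M.A.r_cancel_one'[of "t g" "c (\<rho> g)"] \<rho> pre_twisting_pairD(1)[OF pre g] by simp
      then show "c (x g) = \<one>\<^bsub>A\<^esub>"
        using g by (simp add: x_def)
    qed
    have x_eq: "x g = \<rho> g" if "g \<in> simplices H 1" for g
      using that by (simp add: x_def)
    have x: "x \<in> carrier (cochain_group M H 1)"
      using xin by (auto simp: cochain_carrier PiE_iff x_def)
    have "v = codiff M H \<alpha> 1 x"
    proof (rule cochain_eqI[OF cocyclesD(1)[OF vc] codiff_1_in[OF x]])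
      fix u assume u: "u \<in> simplices H 2"
      let ?e = "edge H 2 u"
      have e: "?e 0 1 \<in> simplices H 1" "?e 1 2 \<in> simplices H 1" "?e 0 2 \<in> simplices H 1"
        using u by simp_all
      let ?a = "act (?e 0 1) (x (?e 1 2))"
      have a: "?a = t (?e 0 1) 1 (x (?e 1 2))" "?a \<in> ZSet M"
        by (rule act_eq[OF ind e(1) pre_twisting_pairD(1)[OF pre e(1)] xin[OF e(2)]])
          (rule act_in[OF e(1) xin[OF e(2)]])
      have \<eta>: "\<eta> u \<in> carrier N"
        using pre_twisting_pairD(2)[OF pre u] .
      note Z = xin[OF e(1)] xin[OF e(2)] xin[OF e(3)] a(2) cochain_in[OF cocyclesD(1)[OF vc] u]
      have "(v u \<cdot> \<eta> u) \<cdot> x (?e 0 2) = x (?e 0 1) \<cdot> ?a \<cdot> \<eta> u"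
        unfolding a(1) using rg u e by (simp add: regauge_def x_eq)
      moreover have "(v u \<cdot> \<eta> u) \<cdot> x (?e 0 2) = (v u \<cdot> x (?e 0 2)) \<cdot> \<eta> u"
        using Z \<eta> M.Z_central[of "x (?e 0 2)" "\<eta> u"] by (simp add: M.N.m_assoc)
      ultimately have "v u \<cdot> x (?e 0 2) = x (?e 0 1) \<cdot> ?a"
        using Z \<eta> by simp
      then have "v u = x (?e 0 1) \<cdot> ?a \<cdot> inv\<^bsub>N\<^esub> x (?e 0 2)"
        using Z by (simp add: M.N.inv_solve_right)
      also have "\<dots> = codiff M H \<alpha> 1 x u"
      proof -
        interpret Z: comm_group "ZGroup M" by (rule M.Z_comm_group)
        show ?thesis
          unfolding codiff_1[OF x u] using Z Z.m_ac by simp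
      qed
      finally show "v u = codiff M H \<alpha> 1 x u" .
    qed
    then have "v \<in> coboundaries M H \<alpha> 2"
      using x by (simp add: coboundaries_2)
    then show ?thesis
      unfolding cohomology_one cohomology_coset(1)[OF V v(1)]
      using group.coset_join2[OF comm_group.axioms(2)[OF cocycle_comm_group] _ coboundaries_subgroup_cocycle]
        vc by (simp add: carrier_cocycle_group)
  qed
  moreover have "\<one>\<^bsub>?G\<^esub> \<in> carrier ?G" "ext_action M H \<alpha> \<one>\<^bsub>?G\<^esub> C = C" if "C \<in> E" for C
    using group_action.id_eq_one[OF group_action] that cohomology_group
    by (simp_all add: group.is_monoid monoid.one_closed) (metis restrict_apply')
  ultimately show ?thesis
    unfolding free_action_def stabilizer_def using group_action by blast
qed

text \<open>Moving the first class along \<rho> gives it the same \<open>t\<close> as the second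
  without leaving the class. The remaining central difference \<open>v\<close> is a cocycle because
  both obstruction cochains are trivial.\<close>

lemma transitive_action: "transitive_action (cohomology M H \<alpha> 2) E (ext_action M H \<alpha>)"
proof (intro transitive_action.intro transitive_action_axioms.intro group_action)
  fix C D assume CD: "C \<in> E" "D \<in> E"
  obtain t' \<eta>' where C: "C = cls t' \<eta>'" and tw': "twisting_pair M H t' \<eta>'" and ind': "inducing t'"
    using ext_classes_eq CD(1) by blast
  obtain t \<eta> where D: "D = cls t \<eta>" and tw: "twisting_pair M H t \<eta>" and ind: "inducing t"
    using ext_classes_eq CD(2) by blast
  have pre: "pre_twisting_pair M H t \<eta>" and pre': "pre_twisting_pair M H t' \<eta>'"
    using tw tw' by (simp_all add: twisting_pair_def)
  obtain \<rho> \<eta>'' v where *: "pre_twisting_pair M H t \<eta>''" "regauge M H t \<eta>'' t' \<eta>' \<rho>"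
    "\<And>u. u \<in> simplices H 3 \<Longrightarrow> obstruction_cochain M H t \<eta>'' u = obstruction_cochain M H t' \<eta>' u"
    "v \<in> carrier (cochain_group M H 2)" "normalized M H v"
    "\<And>u. u \<in> simplices H 2 \<Longrightarrow> \<eta> u = v u \<cdot> \<eta>'' u"
    "\<And>u. u \<in> simplices H 3 \<Longrightarrow>
      obstruction_cochain M H t \<eta> u \<cdot> codiff M H \<alpha> 2 v u = obstruction_cochain M H t' \<eta>' u"
    by (rule compare_pre_twisting_pairs[OF pre ind pre' ind']) (rule that, assumption+)
  have tw'': "twisting_pair M H t \<eta>''"
    using *(1,3) tw' by (simp add: obstruction_one_iff)
  have C'': "C = cls t \<eta>''"
    using tw_class_eq_iff[OF tw'' tw'] *(2) C by blast
  have "codiff M H \<alpha> 2 v = \<one>\<^bsub>cochain_group M H 3\<^esub>"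
  proof (rule cochain_eqI[OF codiff_2_in[OF *(4)]])
    show "\<one>\<^bsub>cochain_group M H 3\<^esub> \<in> carrier (cochain_group M H 3)"
      by (auto simp: cochain_one cochain_carrier)
    fix u assume u: "u \<in> simplices H 3"
    show "codiff M H \<alpha> 2 v u = \<one>\<^bsub>cochain_group M H 3\<^esub> u"
      using *(7)[OF u] u tw tw' cochain_in[OF codiff_2_in[OF *(4)] u]
      by (simp add: obstruction_one_iff cochain_one)
  qed
  then have vc: "v \<in> cocycles M H \<alpha> 2"
    using *(4) by (simp add: cocycles_2 kernel_def)
  define V where "V = coboundaries M H \<alpha> 2 #>\<^bsub>cocycle_group M H \<alpha> 2\<^esub> v"
  have V: "V \<in> carrier (cohomology M H \<alpha> 2)"
    unfolding V_def by (rule cohomologyI[OF vc])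
  have vV: "v \<in> V"
    unfolding V_def using group.rcos_self[OF comm_group.axioms(2)[OF cocycle_comm_group] _ coboundaries_subgroup_cocycle]
      vc by (simp add: carrier_cocycle_group)
  have tw_v: "twisting_pair M H t (\<lambda>u. v u \<cdot> \<eta>'' u)"
    by (rule twisting_change[OF tw'' ind vc *(5)]) simp
  have "ext_action M H \<alpha> V C = D"
    unfolding C'' D ext_action_cls[OF tw'' ind V vV *(5)]
    by (rule tw_class_cong[OF tw_v tw]) (simp add: *(6))
  then show "\<exists>V\<in>carrier (cohomology M H \<alpha> 2). ext_action M H \<alpha> V C = D"
    using V by blast
qed

end

text \<open>The injection \<open>enc\<close> makes \<open>'e\<close> large enough to hold a copy of
  every twisted product, so that each equivalence class is represented over it.\<close>

theorem theorem4p11: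
  fixes M :: "'m sset" and H :: "'h sset"
    and \<alpha> :: "nat \<Rightarrow> 'h \<Rightarrow> (nat \<Rightarrow> 'm \<Rightarrow> 'm) set list"
    and enc :: "('m \<times> 'h) list \<Rightarrow> 'e"
  assumes "partial_group M" and "partial_group H" and "outer_action M H \<alpha>"
    and "inj enc"
  shows "((ext_classes M H \<alpha> :: ('m, 'h, 'e) ext set set) \<noteq> {} \<longleftrightarrow>
            obstruction_class M H \<alpha> = \<one>\<^bsub>cohomology M H \<alpha> 3\<^esub>) \<and>
         ((ext_classes M H \<alpha> :: ('m, 'h, 'e) ext set set) \<noteq> {} \<longrightarrow>
            free_action (cohomology M H \<alpha> 2)
              (ext_classes M H \<alpha> :: ('m, 'h, 'e) ext set set) (ext_action M H \<alpha>) \<and>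
            transitive_action (cohomology M H \<alpha> 2)
              (ext_classes M H \<alpha> :: ('m, 'h, 'e) ext set set) (ext_action M H \<alpha>))"
proof -
  interpret outer_act_enc M H \<alpha> enc
    by unfold_locales (use assms in \<open>simp_all add: partial_group_def\<close>)
  have "(ext_classes M H \<alpha> :: ('m, 'h, 'e) ext set set) \<noteq> {} \<longleftrightarrow> (\<exists>t \<eta>. twisting_pair M H t \<eta> \<and> inducing t)"
    unfolding ext_classes_eq by blast
  then show ?thesis
    using obstruction_class_one_iff free_action transitive_action by blast
qed

end
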